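(* For a represented space $(X,\rho)$ the following are equivalent: (1) $(X,\rho)$ computably embeds into the Hilbert cube $[0,1]^{\mathbb{N}}$; (2) $(X,\rho)$ computably embeds into some computable metric space; (3) $(X,\rho)$ is computably second countable and strongly computably regular.
   Context: A represented space $(X,\rho)$ is a set with a partial surjection $\rho:\subseteq\mathbb{N}^{\mathbb{N}}\to X$, with computability via realizers on names and the final topology on $X$. $\mathcal{O}(X)$: open sets represented by names of their characteristic maps into Sierpiński space $\mathbb{S}$ ($c_{\mathbb{S}}(0^\omega)=0$, otherwise $1$); $\mathcal{A}_-(X)$: closed sets, named by $\mathcal{O}(X)$-names of their complements; $\mathcal{O}(\mathbb{N})$-names are enumerations. $(X,\rho)$ computably embeds into $(Y,\tau)$ if there is a computable injection $X\to Y$ with a computable partial inverse defined on its image. The Hilbert cube carries its standard (product Cauchy) representation; computable metric spaces carry their Cauchy representation. $(X,\rho)$ is computably second countable if there is a sequence $(B_i)$ of subsets forming a classical subbase, with $x\mapsto\{i:x\in B_i\}$ injective and every point in some $B_i$, such that $\rho$ is computably equivalent to the representation whose names of $x$ are enumerations of $\{i: x\in B_i\}$. $(X,\rho)$ is strongly computably regular if the multifunction $P:\mathcal{O}(X)\rightrightarrows\mathcal{O}(X)^{\mathbb{N}}\times\mathcal{A}_-(X)^{\mathbb{N}}$, $O\mapsto\{(U_n,V_n)_n: \forall n,\ U_n\subseteq V_n\subseteq O,\ O=\bigcup_n U_n\}$, is well defined and computable. *)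

theory Defs
  imports "HOL-Analysis.Analysis" "HOL-Library.Nat_Bijection"
begin

section \<open>Computable partial functions on Baire space\<close>

text \<open>
  The partial recursive functionals \<open>\<Phi>(p, n)\<close> with a function argument \<open>p\<close> and a number argument
  \<open>n\<close>: Kleene's schemes for unary partial recursive functions (arguments are tupled with
  \<^const>\<open>prod_encode\<close>), where in addition values of \<open>p\<close> may be queried. These are the functionals
  computed by machines that have random access to the infinite sequence \<open>p\<close>.
\<close>

inductive recursive_functional :: "((nat \<Rightarrow> nat) \<Rightarrow> nat \<Rightarrow> nat option) \<Rightarrow> bool" where
  rf_zero: "recursive_functional (\<lambda>p n. Some 0)"
| rf_succ: "recursive_functional (\<lambda>p n. Some (Suc n))"
| rf_fst: "recursive_functional (\<lambda>p n. Some (fst (prod_decode n)))"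
| rf_snd: "recursive_functional (\<lambda>p n. Some (snd (prod_decode n)))"
| rf_query: "recursive_functional (\<lambda>p n. Some (p n))"
| rf_pair: "\<lbrakk>recursive_functional F; recursive_functional G\<rbrakk> \<Longrightarrow>
    recursive_functional (\<lambda>p n. Option.bind (F p n) (\<lambda>a.
      Option.bind (G p n) (\<lambda>b. Some (prod_encode (a, b)))))"
| rf_comp: "\<lbrakk>recursive_functional F; recursive_functional G\<rbrakk> \<Longrightarrow>
    recursive_functional (\<lambda>p n. Option.bind (G p n) (F p))"
| rf_prim_rec: "\<lbrakk>recursive_functional F; recursive_functional G\<rbrakk> \<Longrightarrow>
    recursive_functional (\<lambda>p n. case prod_decode n of (a, k) \<Rightarrow>
      rec_nat (F p a)
        (\<lambda>i r. Option.bind r (\<lambda>v. G p (prod_encode (a, prod_encode (i, v))))) k)"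
| rf_mu: "recursive_functional F \<Longrightarrow>
    recursive_functional (\<lambda>p n.
      if \<exists>k. F p (prod_encode (n, k)) = Some 0 \<and>
             (\<forall>j<k. \<exists>m. F p (prod_encode (n, j)) = Some (Suc m))
      then Some (LEAST k. F p (prod_encode (n, k)) = Some 0)
      else None)"

definition computable_baire :: "((nat \<Rightarrow> nat) \<Rightarrow> (nat \<Rightarrow> nat) option) \<Rightarrow> bool" where
  "computable_baire F \<longleftrightarrow>
    (\<exists>\<Phi>. recursive_functional \<Phi> \<and> (\<forall>p q. F p = Some q \<longrightarrow> (\<forall>n. \<Phi> p n = Some (q n))))"


section \<open>Represented spaces\<close>

text \<open>
  A represented space \<open>(X, \<rho>)\<close> is given by the partial map \<open>\<rho>\<close> alone, its underlying set being
  \<open>X = ran \<rho>\<close>; a point of \<open>X\<close> is named by every \<open>p\<close> with \<open>\<rho> p = Some x\<close>.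
\<close>

type_synonym 'a representation = "(nat \<Rightarrow> nat) \<Rightarrow> 'a option"

text \<open>A multifunction \<open>P\<close> has as its domain the points \<open>x\<close> with \<open>P x \<noteq> {}\<close>.\<close>

definition computable_multi ::
  "'a representation \<Rightarrow> 'b representation \<Rightarrow> ('a \<Rightarrow> 'b set) \<Rightarrow> bool" where
  "computable_multi \<rho> \<tau> P \<longleftrightarrow>
    (\<exists>F. computable_baire F \<and>
      (\<forall>p x. \<rho> p = Some x \<and> P x \<noteq> {} \<longrightarrow> (\<exists>q y. F p = Some q \<and> \<tau> q = Some y \<and> y \<in> P x)))"

definition computable_on ::
  "'a representation \<Rightarrow> 'b representation \<Rightarrow> 'a set \<Rightarrow> ('a \<Rightarrow> 'b) \<Rightarrow> bool" where
  "computable_on \<rho> \<tau> D f \<longleftrightarrow> computable_multi \<rho> \<tau> (\<lambda>x. if x \<in> D then {f x} else {})"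

definition computably_equivalent :: "'a representation \<Rightarrow> 'a representation \<Rightarrow> bool" where
  "computably_equivalent \<rho> \<tau> \<longleftrightarrow>
    ran \<rho> = ran \<tau> \<and> computable_on \<rho> \<tau> (ran \<rho>) id \<and> computable_on \<tau> \<rho> (ran \<tau>) id"

definition computably_embeds :: "'a representation \<Rightarrow> 'b representation \<Rightarrow> bool" where
  "computably_embeds \<rho> \<tau> \<longleftrightarrow>
    (\<exists>f. inj_on f (ran \<rho>) \<and> f ` ran \<rho> \<subseteq> ran \<tau> \<and>
         computable_on \<rho> \<tau> (ran \<rho>) f \<and>
         computable_on \<tau> \<rho> (f ` ran \<rho>) (inv_into (ran \<rho>) f))"

text \<open>The final topology of \<open>\<rho>\<close>, where \<open>dom \<rho>\<close> is a subspace of Baire space (the product topology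
  on \<^typ>\<open>nat \<Rightarrow> nat\<close>).\<close>

definition final_topology :: "'a representation \<Rightarrow> 'a topology" where
  "final_topology \<rho> = topology (\<lambda>U. U \<subseteq> ran \<rho> \<and>
     openin (top_of_set (dom \<rho>)) {p \<in> dom \<rho>. the (\<rho> p) \<in> U})"

lemma openin_final_topology:
  "openin (final_topology \<rho>) U \<longleftrightarrow>
    U \<subseteq> ran \<rho> \<and> openin (top_of_set (dom \<rho>)) {p \<in> dom \<rho>. the (\<rho> p) \<in> U}"
proof -
  let ?P = "\<lambda>U. {p \<in> dom \<rho>. the (\<rho> p) \<in> U}"
  have Int: "?P (S \<inter> T) = ?P S \<inter> ?P T" for S T by auto
  have Un: "?P (\<Union>K) = \<Union>(?P ` K)" for K by auto
  have "istopology (\<lambda>U. U \<subseteq> ran \<rho> \<and> openin (top_of_set (dom \<rho>)) (?P U))"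
    unfolding istopology_def Int Un by (auto intro!: openin_Int openin_Union)
  then show ?thesis
    by (simp add: final_topology_def topology_inverse')
qed

lemma topspace_final_topology: "topspace (final_topology \<rho>) = ran \<rho>"
proof -
  have "{p \<in> dom \<rho>. the (\<rho> p) \<in> ran \<rho>} = dom \<rho>"
    by (auto simp: ran_def)
  then have "openin (final_topology \<rho>) (ran \<rho>)"
    by (simp add: openin_final_topology)
  then show ?thesis
    by (metis openin_final_topology openin_subset openin_topspace subset_antisym)
qed


subsection \<open>Constructions of representations\<close>

text \<open>The representation given by a naming relation \<open>N\<close>, which is meant to be single-valued.\<close>

definition rep_of :: "((nat \<Rightarrow> nat) \<Rightarrow> 'a \<Rightarrow> bool) \<Rightarrow> 'a representation" where
  "rep_of N p = (if \<exists>!x. N p x then Some (THE x. N p x) else None)"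

lemma rep_of_eq_Some: "rep_of N p = Some x \<longleftrightarrow> N p x \<and> (\<forall>y. N p y \<longrightarrow> y = x)"
proof (cases "\<exists>!x. N p x")
  case True
  then show ?thesis
    unfolding rep_of_def by (metis option.inject the_equality)
next
  case False
  then show ?thesis
    unfolding rep_of_def by (metis option.distinct(1))
qed

definition restrict_rep :: "'a representation \<Rightarrow> 'a set \<Rightarrow> 'a representation" where
  "restrict_rep \<rho> A p = (case \<rho> p of None \<Rightarrow> None | Some x \<Rightarrow> if x \<in> A then Some x else None)"

definition pair_rep :: "'a representation \<Rightarrow> 'b representation \<Rightarrow> ('a \<times> 'b) representation" where
  "pair_rep \<rho> \<tau> p =
    Option.bind (\<rho> (\<lambda>n. p (2 * n))) (\<lambda>x.
      Option.bind (\<tau> (\<lambda>n. p (2 * n + 1))) (\<lambda>y. Some (x, y)))"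

text \<open>The countable power of a represented space.\<close>

definition seq_rep :: "'a representation \<Rightarrow> (nat \<Rightarrow> 'a) representation" where
  "seq_rep \<rho> p =
    (if \<forall>i. \<rho> (\<lambda>n. p (prod_encode (i, n))) \<noteq> None
     then Some (\<lambda>i. the (\<rho> (\<lambda>n. p (prod_encode (i, n))))) else None)"

definition nat_rep :: "nat representation" where
  "nat_rep p = Some (p 0)"

text \<open>Enumerations: a value \<open>0\<close> of \<open>p\<close> carries no information, so that the empty set has a name.\<close>

definition enumerated_set :: "(nat \<Rightarrow> nat) \<Rightarrow> nat set" where
  "enumerated_set p = {i. \<exists>k. p k = Suc i}"

text \<open>Sierpinski space, with \<open>True\<close> as its open point.\<close>

definition sierpinski_rep :: "bool representation" where
  "sierpinski_rep p = Some (p \<noteq> (\<lambda>_. 0))"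


subsection \<open>Function names, open and closed sets\<close>

text \<open>
  Application in Kleene's second algebra. A name \<open>\<alpha>\<close> of a partial continuous function tells, for
  each position \<open>n\<close> and each finite prefix of the argument \<open>p\<close>, whether the prefix determines the
  \<open>n\<close>-th output value (answer \<open>v + 1\<close>, where \<open>v\<close> is that value) or not (answer \<open>0\<close>).
\<close>

definition kleene_app :: "(nat \<Rightarrow> nat) \<Rightarrow> (nat \<Rightarrow> nat) \<Rightarrow> (nat \<Rightarrow> nat) option" where
  "kleene_app \<alpha> p =
    (let a = (\<lambda>n k. \<alpha> (list_encode (n # map p [0..<k])))
     in if \<forall>n. \<exists>k. a n k \<noteq> 0 then Some (\<lambda>n. a n (LEAST k. a n k \<noteq> 0) - 1) else None)"

definition names_map ::
  "'a representation \<Rightarrow> 'b representation \<Rightarrow> (nat \<Rightarrow> nat) \<Rightarrow> ('a \<Rightarrow> 'b) \<Rightarrow> bool" where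
  "names_map \<rho> \<tau> \<alpha> f \<longleftrightarrow>
    (\<forall>p x. \<rho> p = Some x \<longrightarrow> (\<exists>q. kleene_app \<alpha> p = Some q \<and> \<tau> q = Some (f x)))"

definition open_rep :: "'a representation \<Rightarrow> 'a set representation" where
  "open_rep \<rho> = rep_of (\<lambda>\<alpha> U.
    openin (final_topology \<rho>) U \<and> names_map \<rho> sierpinski_rep \<alpha> (\<lambda>x. x \<in> U))"

lemma open_rep_eq_Some:
  "open_rep \<rho> \<alpha> = Some U \<longleftrightarrow>
    openin (final_topology \<rho>) U \<and> names_map \<rho> sierpinski_rep \<alpha> (\<lambda>x. x \<in> U)"
proof -
  have *: "U \<subseteq> V"
    if "openin (final_topology \<rho>) U" "names_map \<rho> sierpinski_rep \<alpha> (\<lambda>x. x \<in> U)"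
       "names_map \<rho> sierpinski_rep \<alpha> (\<lambda>x. x \<in> V)" for U V
  proof
    fix x assume "x \<in> U"
    with that(1) obtain p where "\<rho> p = Some x"
      by (auto simp: openin_final_topology ran_def)
    with that(2,3) \<open>x \<in> U\<close> show "x \<in> V"
      unfolding names_map_def by (metis option.inject)
  qed
  show ?thesis
    unfolding open_rep_def rep_of_eq_Some by (auto dest: *)
qed

definition closed_rep :: "'a representation \<Rightarrow> 'a set representation" where
  "closed_rep \<rho> \<alpha> = map_option (\<lambda>U. ran \<rho> - U) (open_rep \<rho> \<alpha>)"


subsection \<open>Metric spaces and the Hilbert cube\<close>

text \<open>Names are rapidly converging sequences of (indices of) points of the sequence \<open>a\<close>.\<close>

definition cauchy_rep ::
  "'a set \<Rightarrow> ('a \<Rightarrow> 'a \<Rightarrow> real) \<Rightarrow> (nat \<Rightarrow> 'a) \<Rightarrow> 'a representation" where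
  "cauchy_rep M d a = rep_of (\<lambda>p x.
    (\<forall>i j. i < j \<longrightarrow> d (a (p i)) (a (p j)) \<le> (1 / 2) ^ i) \<and>
    limitin (Metric_space.mtopology M d) (\<lambda>n. a (p n)) x sequentially)"

lemma cauchy_rep_eq_Some:
  assumes "Metric_space M d"
  shows "cauchy_rep M d a p = Some x \<longleftrightarrow>
    (\<forall>i j. i < j \<longrightarrow> d (a (p i)) (a (p j)) \<le> (1 / 2) ^ i) \<and>
    limitin (Metric_space.mtopology M d) (\<lambda>n. a (p n)) x sequentially"
  unfolding cauchy_rep_def rep_of_eq_Some
  using Metric_space.limitin_metric_unique[OF assms] trivial_limit_sequentially by blast

definition rat_enum :: "nat \<Rightarrow> real" where
  "rat_enum n = (case prod_decode n of (m, k) \<Rightarrow> case prod_decode m of (i, j) \<Rightarrow>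
     (real i - real j) / real (k + 1))"

definition real_rep :: "real representation" where
  "real_rep = cauchy_rep UNIV dist rat_enum"

definition computable_metric_space ::
  "'a set \<Rightarrow> ('a \<Rightarrow> 'a \<Rightarrow> real) \<Rightarrow> (nat \<Rightarrow> 'a) \<Rightarrow> bool" where
  "computable_metric_space M d a \<longleftrightarrow>
    Metric_space M d \<and> range a \<subseteq> M \<and> Metric_space.mtopology M d closure_of range a = M \<and>
    computable_on (pair_rep nat_rep nat_rep) real_rep UNIV (\<lambda>(i, j). d (a i) (a j))"

text \<open>The carrier of the Hilbert cube is the set of all \<open>x :: nat \<Rightarrow> real\<close> with values in \<open>[0, 1]\<close>.\<close>

definition hilbert_cube_rep :: "(nat \<Rightarrow> real) representation" where
  "hilbert_cube_rep = seq_rep (restrict_rep real_rep {0..1})"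


section \<open>Computable second countability and strong computable regularity\<close>

definition subbase_rep :: "'a set \<Rightarrow> (nat \<Rightarrow> 'a set) \<Rightarrow> 'a representation" where
  "subbase_rep X B = rep_of (\<lambda>p x. x \<in> X \<and> enumerated_set p = {i. x \<in> B i})"

definition computably_second_countable :: "'a representation \<Rightarrow> bool" where
  "computably_second_countable \<rho> \<longleftrightarrow>
    (\<exists>B :: nat \<Rightarrow> 'a set.
      (\<forall>i. B i \<subseteq> ran \<rho>) \<and>
      topology_generated_by (range B) = final_topology \<rho> \<and>
      inj_on (\<lambda>x. {i. x \<in> B i}) (ran \<rho>) \<and>
      (\<forall>x \<in> ran \<rho>. \<exists>i. x \<in> B i) \<and>
      computably_equivalent \<rho> (subbase_rep (ran \<rho>) B))"

definition regular_shrinkings ::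
  "'a representation \<Rightarrow> 'a set \<Rightarrow> ((nat \<Rightarrow> 'a set) \<times> (nat \<Rightarrow> 'a set)) set" where
  "regular_shrinkings \<rho> W =
    {(U, V). (\<forall>n. openin (final_topology \<rho>) (U n) \<and> closedin (final_topology \<rho>) (V n)) \<and>
             (\<forall>n. U n \<subseteq> V n \<and> V n \<subseteq> W) \<and> W = (\<Union>n. U n)}"

definition strongly_computably_regular :: "'a representation \<Rightarrow> bool" where
  "strongly_computably_regular \<rho> \<longleftrightarrow>
    (\<forall>W. openin (final_topology \<rho>) W \<longrightarrow> regular_shrinkings \<rho> W \<noteq> {}) \<and>
    computable_multi (open_rep \<rho>)
      (pair_rep (seq_rep (open_rep \<rho>)) (seq_rep (closed_rep \<rho>)))
      (regular_shrinkings \<rho>)"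

end

theory Submission
  imports Defs
begin

text \<open>
  The Hilbert cube is itself a computable metric space, so (1) implies (2). It remains to see that
  (2) implies (3) and (3) implies (1).

  Every partial recursive functional has a total recursive approximation on finite words, so a
  realizer can be run on the finite prefixes of a name. For (2) to (3) let \<open>O\<close> be an open set. A
  finite word that the given name of \<open>O\<close> accepts determines a finite intersection of open balls
  contained in \<open>O\<close>, and \<open>O\<close> is the union of these intersections; shrinking the radii
  by \<open>2\<^sup>-\<^sup>m\<close> gives \<open>U\<^sub>n\<close> (strict inequalities) and \<open>V\<^sub>n\<close> (weak ones).

  For (3) to (1), regularity is applied only to the finite intersections \<open>B\<^sub>K\<close> of subbasic sets. As
  every open set \<open>G\<close> is a union of such \<open>B\<^sub>K\<close>, this already yields effective normality: if
  \<open>G \<union> H = X\<close>, then \<open>\<Union>\<^sub>m (U\<^sub>m - \<Union>\<^bsub>m' \<le> m\<^esub> V'\<^bsub>m'\<^esub>)\<close> and its mirror image are disjoint and cover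
  \<open>X - H\<close> and \<open>X - G\<close>, where the \<open>U\<^sub>m \<subseteq> V\<^sub>m\<close> exhaust \<open>G\<close> and the \<open>U'\<^sub>m \<subseteq> V'\<^sub>m\<close> exhaust \<open>H\<close>. Dyadic
  iteration gives computable Urysohn functions that vanish outside \<open>B\<^sub>i\<close> and equal \<open>1\<close> on \<open>U\<^sub>n\<close>;
  together they embed \<open>X\<close> into the Hilbert cube.
\<close>

section \<open>Total computable functions\<close>

text \<open>Dyadic iteration produces new open sets at every stage, and running the regularity
  realizer on them would feed it names that depend on all stages before. Shrinking only basic sets
  replaces the realizer by one fixed table of decidable predicates on finite words, and every later
  open set is given by such a predicate as well. Basic sets suffice by a prepending argument: a
  finite list of indices of sets containing x can be put in front of any enumeration for x, so a
  predicate that accepts a word K holds at all points of \<open>cyl K\<close>.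

  The same argument for Cauchy names needs room, because the entries of a name must be close to each
  other and not only to the limit. Hence the radii \<open>(1 / 2) ^ (t + 2)\<close> on the metric
  side.

  Predicates on enumerations need not be monotone. It is enough that each positive answer is correct
  and that all long prefixes are accepted, so that finitely many conditions hold on a common
  prefix.\<close>

definition pfst :: "nat \<Rightarrow> nat" where "pfst n = fst (prod_decode n)"
definition psnd :: "nat \<Rightarrow> nat" where "psnd n = snd (prod_decode n)"

lemma pfst_prod_encode [simp]: "pfst (prod_encode (a, b)) = a" by (simp add: pfst_def)
lemma psnd_prod_encode [simp]: "psnd (prod_encode (a, b)) = b" by (simp add: psnd_def)
lemma prod_encode_pfst_psnd [simp]: "prod_encode (pfst n, psnd n) = n"
  by (simp add: pfst_def psnd_def)

text \<open>The sequence p stays an oracle, so one predicate covers number functions (which ignore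
  p) and total operators on Baire space.\<close>

definition tot :: "((nat \<Rightarrow> nat) \<Rightarrow> nat \<Rightarrow> nat) \<Rightarrow> bool" where
  "tot f \<longleftrightarrow> recursive_functional (\<lambda>p n. Some (f p n))"

definition dec :: "((nat \<Rightarrow> nat) \<Rightarrow> nat \<Rightarrow> bool) \<Rightarrow> bool" where
  "dec P \<longleftrightarrow> tot (\<lambda>p n. if P p n then 1 else 0)"

lemma tot_pair: "tot f \<Longrightarrow> tot g \<Longrightarrow> tot (\<lambda>p n. prod_encode (f p n, g p n))"
  unfolding tot_def by (drule (1) rf_pair) simp

lemma tot_id: "tot (\<lambda>p n. n)"
  unfolding tot_def using rf_pair[OF rf_fst rf_snd] by simp

lemma tot_comp: "tot f \<Longrightarrow> tot g \<Longrightarrow> tot (\<lambda>p n. f p (g p n))"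
  unfolding tot_def by (drule (1) rf_comp) simp

lemma tot_comp2:
  "tot (\<lambda>p n. T (pfst n) (psnd n)) \<Longrightarrow> tot f \<Longrightarrow> tot g \<Longrightarrow> tot (\<lambda>p n. T (f p n) (g p n))"
  using tot_comp[of "\<lambda>p n. T (pfst n) (psnd n)", OF _ tot_pair] by simp

lemma tot_zero: "tot (\<lambda>p n. 0)"
  unfolding tot_def by (rule rf_zero)

lemma tot_Suc: "tot f \<Longrightarrow> tot (\<lambda>p n. Suc (f p n))"
  using tot_comp[of "\<lambda>p n. Suc n" f] unfolding tot_def by (simp add: rf_succ)

lemma tot_const: "tot (\<lambda>p n. c)"
  by (induction c) (simp_all add: tot_zero tot_Suc)

lemma tot_pfst: "tot f \<Longrightarrow> tot (\<lambda>p n. pfst (f p n))"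
  using tot_comp[of "\<lambda>p n. pfst n" f] unfolding tot_def by (simp add: rf_fst pfst_def)

lemma tot_psnd: "tot f \<Longrightarrow> tot (\<lambda>p n. psnd (f p n))"
  using tot_comp[of "\<lambda>p n. psnd n" f] unfolding tot_def by (simp add: rf_snd psnd_def)

lemma tot_query: "tot f \<Longrightarrow> tot (\<lambda>p n. p (f p n))"
  using tot_comp[of "\<lambda>p n. p n" f] unfolding tot_def by (simp add: rf_query)

lemma tot_rec:
  assumes "tot b" "tot f" "tot (\<lambda>p m. g p (pfst m) (pfst (psnd m)) (psnd (psnd m)))"
  shows "tot (\<lambda>p n. rec_nat (f p n) (\<lambda>i r. g p n i r) (b p n))"
proof -
  have *: "rec_nat (Some x) (\<lambda>i r. Option.bind r (\<lambda>v. Some (h i v))) k = Some (rec_nat x h k)"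
    for x h k by (induction k) auto
  have "tot (\<lambda>p n. rec_nat (f p (pfst n)) (\<lambda>i r. g p (pfst n) i r) (psnd n))"
    using rf_prim_rec[OF assms(2,3)[unfolded tot_def]]
    unfolding tot_def by (simp add: case_prod_unfold * flip: pfst_def psnd_def)
  from tot_comp[OF this tot_pair[OF tot_id assms(1)]] show ?thesis by simp
qed

lemma tot_add: assumes "tot f" "tot g" shows "tot (\<lambda>p n. f p n + g p n)"
proof -
  have "rec_nat x (\<lambda>i r. Suc r) k = x + k" for x k by (induction k) auto
  moreover have "tot (\<lambda>p n. rec_nat (f p n) (\<lambda>i r. Suc r) (g p n))"
    by (intro tot_rec assms tot_Suc tot_psnd tot_id)
  ultimately show ?thesis by simp
qed

lemma tot_mult: assumes "tot f" "tot g" shows "tot (\<lambda>p n. f p n * g p n)"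
proof -
  have "rec_nat 0 (\<lambda>i r. r + x) k = x * k" for x k :: nat by (induction k) auto
  moreover have "tot (\<lambda>p n. rec_nat 0 (\<lambda>i r. r + f p n) (g p n))"
    by (intro tot_rec assms tot_add tot_psnd tot_id tot_zero tot_comp[OF assms(1) tot_pfst])
  ultimately show ?thesis by simp
qed

lemma tot_power: assumes "tot g" shows "tot (\<lambda>p n. c ^ g p n)"
proof -
  have "rec_nat (Suc 0) (\<lambda>i r. r * c) k = c ^ k" for k :: nat by (induction k) auto
  moreover have "tot (\<lambda>p n. rec_nat (Suc 0) (\<lambda>i r. r * c) (g p n))"
    by (intro tot_rec assms tot_mult tot_psnd tot_id tot_const)
  ultimately show ?thesis by simp
qed

lemma tot_diff: assumes "tot f" "tot g" shows "tot (\<lambda>p n. f p n - g p n)"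
proof -
  have 1: "rec_nat 0 (\<lambda>i r. i) k = k - 1" for k :: nat by (induction k) auto
  have "tot (\<lambda>p n. rec_nat 0 (\<lambda>i r. i) n)"
    by (intro tot_rec tot_psnd tot_pfst tot_id tot_zero)
  then have pred: "tot (\<lambda>p n. n - 1)" by (simp add: 1)
  have "rec_nat x (\<lambda>i r. r - 1) k = x - k" for x k :: nat by (induction k) auto
  moreover have "tot (\<lambda>p n. rec_nat (f p n) (\<lambda>i r. r - 1) (g p n))"
    by (intro tot_rec assms tot_comp[OF pred] tot_psnd tot_id)
  ultimately show ?thesis by simp
qed

lemma dec_eq_0: assumes "tot f" shows "dec (\<lambda>p n. f p n = 0)"
proof -
  have "tot (\<lambda>p n. 1 - f p n)" by (intro tot_diff assms tot_const)
  moreover have "(\<lambda>p n. 1 - f p n) = (\<lambda>p n. if f p n = 0 then 1 else 0)"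
    by (auto simp: fun_eq_iff)
  ultimately show ?thesis by (simp add: dec_def)
qed

lemma dec_le: "tot f \<Longrightarrow> tot g \<Longrightarrow> dec (\<lambda>p n. f p n \<le> g p n)"
  using dec_eq_0[OF tot_diff[of f g]] by simp

lemma dec_not: assumes "dec P" shows "dec (\<lambda>p n. \<not> P p n)"
  using dec_eq_0[OF assms[unfolded dec_def]]
  by (rule back_subst[of dec]) (simp add: fun_eq_iff)

lemma dec_conj: assumes "dec P" "dec Q" shows "dec (\<lambda>p n. P p n \<and> Q p n)"
proof -
  have "(\<lambda>p n. (if P p n then 1 else 0) * (if Q p n then 1 else (0::nat)))
      = (\<lambda>p n. if P p n \<and> Q p n then 1 else 0)"
    by (auto simp: fun_eq_iff)
  with tot_mult[OF assms[unfolded dec_def]] show ?thesis by (simp add: dec_def)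
qed

lemma dec_disj: "dec P \<Longrightarrow> dec Q \<Longrightarrow> dec (\<lambda>p n. P p n \<or> Q p n)"
  using dec_not[OF dec_conj[OF dec_not[of P] dec_not[of Q]]] by simp

lemma dec_imp: "dec P \<Longrightarrow> dec Q \<Longrightarrow> dec (\<lambda>p n. P p n \<longrightarrow> Q p n)"
  unfolding imp_conv_disj by (intro dec_disj dec_not)

lemma dec_less: "tot f \<Longrightarrow> tot g \<Longrightarrow> dec (\<lambda>p n. f p n < g p n)"
  using dec_not[OF dec_le[of g f]] by (simp add: not_le)

lemma dec_eq: "tot f \<Longrightarrow> tot g \<Longrightarrow> dec (\<lambda>p n. f p n = g p n)"
  using dec_conj[OF dec_le[of f g] dec_le[of g f]] by (simp flip: eq_iff)

lemma tot_if: assumes "dec P" "tot f" "tot g" shows "tot (\<lambda>p n. if P p n then f p n else g p n)"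
proof -
  have "tot (\<lambda>p n. (if P p n then 1 else 0) * f p n + (1 - (if P p n then 1 else 0)) * g p n)"
    by (intro tot_add tot_mult tot_diff tot_const assms assms[unfolded dec_def])
  moreover have "(\<lambda>p n. (if P p n then 1 else 0) * f p n + (1 - (if P p n then 1 else 0)) * g p n)
     = (\<lambda>p n. if P p n then f p n else g p n)" by (auto simp: fun_eq_iff)
  ultimately show ?thesis by simp
qed

lemma dec_if: "dec P \<Longrightarrow> dec Q \<Longrightarrow> dec R \<Longrightarrow> dec (\<lambda>p n. if P p n then Q p n else R p n)"
  using dec_disj[OF dec_conj[of P Q] dec_conj[OF dec_not[of P], of R]]
  by (rule back_subst[of dec]) (auto simp: fun_eq_iff)

lemma dec_const: "dec (\<lambda>p n. c)"
  unfolding dec_def by (rule tot_const)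

lemma dec_comp: "dec P \<Longrightarrow> tot g \<Longrightarrow> dec (\<lambda>p n. P p (g p n))"
  unfolding dec_def by (rule tot_comp)

lemma dec_ex_less:
  assumes "tot b" "dec (\<lambda>p m. P p (pfst m) (psnd m))"
  shows "dec (\<lambda>p n. \<exists>k < b p n. P p n k)"
proof -
  have 1: "(rec_nat 0 (\<lambda>i r. if Q i then 1 else r) k = (0::nat)) \<longleftrightarrow> \<not> (\<exists>i<k. Q i)" for Q and k :: nat
    by (induction k) (auto simp: less_Suc_eq simp del: One_nat_def)
  have "dec (\<lambda>p m. P p (pfst m) (pfst (psnd m)))"
    using dec_comp[OF assms(2), of "\<lambda>p m. prod_encode (pfst m, pfst (psnd m))"]
    by (simp add: tot_pair tot_pfst tot_psnd tot_id)
  then have "tot (\<lambda>p n. rec_nat 0 (\<lambda>i r. if P p n i then 1 else r) (b p n))"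
    by (intro tot_rec assms(1) tot_if tot_const tot_psnd tot_id) auto
  from dec_not[OF dec_eq_0[OF this]] show ?thesis by (simp add: 1)
qed

lemma dec_all_less:
  assumes "tot b" "dec (\<lambda>p m. P p (pfst m) (psnd m))"
  shows "dec (\<lambda>p n. \<forall>k < b p n. P p n k)"
  using dec_not[OF dec_ex_less[OF assms(1) dec_not[OF assms(2)]]] by simp

lemma dec_all_le:
  assumes "tot b" "dec (\<lambda>p m. P p (pfst m) (psnd m))"
  shows "dec (\<lambda>p n. \<forall>k \<le> b p n. P p n k)"
  using dec_all_less[OF tot_Suc[OF assms(1)] assms(2)] by (simp add: less_Suc_eq_le)

lemma recursive_functional_search:
  assumes P: "dec (\<lambda>p m. P p (pfst m) (psnd m))" and f: "tot (\<lambda>p m. f p (pfst m) (psnd m))"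
  shows "recursive_functional (\<lambda>p n.
    if \<exists>k. P p n k then Some (f p n (LEAST k. P p n k)) else None)"
proof -
  let ?F = "\<lambda>p m. Some (if \<not> P p (pfst m) (psnd m) then 1 else 0 :: nat)"
  have "recursive_functional ?F"
    using dec_not[OF P] by (simp add: dec_def tot_def)
  note 1 = rf_mu[OF this]
  \<comment> \<open>\<open>?F\<close> is total and vanishes exactly where \<open>P\<close> holds, so
    the side condition of the search says that no earlier k satisfies \<open>P\<close>; the least k
    always meets it.\<close>
  have iff: "(\<exists>k. ?F p (prod_encode (n, k)) = Some 0 \<and>
             (\<forall>j<k. \<exists>m. ?F p (prod_encode (n, j)) = Some (Suc m))) \<longleftrightarrow> (\<exists>k. P p n k)" for p n
    by (auto, meson exists_least_iff)
  have *: "(?F p (prod_encode (n, k)) = Some 0) = P p n k" for p n k by simp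
  from 1 have "recursive_functional (\<lambda>p n. if \<exists>k. P p n k then Some (LEAST k. P p n k) else None)"
    unfolding iff unfolding * .
  from rf_pair[OF tot_id[unfolded tot_def] this]
  have "recursive_functional (\<lambda>p n. if \<exists>k. P p n k then Some (prod_encode (n, LEAST k. P p n k)) else None)"
    by (rule back_subst[of recursive_functional]) (auto simp: fun_eq_iff)
  from rf_comp[OF f[unfolded tot_def] this] show ?thesis
    by (rule back_subst[of recursive_functional]) (auto simp: fun_eq_iff)
qed

lemma tot_Least:
  assumes "dec (\<lambda>p m. P p (pfst m) (psnd m))" "\<And>p n. \<exists>k. P p n k"
  shows "tot (\<lambda>p n. LEAST k. P p n k)"
  using recursive_functional_search[OF assms(1), of "\<lambda>p n k. k"] assms(2)
  by (simp add: tot_def tot_psnd[OF tot_id, unfolded tot_def])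

named_theorems comp_intros
lemmas [comp_intros] = tot_id tot_pair tot_const tot_Suc tot_pfst tot_psnd tot_query tot_add tot_mult
  tot_power tot_diff tot_if tot_rec dec_le dec_less dec_eq dec_not dec_conj dec_disj dec_imp dec_if
  dec_const dec_ex_less dec_all_less dec_all_le

lemma tot_div: assumes "tot f" "c > 0" shows "tot (\<lambda>p n. f p n div c)"
proof -
  have ex: "n < c * Suc (n div c)" for n
    using dividend_less_times_div[OF assms(2), of n] by simp
  have least: "(LEAST k. n < c * Suc k) = n div c" for n
  proof (rule Least_equality, rule ex)
    fix k assume "n < c * Suc k"
    then have "n div c < Suc k" by (metis less_mult_imp_div_less mult.commute)
    then show "n div c \<le> k" by simp
  qed
  have "tot (\<lambda>p n. LEAST k. n < c * Suc k)"
    by (intro tot_Least comp_intros) (use ex in blast)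
  then have "tot (\<lambda>p n. n div c)" by (simp only: least)
  from tot_comp[OF this assms(1)] show ?thesis .
qed

lemma dec_even: assumes "tot f" shows "dec (\<lambda>p n. even (f p n))"
proof -
  have "dec (\<lambda>p n. f p n = 2 * (f p n div 2))"
    by (intro comp_intros assms tot_div) simp
  moreover have "(\<lambda>p n. f p n = 2 * (f p n div 2)) = (\<lambda>p n. even (f p n))"
    by (intro ext) (metis dvd_mult_div_cancel dvd_triv_left)
  ultimately show ?thesis by simp
qed

lemmas [comp_intros] = dec_even

section \<open>Finite words\<close>

text \<open>A nonempty word is the successor of a pair code, hence the subtraction of 1. The empty
  word 0 is its own tail because 0 codes the pair (0, 0); reading beyond the end therefore yields
  0.\<close>

definition ctl :: "nat \<Rightarrow> nat" where "ctl c = psnd (c - 1)"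
definition ent :: "nat \<Rightarrow> nat \<Rightarrow> nat" where "ent c i = pfst (rec_nat c (\<lambda>_. ctl) i - 1)"
definition len :: "nat \<Rightarrow> nat" where "len c = (LEAST k. rec_nat c (\<lambda>_. ctl) k = 0)"
definition pre :: "(nat \<Rightarrow> nat) \<Rightarrow> nat \<Rightarrow> nat" where "pre p k = list_encode (map p [0..<k])"

lemma pfst_0 [simp]: "pfst 0 = 0" and psnd_0 [simp]: "psnd 0 = 0"
  using prod_encode_pfst_psnd[of 0] pfst_prod_encode[of 0 0] psnd_prod_encode[of 0 0]
  by (simp_all add: prod_encode_def)

lemma ctl_iterate: "rec_nat (list_encode xs) (\<lambda>_. ctl) i = list_encode (drop i xs)"
proof (induction i)
  case (Suc i)
  have "ctl (list_encode ys) = list_encode (tl ys)" for ys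
    by (cases ys) (simp_all add: ctl_def)
  with Suc show ?case by (simp add: drop_Suc tl_drop)
qed simp

lemma list_encode_eq_0 [simp]: "list_encode xs = 0 \<longleftrightarrow> xs = []"
  by (cases xs) auto

lemma len_list_encode [simp]: "len (list_encode xs) = length xs"
  unfolding len_def ctl_iterate by (rule Least_equality) auto

lemma ent_list_encode [simp]: "ent (list_encode xs) i = (if i < length xs then xs ! i else 0)"
proof -
  have "pfst (list_encode ys - 1) = (if ys = [] then 0 else hd ys)" for ys
    by (cases ys) simp_all
  then show ?thesis unfolding ent_def ctl_iterate by (simp add: hd_drop_conv_nth)
qed

lemma len_pre [simp]: "len (pre p k) = k"
  and ent_pre [simp]: "ent (pre p k) i = (if i < k then p i else 0)"
  by (simp_all add: pre_def)

lemma pre_ent_len [simp]: "pre (ent c) (len c) = c"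
proof -
  obtain xs where "c = list_encode xs" by (metis list_decode_inverse)
  moreover from this have "map (ent c) [0..<len c] = map ((!) xs) [0..<length xs]" by simp
  ultimately show ?thesis by (simp add: pre_def map_nth)
qed

lemma pre_cong: "(\<And>i. i < k \<Longrightarrow> p i = q i) \<Longrightarrow> pre p k = pre q k"
  unfolding pre_def by (rule arg_cong[where f = list_encode]) simp

lemma pre_eq_iff: "pre p k = pre q l \<longleftrightarrow> k = l \<and> (\<forall>i<k. p i = q i)"
  by (metis ent_pre len_pre pre_cong)

lemma pre_0 [simp]: "pre p 0 = 0"
  by (simp add: pre_def)

lemma tot_ent: assumes "tot f" "tot g" shows "tot (\<lambda>p n. ent (f p n) (g p n))"
  unfolding ent_def ctl_def
  by (intro comp_intros assms)

lemma tot_len: assumes "tot f" shows "tot (\<lambda>p n. len (f p n))"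
proof -
  have "tot (\<lambda>p n. len n)"
    unfolding len_def ctl_def
  proof (rule tot_Least)
    show "\<exists>k. rec_nat n (\<lambda>_ c. psnd (c - 1)) k = 0" for n
      using ctl_iterate[of "list_decode n" "length (list_decode n)"]
      by (auto simp: ctl_def[abs_def])
  qed (intro comp_intros)
  from tot_comp[OF this assms] show ?thesis .
qed

lemma tot_pre:
  assumes "tot b" "tot (\<lambda>p m. f p (pfst m) (psnd m))"
  shows "tot (\<lambda>p n. pre (f p n) (b p n))"
proof -
  \<comment> \<open>Prepending a letter is the only operation on codes, so the word is built from
    its last letter backwards: after i steps it holds the last i letters.\<close>
  have eq: "rec_nat 0 (\<lambda>i r. Suc (prod_encode (h (k - 1 - i), r))) i = list_encode (map h [k - i..<k])"
    if "i \<le> k" for h k i using that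
  proof (induction i)
    case (Suc i)
    then have "k - Suc i < k" and *: "Suc (k - Suc i) = k - i" by auto
    then have "[k - Suc i..<k] = (k - Suc i) # [k - i..<k]"
      by (simp add: upt_conv_Cons)
    with Suc show ?case by simp
  qed simp
  have f: "tot (\<lambda>p m. f p (g p m) (h p m))" if "tot g" "tot h" for g h
    using tot_comp[OF assms(2) tot_pair[OF that]] by simp
  have "tot (\<lambda>p n. rec_nat 0 (\<lambda>i r. Suc (prod_encode (f p n (b p n - 1 - i), r))) (b p n))"
    by (intro comp_intros f assms tot_comp[OF assms(1)])
  moreover have "pre h k = rec_nat 0 (\<lambda>i r. Suc (prod_encode (h (k - 1 - i), r))) k" for h k
    by (subst eq) (simp_all add: pre_def)
  ultimately show ?thesis by simp
qed

lemmas [comp_intros] = tot_ent tot_len tot_pre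

section \<open>Approximation on finite prefixes\<close>

text \<open>\<open>T\<close> does not see the oracle, so this is ordinary recursiveness of a total
  function of two numbers. Such a function can be applied to words that are themselves
  computed.\<close>

definition rec2 :: "(nat \<Rightarrow> nat \<Rightarrow> nat) \<Rightarrow> bool" where
  "rec2 T \<longleftrightarrow> tot (\<lambda>p n. T (pfst n) (psnd n))"

lemma tot_rec2:
  "rec2 T \<Longrightarrow> tot f \<Longrightarrow> tot g \<Longrightarrow> tot (\<lambda>p n. T (f p n) (g p n))"
  unfolding rec2_def by (rule tot_comp2)

text \<open>The value 0 means that no answer is available yet. A single answer may be withdrawn on a
  longer word, but it is never wrong, and on each sequence with a defined value the answers are
  eventually permanent.\<close>

definition approximates ::
  "(nat \<Rightarrow> nat \<Rightarrow> nat) \<Rightarrow> ((nat \<Rightarrow> nat) \<Rightarrow> nat \<Rightarrow> nat option) \<Rightarrow> bool" where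
  "approximates T \<Phi> \<longleftrightarrow>
     (\<forall>p k n v. T (pre p k) n = Suc v \<longrightarrow> \<Phi> p n = Some v) \<and>
     (\<forall>p n v. \<Phi> p n = Some v \<longrightarrow> (\<forall>\<^sub>F k in sequentially. T (pre p k) n = Suc v))"

lemma approximatesI:
  assumes "\<And>p k n v. T (pre p k) n = Suc v \<Longrightarrow> \<Phi> p n = Some v"
    and "\<And>p n v. \<Phi> p n = Some v \<Longrightarrow> \<forall>\<^sub>F k in sequentially. T (pre p k) n = Suc v"
  shows "approximates T \<Phi>"
  using assms unfolding approximates_def by blast

lemma approximatesD:
  assumes "approximates T \<Phi>"
  shows "T (pre p k) n = Suc v \<Longrightarrow> \<Phi> p n = Some v"
    and "\<Phi> p n = Some v \<Longrightarrow> \<forall>\<^sub>F k in sequentially. T (pre p k) n = Suc v"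
  using assms unfolding approximates_def by blast+

text \<open>A converging computation inspects only finitely many values of p. Each scheme passes a
  missing intermediate result on as 0, and finitely many eventual answers are eventually available
  together.\<close>

theorem recursive_functional_approximable:
  assumes "recursive_functional \<Phi>"
  shows "\<exists>T. rec2 T \<and> approximates T \<Phi>"
  using assms
proof induction
  case rf_zero
  have "rec2 (\<lambda>w n. 1)" unfolding rec2_def by (intro comp_intros)
  moreover have "approximates (\<lambda>w n. 1) (\<lambda>p n. Some 0)" by (simp add: approximates_def)
  ultimately show ?case by blast
next
  case rf_succ
  have "rec2 (\<lambda>w n. Suc (Suc n))" unfolding rec2_def by (intro comp_intros)
  moreover have "approximates (\<lambda>w n. Suc (Suc n)) (\<lambda>p n. Some (Suc n))" by (simp add: approximates_def)
  ultimately show ?case by blast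
next
  case rf_fst
  have "rec2 (\<lambda>w n. Suc (pfst n))" unfolding rec2_def by (intro comp_intros)
  moreover have "approximates (\<lambda>w n. Suc (pfst n)) (\<lambda>p n. Some (fst (prod_decode n)))"
    by (simp add: approximates_def pfst_def)
  ultimately show ?case by blast
next
  case rf_snd
  have "rec2 (\<lambda>w n. Suc (psnd n))" unfolding rec2_def by (intro comp_intros)
  moreover have "approximates (\<lambda>w n. Suc (psnd n)) (\<lambda>p n. Some (snd (prod_decode n)))"
    by (simp add: approximates_def psnd_def)
  ultimately show ?case by blast
next
  case rf_query
  let ?T = "\<lambda>w n. if n < len w then Suc (ent w n) else 0"
  have "rec2 ?T" unfolding rec2_def by (intro comp_intros)
  moreover have "approximates ?T (\<lambda>p n. Some (p n))"
    by (rule approximatesI)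
      (auto split: if_splits intro: eventually_mono[OF eventually_gt_at_top])
  ultimately show ?case by blast
next
  case (rf_pair F G)
  then obtain TF TG where T: "rec2 TF" "rec2 TG"
    and F: "approximates TF F" and G: "approximates TG G" by blast
  let ?T = "\<lambda>w n. if TF w n = 0 \<or> TG w n = 0 then 0 else Suc (prod_encode (TF w n - 1, TG w n - 1))"
  have "rec2 ?T" unfolding rec2_def by (intro comp_intros T[THEN tot_rec2])
  moreover have "approximates ?T (\<lambda>p n. Option.bind (F p n) (\<lambda>a.
      Option.bind (G p n) (\<lambda>b. Some (prod_encode (a, b)))))"
  proof (rule approximatesI)
    fix p k n v assume "?T (pre p k) n = Suc v"
    then obtain a b where "TF (pre p k) n = Suc a" "TG (pre p k) n = Suc b" "v = prod_encode (a, b)"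
      by (auto split: if_splits simp: not0_implies_Suc) (metis Suc_pred)
    then show "Option.bind (F p n) (\<lambda>a. Option.bind (G p n) (\<lambda>b. Some (prod_encode (a, b)))) = Some v"
      using approximatesD(1)[OF F] approximatesD(1)[OF G] by simp
  next
    fix p n v
    assume "Option.bind (F p n) (\<lambda>a. Option.bind (G p n) (\<lambda>b. Some (prod_encode (a, b)))) = Some v"
    then obtain a b where "F p n = Some a" "G p n = Some b" "v = prod_encode (a, b)"
      by (auto simp: Option.bind_eq_Some_conv)
    with approximatesD(2)[OF F, of p n a] approximatesD(2)[OF G, of p n b]
    show "\<forall>\<^sub>F k in sequentially. ?T (pre p k) n = Suc v"
      by (auto elim: eventually_elim2)
  qed
  ultimately show ?case by blast
next
  case (rf_comp F G)
  then obtain TF TG where T: "rec2 TF" "rec2 TG"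
    and F: "approximates TF F" and G: "approximates TG G" by blast
  let ?T = "\<lambda>w n. if TG w n = 0 then 0 else TF w (TG w n - 1)"
  have "rec2 ?T" unfolding rec2_def by (intro comp_intros T[THEN tot_rec2])
  moreover have "approximates ?T (\<lambda>p n. Option.bind (G p n) (F p))"
  proof (rule approximatesI)
    fix p k n v assume "?T (pre p k) n = Suc v"
    then obtain a where "TG (pre p k) n = Suc a" "TF (pre p k) a = Suc v"
      by (auto split: if_splits) (metis Suc_pred)
    then show "Option.bind (G p n) (F p) = Some v"
      using approximatesD(1)[OF F] approximatesD(1)[OF G] by simp
  next
    fix p n v assume "Option.bind (G p n) (F p) = Some v"
    then obtain a where "G p n = Some a" "F p a = Some v"
      by (auto simp: Option.bind_eq_Some_conv)
    with approximatesD(2)[OF F, of p a v] approximatesD(2)[OF G, of p n a]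
    show "\<forall>\<^sub>F k in sequentially. ?T (pre p k) n = Suc v"
      by (auto elim: eventually_elim2)
  qed
  ultimately show ?case by blast
next
  case (rf_prim_rec F G)
  then obtain TF TG where T: "rec2 TF" "rec2 TG"
    and F: "approximates TF F" and G: "approximates TG G" by blast
  let ?R = "\<lambda>w a. rec_nat (TF w a)
    (\<lambda>i r. if r = 0 then 0 else TG w (prod_encode (a, prod_encode (i, r - 1))))"
  let ?S = "\<lambda>p a. rec_nat (F p a)
    (\<lambda>i r. Option.bind r (\<lambda>v. G p (prod_encode (a, prod_encode (i, v)))))"
  have "rec2 (\<lambda>w n. ?R w (pfst n) (psnd n))" unfolding rec2_def by (intro comp_intros T[THEN tot_rec2])
  moreover have "?S p a i = Some v" if "?R (pre p k) a i = Suc v" for p k a i v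
    using that
  proof (induction i arbitrary: v)
    case 0
    then show ?case using approximatesD(1)[OF F] by simp
  next
    case (Suc i)
    show ?case
    proof (cases "?R (pre p k) a i")
      case 0
      with Suc.prems show ?thesis by simp
    next
      case (Suc u)
      with Suc.prems have "TG (pre p k) (prod_encode (a, prod_encode (i, u))) = Suc v" by simp
      from approximatesD(1)[OF G, OF this] Suc.IH[OF Suc] show ?thesis by simp
    qed
  qed
  moreover have "\<forall>\<^sub>F k in sequentially. ?R (pre p k) a i = Suc v" if "?S p a i = Some v" for p a i v
    using that
  proof (induction i arbitrary: v)
    case 0
    then show ?case using approximatesD(2)[OF F] by simp
  next
    case (Suc i)
    then obtain u where u: "?S p a i = Some u" "G p (prod_encode (a, prod_encode (i, u))) = Some v"
      by (auto simp: Option.bind_eq_Some_conv)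
    have "?R (pre p k) a (Suc i) = Suc v"
      if "?R (pre p k) a i = Suc u" "TG (pre p k) (prod_encode (a, prod_encode (i, u))) = Suc v" for k
      by (simp add: that)
    then show ?case
      by (rule eventually_elim2[OF Suc.IH[OF u(1)] approximatesD(2)[OF G, OF u(2)]])
  qed
  ultimately have "rec2 (\<lambda>w n. ?R w (pfst n) (psnd n)) \<and>
      approximates (\<lambda>w n. ?R w (pfst n) (psnd n)) (\<lambda>p n. ?S p (pfst n) (psnd n))"
    unfolding approximates_def by blast
  then show ?case unfolding case_prod_unfold pfst_def psnd_def by blast
next
  case (rf_mu F)
  then obtain TF where T: "rec2 TF" and F: "approximates TF F" by blast
  \<comment> \<open>The cut-off at \<open>len w\<close> keeps the search total. It stops at the
    first argument whose value is unanswered (0) or answered as zero (1), and only the second case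
    is a success.\<close>
  let ?P = "\<lambda>w n k. len w \<le> k \<or> TF w (prod_encode (n, k)) \<le> 1"
  let ?L = "\<lambda>w n. LEAST k. ?P w n k"
  let ?T = "\<lambda>w n. if ?L w n < len w \<and> TF w (prod_encode (n, ?L w n)) = 1 then Suc (?L w n) else 0"
  let ?Q = "\<lambda>p n k. F p (prod_encode (n, k)) = Some 0 \<and>
             (\<forall>j<k. \<exists>m. F p (prod_encode (n, j)) = Some (Suc m))"
  have least: "(LEAST k. F p (prod_encode (n, k)) = Some 0) = k" if "?Q p n k" for p n k
    using that by (intro Least_equality) (auto simp: not_less[symmetric])
  have "tot (\<lambda>p m. ?L (pfst m) (psnd m))"
    by (intro tot_Least comp_intros T[THEN tot_rec2]) auto
  then have "rec2 ?T" unfolding rec2_def by (intro comp_intros T[THEN tot_rec2])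
  moreover have "approximates ?T (\<lambda>p n. if \<exists>k. ?Q p n k
      then Some (LEAST k. F p (prod_encode (n, k)) = Some 0) else None)"
  proof (rule approximatesI)
    fix p k n v assume "?T (pre p k) n = Suc v"
    then have v: "?L (pre p k) n = v" "v < k" "TF (pre p k) (prod_encode (n, v)) = Suc 0"
      by (auto split: if_splits)
    have "\<not> ?P (pre p k) n j" if "j < v" for j
      using that unfolding v(1)[symmetric] by (rule not_less_Least)
    then have "\<exists>m. TF (pre p k) (prod_encode (n, j)) = Suc (Suc m)" if "j < v" for j
      using that by (metis One_nat_def Suc_leI le_0_eq le_SucE le_zero_eq not0_implies_Suc not_less_eq_eq)
    with approximatesD(1)[OF F] v(3) have Q: "?Q p n v" by blast
    with least[OF Q] show "(if \<exists>k. ?Q p n k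
      then Some (LEAST k. F p (prod_encode (n, k)) = Some 0) else None) = Some v" by auto
  next
    fix p n v assume "(if \<exists>k. ?Q p n k
      then Some (LEAST k. F p (prod_encode (n, k)) = Some 0) else None) = Some v"
    then obtain k where "?Q p n k" "v = (LEAST k. F p (prod_encode (n, k)) = Some 0)"
      by (auto split: if_splits)
    with least have Q: "?Q p n v" by metis
    have "\<forall>\<^sub>F k in sequentially. \<forall>j\<in>{..<v}. TF (pre p k) (prod_encode (n, j)) > 1"
    proof (rule eventually_ball_finite, simp, safe)
      fix j assume "j < v"
      with Q obtain m where "F p (prod_encode (n, j)) = Some (Suc m)" by blast
      from approximatesD(2)[OF F, OF this]
      show "\<forall>\<^sub>F k in sequentially. TF (pre p k) (prod_encode (n, j)) > 1"
        by (rule eventually_mono) simp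
    qed
    moreover have "\<forall>\<^sub>F k in sequentially. TF (pre p k) (prod_encode (n, v)) = Suc 0"
      using approximatesD(2)[OF F] Q by blast
    ultimately show "\<forall>\<^sub>F k in sequentially. ?T (pre p k) n = Suc v"
      using eventually_gt_at_top[of v]
    proof eventually_elim
      case (elim k)
      then have "?L (pre p k) n = v"
        by (intro Least_equality) (force simp: not_less[symmetric])+
      with elim show ?case by simp
    qed
  qed
  ultimately show ?case by blast
qed

text \<open>A value \<open>T w n = Suc v\<close> means that \<open>w\<close> determines the \<open>n\<close>-th output to be \<open>v\<close>; the value
  \<open>0\<close> means that \<open>w\<close> is still too short.\<close>

definition tracks :: "(nat \<Rightarrow> nat \<Rightarrow> nat) \<Rightarrow> (nat \<Rightarrow> nat) \<Rightarrow> (nat \<Rightarrow> nat) \<Rightarrow> bool" where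
  "tracks T p q \<longleftrightarrow> (\<forall>k n v. T (pre p k) n = Suc v \<longrightarrow> v = q n) \<and>
     (\<forall>n. \<forall>\<^sub>F k in sequentially. T (pre p k) n = Suc (q n))"

lemma tracksD:
  assumes "tracks T p q"
  shows "T (pre p k) n = Suc v \<Longrightarrow> v = q n"
    and "\<forall>\<^sub>F k in sequentially. T (pre p k) n = Suc (q n)"
  using assms unfolding tracks_def by blast+

lemma tracks_unique: assumes "tracks T p q" "tracks T p r" shows "q = r"
proof
  fix n
  from eventually_conj[OF tracksD(2)[OF assms(1), of n] tracksD(2)[OF assms(2), of n]]
  have "\<exists>k. T (pre p k) n = Suc (q n) \<and> T (pre p k) n = Suc (r n)"
    by (rule eventually_happens'[OF sequentially_bot])
  then show "q n = r n" by auto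
qed

lemma approximates_tracks:
  "approximates T \<Phi> \<Longrightarrow> (\<And>n. \<Phi> p n = Some (q n)) \<Longrightarrow> tracks T p q"
  unfolding tracks_def approximates_def by (metis option.inject)

lemma total_tracked: assumes "tot f" obtains T where "rec2 T" "\<And>p. tracks T p (f p)"
  using recursive_functional_approximable[OF assms[unfolded tot_def]] approximates_tracks by metis

lemma search_tracked:
  assumes "dec (\<lambda>p m. P p (pfst m) (psnd m))" "tot (\<lambda>p m. f p (pfst m) (psnd m))"
  obtains T where "rec2 T"
    "\<And>p. (\<And>n. \<exists>k. P p n k) \<Longrightarrow> tracks T p (\<lambda>n. f p n (LEAST k. P p n k))"
proof -
  obtain T where "rec2 T" and T: "approximates T (\<lambda>p n.
    if \<exists>k. P p n k then Some (f p n (LEAST k. P p n k)) else None)"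
    using recursive_functional_approximable[OF recursive_functional_search[OF assms]] by blast
  from approximates_tracks[OF T] show ?thesis by (intro that[OF \<open>rec2 T\<close>]) simp
qed

lemma computable_baire_tracked:
  assumes "computable_baire F"
  obtains T where "rec2 T" "\<And>p q. F p = Some q \<Longrightarrow> tracks T p q"
  using assms recursive_functional_approximable approximates_tracks
  unfolding computable_baire_def by metis

text \<open>Every answer of \<open>T\<close> on a prefix of p is correct as soon as p tracks
  anything, so the first prefix with a nonzero answer decides the value even if longer ones are
  unanswered again.\<close>

lemma tracked_computable_baire:
  assumes T: "rec2 T"
  shows "computable_baire (\<lambda>p. if \<exists>q. tracks T p q then Some (THE q. tracks T p q) else None)"
proof -
  let ?\<Phi> = "\<lambda>p n. if \<exists>k. T (pre p k) n \<noteq> 0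
    then Some (T (pre p (LEAST k. T (pre p k) n \<noteq> 0)) n - 1) else None"
  have "recursive_functional ?\<Phi>"
    by (intro recursive_functional_search comp_intros tot_rec2[OF T])
  moreover have val: "?\<Phi> p n = Some (q n)" if "tracks T p q" for p q n
  proof -
    from eventually_happens'[OF sequentially_bot tracksD(2)[OF that, of n]]
    obtain k where "T (pre p k) n = Suc (q n)" by blast
    then have ex: "\<exists>k. T (pre p k) n \<noteq> 0" by (metis nat.distinct(1))
    from LeastI_ex[OF this] tracksD(1)[OF that] have "T (pre p (LEAST k. T (pre p k) n \<noteq> 0)) n - 1 = q n"
      by (metis not0_implies_Suc diff_Suc_1)
    with ex show ?thesis by simp
  qed
  moreover have the: "(THE q. tracks T p q) = q" if "tracks T p q" for p q
    using that tracks_unique by blast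
  have "tracks T p q"
    if "(if \<exists>q. tracks T p q then Some (THE q. tracks T p q) else None) = Some q" for p q
    using that by (auto split: if_splits simp: the)
  ultimately show ?thesis unfolding computable_baire_def by blast
qed

lemma computable_multi_iff:
  "computable_multi \<rho> \<tau> P \<longleftrightarrow> (\<exists>T. rec2 T \<and>
     (\<forall>p x. \<rho> p = Some x \<and> P x \<noteq> {} \<longrightarrow> (\<exists>q y. tracks T p q \<and> \<tau> q = Some y \<and> y \<in> P x)))"
proof
  assume "computable_multi \<rho> \<tau> P"
  then obtain F where "computable_baire F" and F:
    "\<And>p x. \<rho> p = Some x \<and> P x \<noteq> {} \<Longrightarrow> \<exists>q y. F p = Some q \<and> \<tau> q = Some y \<and> y \<in> P x"
    unfolding computable_multi_def by blast
  from computable_baire_tracked[OF this(1)] obtain T where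
    "rec2 T" "\<And>p q. F p = Some q \<Longrightarrow> tracks T p q" by blast
  with F show "\<exists>T. rec2 T \<and>
     (\<forall>p x. \<rho> p = Some x \<and> P x \<noteq> {} \<longrightarrow> (\<exists>q y. tracks T p q \<and> \<tau> q = Some y \<and> y \<in> P x))"
    by meson
next
  assume "\<exists>T. rec2 T \<and>
     (\<forall>p x. \<rho> p = Some x \<and> P x \<noteq> {} \<longrightarrow> (\<exists>q y. tracks T p q \<and> \<tau> q = Some y \<and> y \<in> P x))"
  then obtain T where "rec2 T" and
    T: "\<And>p x. \<rho> p = Some x \<and> P x \<noteq> {} \<Longrightarrow> \<exists>q y. tracks T p q \<and> \<tau> q = Some y \<and> y \<in> P x" by blast
  let ?F = "\<lambda>p. if \<exists>q. tracks T p q then Some (THE q. tracks T p q) else None"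
  have "?F p = Some q" if "tracks T p q" for p q
    using that tracks_unique by (auto intro!: the_equality)
  with T tracked_computable_baire[OF \<open>rec2 T\<close>] show "computable_multi \<rho> \<tau> P"
    unfolding computable_multi_def by (intro exI[of _ ?F] conjI) meson+
qed

lemma computable_on_iff:
  "computable_on \<rho> \<tau> D f \<longleftrightarrow> (\<exists>T. rec2 T \<and>
     (\<forall>p x. \<rho> p = Some x \<and> x \<in> D \<longrightarrow> (\<exists>q. tracks T p q \<and> \<tau> q = Some (f x))))"
  unfolding computable_on_def computable_multi_iff by (simp, meson)

text \<open>The longest word that \<open>T\<close> can guarantee to be a prefix of the image, cut off at the length
  of the argument so that it is found by a bounded search.\<close>

definition img :: "(nat \<Rightarrow> nat \<Rightarrow> nat) \<Rightarrow> nat \<Rightarrow> nat" where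
  "img T w = pre (\<lambda>i. T w i - 1) (LEAST i. len w \<le> i \<or> T w i = 0)"

lemma img_tracks:
  assumes "tracks T p q"
  shows "img T (pre p k) = pre q (len (img T (pre p k)))"
proof -
  let ?l = "LEAST i. k \<le> i \<or> T (pre p k) i = 0"
  have "T (pre p k) i - 1 = q i" if "i < ?l" for i
    using not_less_Least[OF that] tracksD(1)[OF assms, of k i] by (metis not0_implies_Suc diff_Suc_1)
  then show ?thesis unfolding img_def by (simp add: pre_eq_iff)
qed

lemma len_img_tracks:
  assumes "tracks T p q"
  shows "filterlim (\<lambda>k. len (img T (pre p k))) at_top sequentially"
  unfolding filterlim_at_top
proof
  fix N
  have "\<forall>\<^sub>F k in sequentially. \<forall>i\<in>{..<N}. T (pre p k) i = Suc (q i)"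
    using tracksD(2)[OF assms] by (intro eventually_ball_finite) auto
  then show "\<forall>\<^sub>F k in sequentially. N \<le> len (img T (pre p k))"
    using eventually_ge_at_top[of N]
  proof eventually_elim
    case (elim k)
    define l where "l = (LEAST i. k \<le> i \<or> T (pre p k) i = 0)"
    have "k \<le> l \<or> T (pre p k) l = 0"
      unfolding l_def by (rule LeastI_ex) blast
    with elim have "N \<le> l" by (cases "l < N") auto
    then show ?case unfolding img_def by (simp add: l_def)
  qed
qed

lemma tracks_img:
  assumes "tracks T p q" "tracks S q r"
  shows "tracks (\<lambda>w. S (img T w)) p r"
  unfolding tracks_def
proof (intro conjI allI impI)
  fix k n v assume "S (img T (pre p k)) n = Suc v"
  with tracksD(1)[OF assms(2)] show "v = r n" by (metis img_tracks[OF assms(1)])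
next
  fix n
  from eventually_compose_filterlim[OF tracksD(2)[OF assms(2), of n] len_img_tracks[OF assms(1)]]
  show "\<forall>\<^sub>F k in sequentially. S (img T (pre p k)) n = Suc (r n)"
    by (simp flip: img_tracks[OF assms(1)])
qed

lemma tot_img: assumes "rec2 T" "tot f" shows "tot (\<lambda>p n. img T (f p n))"
proof -
  have "tot (\<lambda>p n. img T n)"
    unfolding img_def by (intro comp_intros tot_Least tot_rec2[OF assms(1)]) auto
  from tot_comp[OF this assms(2)] show ?thesis .
qed

lemma rec2_img: assumes "rec2 T" "rec2 S" shows "rec2 (\<lambda>w. S (img T w))"
  unfolding rec2_def by (intro tot_rec2[OF assms(2)] tot_img[OF assms(1)] comp_intros)

text \<open>Iteration on names: stage \<open>s\<close> computes prefixes of all iterates from the prefix of length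
  \<open>s\<close> of the first one; the prefixes of each single iterate grow beyond all bounds with \<open>s\<close>.\<close>

lemma rec2_iterate:
  assumes g: "tot (\<lambda>p. g)" and \<Psi>: "tot \<Psi>"
  shows "rec2 (\<lambda>k. rec_nat g (\<lambda>_. \<Psi>) k)"
proof -
  obtain T where T: "rec2 T" "\<And>p. tracks T p (\<Psi> p)" using total_tracked[OF \<Psi>] by blast
  define It where "It k = rec_nat g (\<lambda>_. \<Psi>) k" for k
  define L where "L s k = rec_nat (pre g s) (\<lambda>_. img T) k" for s k
  have L_It: "L s k = pre (It k) (len (L s k)) \<and>
      filterlim (\<lambda>s. len (L s k)) at_top sequentially" for s k
  proof (induction k arbitrary: s)
    case 0
    then show ?case by (simp add: L_def It_def filterlim_ident)
  next
    case (Suc k)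
    have *: "L s (Suc k) = img T (pre (It k) (len (L s k)))" for s
      using Suc[of s] by (simp add: L_def)
    have "filterlim (\<lambda>s. len (L s (Suc k))) at_top sequentially"
      unfolding * using filterlim_compose[OF len_img_tracks[OF T(2)[of "It k"]]] Suc by blast
    moreover have "L s (Suc k) = pre (It (Suc k)) (len (L s (Suc k)))"
      unfolding * using img_tracks[OF T(2)[of "It k"]] by (simp add: It_def)
    ultimately show ?case by blast
  qed
  have ex: "\<exists>s. n < len (L s k)" for n k
    using L_It[of _ k] unfolding filterlim_at_top
    by (metis Suc_le_eq eventually_happens' sequentially_bot)
  have gp: "tot (\<lambda>p m. g (h p m))" if "tot h" for h
    using tot_comp[OF g that] .
  have "tot (\<lambda>p m. LEAST s. psnd m < len (L s (pfst m)))"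
    by (rule tot_Least) (unfold L_def, intro comp_intros gp tot_img T(1), use ex L_def in simp)
  then have "tot (\<lambda>p m. ent (L (LEAST s. psnd m < len (L s (pfst m))) (pfst m)) (psnd m))"
    unfolding L_def by (intro comp_intros gp tot_img T(1))
  \<comment> \<open>Every stage holds a prefix of the same iterate, so the least stage with a long
    enough prefix already gives the right value.\<close>
  moreover have "ent (L (LEAST s. n < len (L s k)) k) n = It k n" for n k
    using LeastI_ex[OF ex[of n k]] L_It by (metis ent_pre)
  ultimately show ?thesis unfolding rec2_def by (simp add: It_def)
qed

section \<open>Rational numbers\<close>

lemma rat_enum_eq: "rat_enum c = (real (pfst (pfst c)) - real (psnd (pfst c))) / real (Suc (psnd c))"
  by (simp add: rat_enum_def case_prod_unfold pfst_def psnd_def)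

definition ratc :: "((nat \<Rightarrow> nat) \<Rightarrow> nat \<Rightarrow> real) \<Rightarrow> bool" where
  "ratc f \<longleftrightarrow> (\<exists>c. tot c \<and> (\<forall>p n. rat_enum (c p n) = f p n))"

lemma ratcI: "tot c \<Longrightarrow> (\<And>p n. rat_enum (c p n) = f p n) \<Longrightarrow> ratc f"
  unfolding ratc_def by blast

lemma ratcE: assumes "ratc f" obtains c where "tot c" "f = (\<lambda>p n. rat_enum (c p n))"
  using assms unfolding ratc_def by (metis ext)

lemma ratc_rat_enum: "tot c \<Longrightarrow> ratc (\<lambda>p n. rat_enum (c p n))"
  by (rule ratcI) auto

lemma ratc_of_nat: assumes "tot f" shows "ratc (\<lambda>p n. real (f p n))"
  by (rule ratcI[of "\<lambda>p n. prod_encode (prod_encode (f p n, 0), 0)"])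
    (intro comp_intros assms, simp add: rat_enum_eq)

lemma ratc_half_power: assumes "tot f" shows "ratc (\<lambda>p n. (1 / 2) ^ f p n)"
proof (rule ratcI)
  show "tot (\<lambda>p n. prod_encode (prod_encode (1, 0), 2 ^ f p n - 1))" by (intro comp_intros assms)
  have "real (Suc (2 ^ k - 1)) = 2 ^ k" for k
    by (metis Suc_diff_1 of_nat_numeral of_nat_power zero_less_numeral zero_less_power)
  then show "rat_enum (prod_encode (prod_encode (1, 0), 2 ^ f p n - 1)) = (1 / 2) ^ f p n" for p n
    by (simp add: rat_enum_eq power_one_over del: of_nat_Suc)
qed

text \<open>Denominators are stored diminished by one; k l + k + l is the stored form of the product
  of k + 1 and l + 1.\<close>

lemma real_Suc_mult: "real (Suc (k * l + k + l)) = real (Suc k) * real (Suc l)"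
  by (simp add: algebra_simps)

lemma ratc_add: assumes "ratc f" "ratc g" shows "ratc (\<lambda>p n. f p n + g p n)"
proof -
  obtain c d where c: "tot c" "f = (\<lambda>p n. rat_enum (c p n))" and d: "tot d" "g = (\<lambda>p n. rat_enum (d p n))"
    using assms by (metis ratcE)
  let ?e = "\<lambda>c d. prod_encode (prod_encode
    (pfst (pfst c) * Suc (psnd d) + pfst (pfst d) * Suc (psnd c),
     psnd (pfst c) * Suc (psnd d) + psnd (pfst d) * Suc (psnd c)),
     psnd c * psnd d + psnd c + psnd d)"
  have "rat_enum (?e c d) = rat_enum c + rat_enum d" for c d
    unfolding rat_enum_eq psnd_prod_encode pfst_prod_encode real_Suc_mult of_nat_add of_nat_mult
    by (simp add: add_frac_eq del: of_nat_Suc) (simp add: algebra_simps del: of_nat_Suc)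
  moreover have "tot (\<lambda>p n. ?e (c p n) (d p n))" by (intro comp_intros c d)
  ultimately show ?thesis unfolding c d by (intro ratcI)
qed

lemma ratc_uminus: assumes "ratc f" shows "ratc (\<lambda>p n. - f p n)"
proof -
  obtain c where c: "tot c" "f = (\<lambda>p n. rat_enum (c p n))"
    using assms by (rule ratcE)
  let ?e = "\<lambda>c. prod_encode (prod_encode (psnd (pfst c), pfst (pfst c)), psnd c)"
  have "rat_enum (?e c) = - rat_enum c" for c
    by (simp add: rat_enum_eq divide_simps)
  moreover have "tot (\<lambda>p n. ?e (c p n))" by (intro comp_intros c)
  ultimately show ?thesis unfolding c by (intro ratcI)
qed

lemma ratc_diff: "ratc f \<Longrightarrow> ratc g \<Longrightarrow> ratc (\<lambda>p n. f p n - g p n)"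
  using ratc_add[OF _ ratc_uminus[of g]] by simp

lemma ratc_mult: assumes "ratc f" "ratc g" shows "ratc (\<lambda>p n. f p n * g p n)"
proof -
  obtain c d where c: "tot c" "f = (\<lambda>p n. rat_enum (c p n))" and d: "tot d" "g = (\<lambda>p n. rat_enum (d p n))"
    using assms by (metis ratcE)
  let ?e = "\<lambda>c d. prod_encode (prod_encode
    (pfst (pfst c) * pfst (pfst d) + psnd (pfst c) * psnd (pfst d),
     pfst (pfst c) * psnd (pfst d) + psnd (pfst c) * pfst (pfst d)),
     psnd c * psnd d + psnd c + psnd d)"
  have "rat_enum (?e c d) = rat_enum c * rat_enum d" for c d
    unfolding rat_enum_eq psnd_prod_encode pfst_prod_encode real_Suc_mult of_nat_add of_nat_mult
      times_divide_times_eq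
    by (rule arg_cong2[where f = divide]) (simp_all add: algebra_simps)
  moreover have "tot (\<lambda>p n. ?e (c p n) (d p n))" by (intro comp_intros c d)
  ultimately show ?thesis unfolding c d by (intro ratcI)
qed

lemma dec_ratc_le: assumes "ratc f" "ratc g" shows "dec (\<lambda>p n. f p n \<le> g p n)"
proof -
  obtain c where c: "tot c" "\<And>p n. rat_enum (c p n) = g p n - f p n"
    using ratc_diff[OF assms(2,1)] unfolding ratc_def by blast
  have "(0 \<le> rat_enum c) \<longleftrightarrow> psnd (pfst c) \<le> pfst (pfst c)" for c
    by (simp add: rat_enum_eq zero_le_divide_iff)
  with c(2) have "(f p n \<le> g p n) \<longleftrightarrow> psnd (pfst (c p n)) \<le> pfst (pfst (c p n))" for p n
    by (metis diff_ge_0_iff_ge)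
  moreover have "dec (\<lambda>p n. psnd (pfst (c p n)) \<le> pfst (pfst (c p n)))" by (intro comp_intros c)
  ultimately show ?thesis by simp
qed

lemma dec_ratc_less: "ratc f \<Longrightarrow> ratc g \<Longrightarrow> dec (\<lambda>p n. f p n < g p n)"
  using dec_not[OF dec_ratc_le[of g f]] by (simp add: not_le)

lemma dec_ratc_eq: "ratc f \<Longrightarrow> ratc g \<Longrightarrow> dec (\<lambda>p n. f p n = g p n)"
  using dec_conj[OF dec_ratc_le[of f g] dec_ratc_le[of g f]] by (simp flip: eq_iff)

lemma ratc_if: assumes "dec P" "ratc f" "ratc g" shows "ratc (\<lambda>p n. if P p n then f p n else g p n)"
proof -
  obtain c d where c: "tot c" "f = (\<lambda>p n. rat_enum (c p n))" and d: "tot d" "g = (\<lambda>p n. rat_enum (d p n))"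
    using assms by (metis ratcE)
  show ?thesis unfolding c d by (rule ratcI[OF tot_if[OF assms(1) c(1) d(1)]]) simp
qed

lemma ratc_max: "ratc f \<Longrightarrow> ratc g \<Longrightarrow> ratc (\<lambda>p n. max (f p n) (g p n))"
  unfolding max_def by (intro ratc_if dec_ratc_le)

lemma ratc_min: "ratc f \<Longrightarrow> ratc g \<Longrightarrow> ratc (\<lambda>p n. min (f p n) (g p n))"
  unfolding min_def by (intro ratc_if dec_ratc_le)

lemma ratc_abs: assumes "ratc f" shows "ratc (\<lambda>p n. \<bar>f p n\<bar>)"
proof -
  have "\<bar>x\<bar> = max x (- x)" for x :: real by simp
  with ratc_max[OF assms ratc_uminus[OF assms]] show ?thesis by simp
qed

lemma ratc_const: "ratc (\<lambda>p n. real c)"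
  by (intro ratc_of_nat tot_const)

lemmas rat_intros = ratc_half_power ratc_rat_enum ratc_add ratc_uminus ratc_diff ratc_mult ratc_abs
  ratc_max ratc_min ratc_if ratc_const[of 0, simplified] ratc_const[of 1, simplified]
  ratc_const[of "numeral k" for k, simplified]
  ratc_half_power[OF tot_const[of 1], simplified] dec_ratc_le dec_ratc_less dec_ratc_eq

section \<open>Names of open sets\<close>

lemma kleene_app_eq:
  "kleene_app \<alpha> p = (if \<forall>n. \<exists>k. \<alpha> (Suc (prod_encode (n, pre p k))) \<noteq> 0
    then Some (\<lambda>n. \<alpha> (Suc (prod_encode (n, pre p (LEAST k. \<alpha> (Suc (prod_encode (n, pre p k))) \<noteq> 0)))) - 1)
    else None)"
  by (simp add: kleene_app_def pre_def)

text \<open>The name answers position \<open>j\<close> on reading the prefix of length \<open>j\<close>, so that the value there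
  tells whether \<open>S\<close> holds of this prefix. Codes \<open>c > 0\<close> stand for a position followed by a word.\<close>

definition name_of :: "(nat \<Rightarrow> bool) \<Rightarrow> nat \<Rightarrow> nat" where
  "name_of S c = (if len (psnd (c - 1)) < pfst (c - 1) then 0 else if S (psnd (c - 1)) then 2 else 1)"

lemma tot_name_of:
  assumes "dec (\<lambda>p m. S p (pfst m) (psnd m))" "tot f"
  shows "tot (\<lambda>p n. name_of (S p n) (f p n))"
proof -
  have S: "dec (\<lambda>p m. S p m (g p m))" if "tot g" for g
    using dec_comp[OF assms(1) tot_pair[OF tot_id that]] by simp
  show ?thesis unfolding name_of_def by (intro comp_intros S assms(2))
qed

lemma kleene_app_name_of: "kleene_app (name_of S) p = Some (\<lambda>j. if S (pre p j) then 1 else 0)"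
proof -
  have *: "(name_of S (Suc (prod_encode (j, pre p k))) \<noteq> 0) = (j \<le> k)" for j k
    by (simp add: name_of_def)
  have "(LEAST k. j \<le> k) = j" for j :: nat by (rule Least_equality) auto
  then show ?thesis unfolding kleene_app_eq * by (auto simp: name_of_def)
qed

text \<open>Membership of the point named by p shows at one output position j, and that output is
  fixed by the shortest prefix of p on which \<open>\<alpha>\<close> answers. All names with this
  prefix get the same output, so they name points of \<open>U\<close>.\<close>

lemma openin_names_map:
  assumes "U \<subseteq> ran \<rho>" and \<alpha>: "names_map \<rho> sierpinski_rep \<alpha> (\<lambda>x. x \<in> U)"
  shows "openin (final_topology \<rho>) U"
proof -
  let ?V = "{p \<in> dom \<rho>. the (\<rho> p) \<in> U}"
  have "\<exists>T. openin (top_of_set (dom \<rho>)) T \<and> p \<in> T \<and> T \<subseteq> ?V" if p: "p \<in> ?V" for p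
  proof -
    obtain q where q: "kleene_app \<alpha> p = Some q" "q \<noteq> (\<lambda>_. 0)"
      using p \<alpha> unfolding names_map_def sierpinski_rep_def by force
    then obtain j where j: "q j \<noteq> 0" by auto
    let ?Q = "\<lambda>p k. \<alpha> (Suc (prod_encode (j, pre p k))) \<noteq> 0"
    define k where "k = (LEAST k. ?Q p k)"
    have qj: "q j = \<alpha> (Suc (prod_encode (j, pre p k))) - 1"
      using q(1) unfolding kleene_app_eq k_def by (auto split: if_splits)
    let ?T = "dom \<rho> \<inter> (Pi\<^sub>E UNIV (\<lambda>i. if i < k then {p i} else UNIV))"
    have "?T \<subseteq> ?V"
    proof
      fix r assume r: "r \<in> ?T"
      then have ri: "r i = p i" if "i < k" for i using that by (auto simp: PiE_def Pi_def split: if_splits)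
      then have pre: "pre r i = pre p i" if "i \<le> k" for i using that by (simp add: pre_eq_iff)
      obtain y s where y: "\<rho> r = Some y" "kleene_app \<alpha> r = Some s" "sierpinski_rep s = Some (y \<in> U)"
        using r \<alpha> unfolding names_map_def by blast
      have "?Q p k" using j qj by (metis diff_0_eq_0)
      \<comment> \<open>Sharing the prefix of length k also rules out an earlier answer on r,
        because r and p agree on all shorter prefixes.\<close>
      have "(LEAST k. ?Q r k) = k"
      proof (rule Least_equality)
        show "?Q r k" using \<open>?Q p k\<close> pre[of k] by simp
        fix i assume i: "?Q r i"
        show "k \<le> i"
        proof (rule ccontr)
          assume "\<not> k \<le> i"
          with i pre[of i] have "?Q p i" by simp
          then have "k \<le> i" unfolding k_def by (rule Least_le)
          with \<open>\<not> k \<le> i\<close> show False ..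
        qed
      qed
      then have "s j = q j"
        using y(2) pre[of k] unfolding qj kleene_app_eq by (auto split: if_splits)
      with j y have "y \<in> U" by (auto simp: sierpinski_rep_def)
      with y show "r \<in> ?V" by auto
    qed
    moreover have "open (Pi\<^sub>E UNIV (\<lambda>i. if i < k then {p i} else UNIV :: nat set))"
      by (intro open_PiE) (auto simp: open_discrete intro: finite_subset[of _ "{..<k}"])
    then have "openin (top_of_set (dom \<rho>)) ?T" by (intro openin_open_Int)
    ultimately show ?thesis using p by (intro exI[of _ ?T]) (auto simp: PiE_def)
  qed
  then have "openin (top_of_set (dom \<rho>)) ?V" by (subst openin_subopen) blast
  with assms(1) show ?thesis by (simp add: openin_final_topology)
qed

text \<open>Replaces Kleene names by predicates on words. \<open>S\<close> is unconstrained on words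
  that begin no name.\<close>

definition semidecides :: "'a representation \<Rightarrow> (nat \<Rightarrow> bool) \<Rightarrow> 'a set \<Rightarrow> bool" where
  "semidecides \<rho> S U \<longleftrightarrow> U \<subseteq> ran \<rho> \<and> (\<forall>p x. \<rho> p = Some x \<longrightarrow> (x \<in> U \<longleftrightarrow> (\<exists>k. S (pre p k))))"

lemma open_rep_name_of: assumes "semidecides \<rho> S U" shows "open_rep \<rho> (name_of S) = Some U"
proof -
  have "names_map \<rho> sierpinski_rep (name_of S) (\<lambda>x. x \<in> U)"
    using assms unfolding names_map_def kleene_app_name_of semidecides_def
    by (auto simp: sierpinski_rep_def fun_eq_iff split: if_splits intro!: exI[of _ "\<lambda>j. if S (pre _ j) then 1 else 0"])
  with openin_names_map[OF _ this] assms show ?thesis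
    unfolding open_rep_eq_Some semidecides_def by blast
qed

lemma semidecides_openin: "semidecides \<rho> S U \<Longrightarrow> openin (final_topology \<rho>) U"
  by (drule open_rep_name_of) (simp add: open_rep_eq_Some)

lemma openin_semidecides:
  assumes U: "openin (final_topology \<rho>) U" obtains S where "semidecides \<rho> S U"
proof -
  \<comment> \<open>This is the largest sound predicate. It is not claimed to be decidable and
    yields only classical existence of a name.\<close>
  define S where "S w \<longleftrightarrow> (\<forall>p x. \<rho> p = Some x \<and> pre p (len w) = w \<longrightarrow> x \<in> U)" for w
  have "\<exists>k. S (pre p k)" if p: "\<rho> p = Some x" "x \<in> U" for p x
  proof -
    obtain T where T: "open T" "{p \<in> dom \<rho>. the (\<rho> p) \<in> U} = dom \<rho> \<inter> T"
      using U unfolding openin_final_topology openin_open by blast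
    with p have "p \<in> T" by force
    with product_topology_open_contains_basis[of "\<lambda>_. euclidean" UNIV T p] T(1)
    obtain Y where Y: "p \<in> Pi\<^sub>E UNIV Y" "finite {i. Y i \<noteq> UNIV}" "Pi\<^sub>E UNIV Y \<subseteq> T"
      by (auto simp: open_fun_def)
    obtain k where k: "\<And>i. Y i \<noteq> UNIV \<Longrightarrow> i < k"
      using finite_nat_set_iff_bounded[THEN iffD1, OF Y(2)] by auto
    have "q \<in> T" if "pre q k = pre p k" for q
    proof -
      have "q i \<in> Y i" for i
        using that k[of i] Y(1) by (cases "Y i = UNIV") (auto simp: pre_eq_iff PiE_def Pi_def)
      with Y(3) show ?thesis by (auto simp: PiE_def)
    qed
    with T(2) have "S (pre p k)" unfolding S_def by force
    then show ?thesis by blast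
  qed
  moreover have "x \<in> U" if "\<rho> p = Some x" "S (pre p k)" for p x k
    using that unfolding S_def by auto
  ultimately have "semidecides \<rho> S U"
    using U unfolding semidecides_def openin_final_topology by blast
  then show ?thesis by (rule that)
qed

text \<open>Here j is an output position and k the length of the shortest prefix answered there.
  Since an answer is the output plus one, a nonzero output means a value above 1. Bounding both by
  the length of the word makes the test decidable in \<open>\<alpha>\<close>.\<close>

definition accepts :: "(nat \<Rightarrow> nat) \<Rightarrow> nat \<Rightarrow> bool" where
  "accepts \<alpha> w \<longleftrightarrow> (\<exists>j < Suc (len w). \<exists>k < Suc (len w).
     (\<forall>i<k. \<alpha> (Suc (prod_encode (j, pre (ent w) i))) = 0) \<and> 1 < \<alpha> (Suc (prod_encode (j, pre (ent w) k))))"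

lemma accepts_mono:
  assumes "accepts \<alpha> (pre p k)" "k \<le> l" shows "accepts \<alpha> (pre p l)"
proof -
  have eq: "pre (ent (pre p m)) i = pre p i" if "i \<le> m" for i m
    using that by (simp add: pre_eq_iff)
  from assms(1) obtain j i where "j \<le> k" "i \<le> k" "1 < \<alpha> (Suc (prod_encode (j, pre p i)))"
    "\<And>i'. i' < i \<Longrightarrow> \<alpha> (Suc (prod_encode (j, pre p i'))) = 0"
    unfolding accepts_def by (auto simp: eq less_Suc_eq_le)
  with assms(2) show ?thesis
    unfolding accepts_def len_pre by (intro exI[of _ j] conjI exI[of _ i]) (auto simp: eq)
qed

lemma semidecides_accepts: assumes "open_rep \<rho> \<alpha> = Some U" shows "semidecides \<rho> (accepts \<alpha>) U"
  unfolding semidecides_def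
proof (intro conjI allI impI)
  show "U \<subseteq> ran \<rho>" using assms by (simp add: open_rep_eq_Some openin_final_topology)
  fix p x assume "\<rho> p = Some x"
  then obtain q where q: "kleene_app \<alpha> p = Some q" "x \<in> U \<longleftrightarrow> q \<noteq> (\<lambda>_. 0)"
    using assms unfolding open_rep_eq_Some names_map_def sierpinski_rep_def by auto
  let ?a = "\<lambda>j k. \<alpha> (Suc (prod_encode (j, pre p k)))"
  let ?k = "\<lambda>j. LEAST k. ?a j k \<noteq> 0"
  have eq: "pre (ent (pre p m)) i = pre p i" if "i \<le> m" for i m
    using that by (simp add: pre_eq_iff)
  have qj: "q j = ?a j (?k j) - 1" and ex: "\<exists>k. ?a j k \<noteq> 0" for j
    using q(1) unfolding kleene_app_eq by (auto split: if_splits)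
  have "?k j = k" if "?a j k > 1" "\<And>i. i < k \<Longrightarrow> ?a j i = 0" for j k
    using that by (intro Least_equality) (auto simp: not_less[symmetric])
  then have "q j \<noteq> 0" if "?a j k > 1" "\<And>i. i < k \<Longrightarrow> ?a j i = 0" for j k
    using that qj[of j] by auto
  then have "q \<noteq> (\<lambda>_. 0)" if "accepts \<alpha> (pre p k)" for k
    using that unfolding accepts_def by (force simp: eq less_Suc_eq_le)
  moreover have "\<exists>k. accepts \<alpha> (pre p k)" if "q \<noteq> (\<lambda>_. 0)"
  proof -
    from that obtain j where "q j \<noteq> 0" by auto
    with qj have "?a j (?k j) > 1" by simp
    moreover have "?a j i = 0" if "i < ?k j" for i using not_less_Least[OF that] by blast
    ultimately have "accepts \<alpha> (pre p (max j (?k j)))"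
      unfolding accepts_def len_pre by (intro exI[of _ j] conjI exI[of _ "?k j"]) (auto simp: eq)
    then show ?thesis by blast
  qed
  ultimately show "x \<in> U \<longleftrightarrow> (\<exists>k. accepts \<alpha> (pre p k))" using q(2) by blast
qed

lemma dec_accepts:
  assumes "tot (\<lambda>p m. \<alpha> p (pfst m) (psnd m))" "tot f"
  shows "dec (\<lambda>p n. accepts (\<alpha> p n) (f p n))"
proof -
  have 1: "tot (\<lambda>p m. \<alpha> p (h p m) (g p m))" if "tot h" "tot g" for g h
    using tot_comp[OF assms(1) tot_pair[OF that]] by simp
  have 2: "tot (\<lambda>p m. f p (h p m))" if "tot h" for h
    using tot_comp[OF assms(2) that] by simp
  show ?thesis unfolding accepts_def by (intro comp_intros assms(2) 1 2)
qed

section \<open>Embeddings\<close>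

lemma computably_embeds_iff:
  "computably_embeds \<rho> \<tau> \<longleftrightarrow> (\<exists>f S T. inj_on f (ran \<rho>) \<and> rec2 S \<and> rec2 T \<and>
     (\<forall>p x. \<rho> p = Some x \<longrightarrow> (\<exists>q. tracks S p q \<and> \<tau> q = Some (f x))) \<and>
     (\<forall>q x. x \<in> ran \<rho> \<and> \<tau> q = Some (f x) \<longrightarrow> (\<exists>p. tracks T q p \<and> \<rho> p = Some x)))"
  (is "_ \<longleftrightarrow> (\<exists>f S T. ?P f S T)")
proof
  assume "computably_embeds \<rho> \<tau>"
  then obtain f S T where f: "inj_on f (ran \<rho>)" and "rec2 S" "rec2 T"
    and S: "\<And>p x. \<rho> p = Some x \<and> x \<in> ran \<rho> \<longrightarrow> (\<exists>q. tracks S p q \<and> \<tau> q = Some (f x))"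
    and T: "\<And>q y. \<tau> q = Some y \<and> y \<in> f ` ran \<rho> \<longrightarrow>
      (\<exists>p. tracks T q p \<and> \<rho> p = Some (inv_into (ran \<rho>) f y))"
    unfolding computably_embeds_def computable_on_iff by blast
  have "?P f S T"
    using f S T \<open>rec2 S\<close> \<open>rec2 T\<close> by (auto simp: ranI) (metis imageI inv_into_f_f)
  then show "\<exists>f S T. ?P f S T" by blast
next
  assume "\<exists>f S T. ?P f S T"
  then obtain f S T where P: "?P f S T" by blast
  then have "f ` ran \<rho> \<subseteq> ran \<tau>" by (auto simp: ran_def) blast
  moreover have "computable_on \<rho> \<tau> (ran \<rho>) f"
    unfolding computable_on_iff using P by blast
  moreover have "computable_on \<tau> \<rho> (f ` ran \<rho>) (inv_into (ran \<rho>) f)"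
    unfolding computable_on_iff using P by (intro exI[of _ T]) auto
  ultimately show "computably_embeds \<rho> \<tau>"
    unfolding computably_embeds_def using P by blast
qed

lemma computably_embeds_trans:
  assumes "computably_embeds \<rho> \<sigma>" "computably_embeds \<sigma> \<tau>"
  shows "computably_embeds \<rho> \<tau>"
proof -
  obtain f S T where f: "inj_on f (ran \<rho>)" and rec: "rec2 S" "rec2 T"
    and S: "\<And>p x. \<rho> p = Some x \<Longrightarrow> \<exists>q. tracks S p q \<and> \<sigma> q = Some (f x)"
    and T: "\<And>q x. x \<in> ran \<rho> \<and> \<sigma> q = Some (f x) \<Longrightarrow> \<exists>p. tracks T q p \<and> \<rho> p = Some x"
    using assms(1) unfolding computably_embeds_iff by blast
  obtain f' S' T' where f': "inj_on f' (ran \<sigma>)" and rec': "rec2 S'" "rec2 T'"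
    and S': "\<And>p x. \<sigma> p = Some x \<Longrightarrow> \<exists>q. tracks S' p q \<and> \<tau> q = Some (f' x)"
    and T': "\<And>q x. x \<in> ran \<sigma> \<and> \<tau> q = Some (f' x) \<Longrightarrow> \<exists>p. tracks T' q p \<and> \<sigma> p = Some x"
    using assms(2) unfolding computably_embeds_iff by blast
  have ran: "f x \<in> ran \<sigma>" if "x \<in> ran \<rho>" for x
    using that S by (force simp: ran_def)
  then have "inj_on (f' \<circ> f) (ran \<rho>)"
    by (intro comp_inj_on f inj_on_subset[OF f']) blast
  moreover have "\<exists>q. tracks (\<lambda>w. S' (img S w)) p q \<and> \<tau> q = Some ((f' \<circ> f) x)" if "\<rho> p = Some x" for p x
  proof -
    obtain r where r: "tracks S p r" "\<sigma> r = Some (f x)" using S[OF \<open>\<rho> p = Some x\<close>] by blast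
    from S'[OF r(2)] tracks_img[OF r(1)] show ?thesis by auto
  qed
  moreover have "\<exists>p. tracks (\<lambda>w. T (img T' w)) q p \<and> \<rho> p = Some x"
    if x: "x \<in> ran \<rho>" "\<tau> q = Some ((f' \<circ> f) x)" for q x
  proof -
    obtain r where r: "tracks T' q r" "\<sigma> r = Some (f x)" using T' ran[OF x(1)] x(2) by fastforce
    from T[OF conjI[OF x(1) r(2)]] tracks_img[OF r(1)] show ?thesis by blast
  qed
  ultimately show ?thesis
    unfolding computably_embeds_iff using rec2_img[OF rec(1) rec'(1)] rec2_img[OF rec'(2) rec(2)] by blast
qed

section \<open>Names in the constructed spaces\<close>

lemma pair_rep_eq_Some:
  "pair_rep \<rho> \<tau> p = Some (x, y) \<longleftrightarrow> \<rho> (\<lambda>n. p (2 * n)) = Some x \<and> \<tau> (\<lambda>n. p (2 * n + 1)) = Some y"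
  by (auto simp: pair_rep_def Option.bind_eq_Some_conv)

lemma seq_rep_eq_Some:
  "seq_rep \<rho> p = Some x \<longleftrightarrow> (\<forall>i. \<rho> (\<lambda>n. p (prod_encode (i, n))) = Some (x i))"
  unfolding seq_rep_def by (auto simp: fun_eq_iff) (metis option.sel, metis option.distinct(1))

lemma closed_rep_eq_Some:
  "closed_rep \<rho> \<alpha> = Some V \<longleftrightarrow> (\<exists>U. open_rep \<rho> \<alpha> = Some U \<and> V = ran \<rho> - U)"
  by (auto simp: closed_rep_def)

text \<open>Entries i < j of a name may differ by at most 2^-i, so their distances to the limit must
  be smaller; two errors of 2^-(i+2) fit. Conversely a name guarantees only distance 2^-n, see
  \<open>cauchy_rep_SomeD\<close>. The offset 2 in later constructions pays for this gap.\<close>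

lemma cauchy_rep_SomeI:
  assumes "Metric_space M d" "range a \<subseteq> M" "x \<in> M" "\<And>n. d (a (p n)) x \<le> (1 / 2) ^ (n + 2)"
  shows "cauchy_rep M d a p = Some x"
proof -
  interpret Metric_space M d by fact
  have a: "a n \<in> M" for n using assms(2) by blast
  have "d (a (p i)) (a (p j)) \<le> (1 / 2) ^ i" if "i < j" for i j
  proof -
    have "d (a (p i)) (a (p j)) \<le> d (a (p i)) x + d (a (p j)) x"
      using triangle[OF a assms(3) a, of "p i" "p j"] by (simp add: commute)
    also have "\<dots> \<le> (1 / 2) ^ (i + 2) + (1 / 2) ^ (j + 2)" by (intro add_mono assms)
    also have "\<dots> \<le> (1 / 2) ^ (i + 2) + (1 / 2) ^ (i + 2)"
      using that by (intro add_left_mono power_decreasing) auto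
    also have "\<dots> \<le> (1 / 2) ^ i" by (simp add: power_add)
    finally show ?thesis .
  qed
  moreover have "(\<lambda>n. d (a (p n)) x) \<longlonglongrightarrow> 0"
  proof (rule tendsto_sandwich[of "\<lambda>_. 0"])
    show "\<forall>\<^sub>F n in sequentially. d (a (p n)) x \<le> (1 / 2) ^ (n + 2)"
      by (rule always_eventually) (use assms(4) in blast)
    show "(\<lambda>n. (1 / 2) ^ (n + 2)) \<longlonglongrightarrow> (0 :: real)"
      by (rule LIMSEQ_ignore_initial_segment) (rule LIMSEQ_power_zero, simp)
  qed auto
  then have "limitin mtopology (\<lambda>n. a (p n)) x sequentially"
    unfolding limitin_metric_dist_null using a assms(3) by auto
  ultimately show ?thesis unfolding cauchy_rep_eq_Some[OF assms(1)] by blast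
qed

lemma cauchy_rep_SomeD:
  assumes "Metric_space M d" "range a \<subseteq> M" "cauchy_rep M d a p = Some x"
  shows "x \<in> M" "d (a (p n)) x \<le> (1 / 2) ^ n"
proof -
  interpret Metric_space M d by fact
  have a: "a n \<in> M" for n using assms(2) by blast
  have c: "i < j \<Longrightarrow> d (a (p i)) (a (p j)) \<le> (1 / 2) ^ i" for i j
    using assms(3) unfolding cauchy_rep_eq_Some[OF assms(1)] by auto
  have l: "limitin mtopology (\<lambda>n. a (p n)) x sequentially"
    using assms(3) unfolding cauchy_rep_eq_Some[OF assms(1)] by auto
  show x: "x \<in> M" using l limitin_mspace by blast
  have lim: "(\<lambda>n. d (a (p n)) x) \<longlonglongrightarrow> 0"
    using l unfolding limitin_metric_dist_null by blast
  have "(\<lambda>m. (1 / 2) ^ n + d (a (p m)) x) \<longlonglongrightarrow> (1 / 2) ^ n + 0"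
    by (intro tendsto_intros lim)
  moreover have "\<forall>\<^sub>F m in sequentially. d (a (p n)) x \<le> (1 / 2) ^ n + d (a (p m)) x"
    using eventually_gt_at_top[of n]
  proof eventually_elim
    case (elim m)
    then show ?case using triangle[OF a a x, of "p n" "p m"] c[of n m] by simp
  qed
  ultimately have "d (a (p n)) x \<le> (1 / 2) ^ n + 0"
    by (rule tendsto_lowerbound) simp
  then show "d (a (p n)) x \<le> (1 / 2) ^ n" by simp
qed

lemma real_rep_SomeI: "(\<And>n. \<bar>rat_enum (p n) - x\<bar> \<le> (1 / 2) ^ (n + 2)) \<Longrightarrow> real_rep p = Some x"
  unfolding real_rep_def using cauchy_rep_SomeI[OF Met_TC.Metric_space_axioms, of rat_enum x p]
  by (simp add: dist_real_def)

lemma real_rep_SomeD: "real_rep p = Some x \<Longrightarrow> \<bar>rat_enum (p n) - x\<bar> \<le> (1 / 2) ^ n"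
  unfolding real_rep_def using cauchy_rep_SomeD(2)[OF Met_TC.Metric_space_axioms, of rat_enum p x n]
  by (simp add: dist_real_def)

lemma hilbert_cube_rep_SomeI:
  assumes "\<And>i. x i \<in> {0..1}" "\<And>i n. \<bar>rat_enum (p (prod_encode (i, n))) - x i\<bar> \<le> (1 / 2) ^ (n + 2)"
  shows "hilbert_cube_rep p = Some x"
proof -
  have "real_rep (\<lambda>n. p (prod_encode (i, n))) = Some (x i)" for i
    by (rule real_rep_SomeI) (rule assms(2))
  with assms(1) show ?thesis
    unfolding hilbert_cube_rep_def seq_rep_eq_Some restrict_rep_def by simp
qed

lemma hilbert_cube_rep_SomeD:
  assumes "hilbert_cube_rep p = Some x"
  shows "x i \<in> {0..1}" "\<bar>rat_enum (p (prod_encode (i, n))) - x i\<bar> \<le> (1 / 2) ^ n"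
proof -
  have "real_rep (\<lambda>n. p (prod_encode (i, n))) = Some (x i) \<and> x i \<in> {0..1}"
    using assms unfolding hilbert_cube_rep_def seq_rep_eq_Some restrict_rep_def
    by (auto split: option.splits if_splits dest!: spec[of _ i])
  then show "x i \<in> {0..1}" "\<bar>rat_enum (p (prod_encode (i, n))) - x i\<bar> \<le> (1 / 2) ^ n"
    using real_rep_SomeD by auto
qed

lemma subbase_rep_eq_Some:
  assumes "inj_on (\<lambda>x. {i. x \<in> B i}) X"
  shows "subbase_rep X B p = Some x \<longleftrightarrow> x \<in> X \<and> enumerated_set p = {i. x \<in> B i}"
  unfolding subbase_rep_def rep_of_eq_Some using inj_onD[OF assms] by auto

lemma enumerated_set_surj: "\<exists>p. enumerated_set p = A"
  by (rule exI[of _ "\<lambda>k. if k \<in> A then Suc k else 0"]) (auto simp: enumerated_set_def)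

text \<open>Zeros and repetitions do no harm in an enumeration, so any finite list of members of
  \<open>A\<close> can precede an enumeration of \<open>A\<close>.\<close>

lemma enumerated_set_prepend:
  assumes "\<And>i. i < len w \<Longrightarrow> ent w i = 0 \<or> ent w i - 1 \<in> A"
  obtains p where "pre p (len w) = w" "enumerated_set p = A"
proof -
  obtain q where q: "enumerated_set q = A" using enumerated_set_surj by blast
  let ?p = "\<lambda>k. if k < len w then ent w k else q (k - len w)"
  have "pre ?p (len w) = w"
    using pre_cong[of "len w" ?p "ent w"] by simp
  moreover have "enumerated_set ?p = A"
  proof (intro equalityI subsetI)
    fix i assume "i \<in> enumerated_set ?p"
    then show "i \<in> A" using assms q by (auto simp: enumerated_set_def split: if_splits) force
  next
    fix i assume "i \<in> A"
    then obtain k where "q k = Suc i" using q by (auto simp: enumerated_set_def)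
    then have "?p (len w + k) = Suc i" by simp
    then show "i \<in> enumerated_set ?p" unfolding enumerated_set_def by blast
  qed
  ultimately show ?thesis by (rule that)
qed

section \<open>The effective Urysohn construction\<close>

locale subbase =
  fixes X :: "'a set" and B :: "nat \<Rightarrow> 'a set"
begin

definition enum :: "(nat \<Rightarrow> nat) \<Rightarrow> 'a \<Rightarrow> bool" where
  "enum p x \<longleftrightarrow> x \<in> X \<and> enumerated_set p = {i. x \<in> B i}"

text \<open>The number K is read both as a finite list of indices whose subbasic sets are
  intersected and as a word. The readings agree: the points of the intersection are those with an
  enumeration beginning with K (\<open>cyl_enum\<close>, \<open>enum_cyl\<close>).\<close>

definition cyl :: "nat \<Rightarrow> 'a set" where
  "cyl K = {x \<in> X. \<forall>i < len K. ent K i = 0 \<or> x \<in> B (ent K i - 1)}"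

definition sat :: "(nat \<Rightarrow> bool) \<Rightarrow> 'a set" where
  "sat g = {x. \<exists>p k. enum p x \<and> g (pre p k)}"

text \<open>Acceptance by one enumeration of x must force permanent acceptance along all of them.
  Permanence is what lets \<open>sep\<close> ask for several conditions on one and the same
  word.\<close>

definition stable :: "(nat \<Rightarrow> bool) \<Rightarrow> bool" where
  "stable g \<longleftrightarrow> (\<forall>p x. enum p x \<and> x \<in> sat g \<longrightarrow> (\<forall>\<^sub>F k in sequentially. g (pre p k)))"

lemma sat_subset: "sat g \<subseteq> X"
  by (auto simp: sat_def enum_def)

lemma satI: "enum p x \<Longrightarrow> g (pre p k) \<Longrightarrow> x \<in> sat g"
  by (auto simp: sat_def)

lemma enum_ex: assumes "x \<in> X" obtains p where "enum p x"
  using enumerated_set_surj[of "{i. x \<in> B i}"] assms by (auto simp: enum_def)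

lemma enum_ex': "x \<in> X \<Longrightarrow> \<exists>p. enum p x"
  using enum_ex by blast

lemma stableD: "stable g \<Longrightarrow> enum p x \<Longrightarrow> x \<in> sat g \<Longrightarrow> \<forall>\<^sub>F k in sequentially. g (pre p k)"
  by (auto simp: stable_def)

lemma sat_eqI:
  assumes "\<And>p x k. enum p x \<Longrightarrow> g (pre p k) \<Longrightarrow> x \<in> G"
    and "\<And>p x. enum p x \<Longrightarrow> x \<in> G \<Longrightarrow> \<forall>\<^sub>F k in sequentially. g (pre p k)" and "G \<subseteq> X"
  shows "stable g \<and> sat g = G"
proof -
  have "x \<in> sat g" if "x \<in> G" for x
  proof -
    from that assms(3) obtain p where p: "enum p x" using enum_ex by blast
    from eventually_happens'[OF sequentially_bot assms(2)[OF p that]] show ?thesis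
      using p by (auto simp: sat_def)
  qed
  moreover have "x \<in> G" if "x \<in> sat g" for x
    using that assms(1) by (auto simp: sat_def)
  ultimately have "sat g = G" by blast
  with assms(2) show ?thesis unfolding stable_def by blast
qed

lemma enum_in: "enum p x \<Longrightarrow> x \<in> X"
  by (simp add: enum_def)

lemma enum_iff: "enum p x \<Longrightarrow> x \<in> B i \<longleftrightarrow> (\<exists>k. p k = Suc i)"
  unfolding enum_def enumerated_set_def by blast

lemma enum_cyl: assumes "enum p x" shows "x \<in> cyl (pre p k)"
proof -
  have "p i = 0 \<or> x \<in> B (p i - 1)" for i
    using enum_iff[OF assms, of "p i - 1"] by (cases "p i") auto
  with enum_in[OF assms] show ?thesis by (simp add: cyl_def)
qed

lemma cyl_enum: assumes "x \<in> cyl K" obtains p where "enum p x" "pre p (len K) = K"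
  using enumerated_set_prepend[of K "{i. x \<in> B i}"] assms unfolding cyl_def enum_def by blast

text \<open>Together with \<open>sat_cyl\<close> this writes \<open>sat g\<close> as the union of
  \<open>cyl K\<close> over the accepted words K, which transfers shrinkings from basic sets to all
  sets of this form.\<close>

lemma cyl_subset_sat: "g K \<Longrightarrow> cyl K \<subseteq> sat g"
  by (metis cyl_enum satI subsetI)

lemma sat_cyl: assumes "x \<in> sat g" obtains K where "g K" "x \<in> cyl K"
  using assms enum_cyl by (auto simp: sat_def)

end

text \<open>\<open>u K n\<close> and \<open>c K n\<close> semidecide the sets \<open>U\<^sub>n\<close> and the complements of the sets \<open>V\<^sub>n\<close> that strong
  regularity provides for the basic open set \<open>cyl K\<close>. Since every open set is a union of such
  sets, these data suffice to shrink all open sets occurring in the construction.\<close>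

locale regular_subbase = subbase +
  fixes u c :: "nat \<Rightarrow> nat \<Rightarrow> nat \<Rightarrow> bool"
  assumes stable_u: "stable (u K n)" and stable_c: "stable (c K n)"
    and u_c_disjoint: "sat (u K n) \<inter> sat (c K n) = {}"
    and c_cover: "sat (c K n) \<union> cyl K = X"
    and u_cover: "cyl K = (\<Union>n. sat (u K n))"
    and dec_u: "dec (\<lambda>p m. u (pfst m) (pfst (psnd m)) (psnd (psnd m)))"
    and dec_c: "dec (\<lambda>p m. c (pfst m) (pfst (psnd m)) (psnd (psnd m)))"
begin

section \<open>Effective normality\<close>

lemma dec_u': "tot k \<Longrightarrow> tot n \<Longrightarrow> tot w \<Longrightarrow> dec (\<lambda>p m. u (k p m) (n p m) (w p m))"
  using dec_comp[OF dec_u, of "\<lambda>p m. prod_encode (k p m, prod_encode (n p m, w p m))"]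
  by (simp add: tot_pair)

lemma dec_c': "tot k \<Longrightarrow> tot n \<Longrightarrow> tot w \<Longrightarrow> dec (\<lambda>p m. c (k p m) (n p m) (w p m))"
  using dec_comp[OF dec_c, of "\<lambda>p m. prod_encode (k p m, prod_encode (n p m, w p m))"]
  by (simp add: tot_pair)

text \<open>The number m codes a word and an index, so the shrinkings of all basic sets inside
  \<open>sat g\<close> form a single sequence; words not accepted are skipped. Only the finitely
  many closed sets for \<open>h\<close> up to m are removed, which keeps the result open, and m <
  \<open>len w\<close> keeps the test bounded.\<close>

definition sep :: "(nat \<Rightarrow> bool) \<Rightarrow> (nat \<Rightarrow> bool) \<Rightarrow> nat \<Rightarrow> bool" where
  "sep g h w \<longleftrightarrow> (\<exists>m < len w. g (pfst m) \<and> u (pfst m) (psnd m) w \<and>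
     (\<forall>m'\<le>m. h (pfst m') \<longrightarrow> c (pfst m') (psnd m') w))"

lemma dec_sep:
  assumes "dec (\<lambda>p m. g p (pfst m) (psnd m))" "dec (\<lambda>p m. h p (pfst m) (psnd m))" "tot w"
  shows "dec (\<lambda>p n. sep (g p n) (h p n) (w p n))"
proof -
  have g: "dec (\<lambda>p m. g p (a p m) (b p m))" and h: "dec (\<lambda>p m. h p (a p m) (b p m))"
    if "tot a" "tot b" for a b
    using dec_comp[OF assms(1) tot_pair[OF that]] dec_comp[OF assms(2) tot_pair[OF that]] by simp_all
  have w: "tot (\<lambda>p m. w p (a p m))" if "tot a" for a
    using tot_comp[OF assms(3) that] .
  show ?thesis unfolding sep_def by (intro comp_intros dec_u' dec_c' g h w assms(3))
qed

lemma stable_sat_sep: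
  "stable (sep g h) \<and> sat (sep g h) = {x \<in> X. \<exists>m. g (pfst m) \<and> x \<in> sat (u (pfst m) (psnd m)) \<and>
     (\<forall>m'\<le>m. h (pfst m') \<longrightarrow> x \<in> sat (c (pfst m') (psnd m')))}" (is "_ \<and> _ = ?G")
proof (rule sat_eqI)
  fix p x k assume p: "enum p x" and "sep g h (pre p k)"
  then obtain m where "g (pfst m)" "u (pfst m) (psnd m) (pre p k)"
    "\<And>m'. m' \<le> m \<Longrightarrow> h (pfst m') \<Longrightarrow> c (pfst m') (psnd m') (pre p k)"
    unfolding sep_def by blast
  with satI[OF p] enum_in[OF p] show "x \<in> ?G" by blast
next
  fix p x assume p: "enum p x" and "x \<in> ?G"
  then obtain m where m: "g (pfst m)" "x \<in> sat (u (pfst m) (psnd m))"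
    "\<And>m'. m' \<le> m \<Longrightarrow> h (pfst m') \<Longrightarrow> x \<in> sat (c (pfst m') (psnd m'))" by blast
  have "\<forall>\<^sub>F k in sequentially. \<forall>m'\<in>{..m}. h (pfst m') \<longrightarrow> c (pfst m') (psnd m') (pre p k)"
  proof (rule eventually_ball_finite, simp, safe)
    fix m' assume "m' \<le> m"
    show "\<forall>\<^sub>F k in sequentially. h (pfst m') \<longrightarrow> c (pfst m') (psnd m') (pre p k)"
      using stableD[OF stable_c p m(3)[OF \<open>m' \<le> m\<close>]] by (cases "h (pfst m')") auto
  qed
  with stableD[OF stable_u p m(2)] eventually_gt_at_top[of m]
  show "\<forall>\<^sub>F k in sequentially. sep g h (pre p k)"
  proof eventually_elim
    case (elim k)
    with m(1) show ?case unfolding sep_def by auto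
  qed
qed blast

lemmas stable_sep = stable_sat_sep[THEN conjunct1]
lemmas sat_sep = stable_sat_sep[THEN conjunct2]

text \<open>A point outside \<open>sat h\<close> lies in no \<open>cyl K'\<close> with
  \<open>h K'\<close>, hence outside all closed sets that may be removed, and some shrinking for
  \<open>g\<close> catches it.\<close>

lemma sep_cover: assumes "sat g \<union> sat h = X" shows "sat h \<union> sat (sep g h) = X"
proof -
  have "x \<in> sat (sep g h)" if "x \<in> X" "x \<notin> sat h" for x
  proof -
    from that assms obtain K where "g K" "x \<in> cyl K" by (metis UnE sat_cyl)
    then obtain n where "x \<in> sat (u K n)" using u_cover by blast
    moreover have "x \<in> sat (c K' n')" if "h K'" for K' n'
      using cyl_subset_sat[of h, OF that] c_cover[of K' n'] \<open>x \<in> X\<close> \<open>x \<notin> sat h\<close> by blast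
    ultimately show ?thesis unfolding sat_sep using \<open>g K\<close> \<open>x \<in> X\<close>
      by (auto intro!: exI[of _ "prod_encode (K, n)"])
  qed
  with sat_subset show ?thesis by blast
qed

text \<open>Of two witnesses for a common point, the one with the larger index excludes the closed
  set around the shrinking chosen by the other.\<close>

lemma sep_disjoint: "sat (sep g h) \<inter> sat (sep h g) = {}"
proof -
  have False if "g (pfst m)" "x \<in> sat (u (pfst m) (psnd m))" "m \<le> m'"
    "\<forall>m''\<le>m'. g (pfst m'') \<longrightarrow> x \<in> sat (c (pfst m'') (psnd m''))" for g m m' x
    using that u_c_disjoint by blast
  then show ?thesis unfolding sat_sep by (auto, metis nat_le_linear)
qed

text \<open>\<open>lev k 0 e j\<close> and \<open>lev k 1 e j\<close> semidecide open sets of points where the \<open>e\<close>-th Urysohn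
  function is at most, respectively at least, \<open>j / 2\<^sup>k\<close>.\<close>

primrec lev :: "nat \<Rightarrow> nat \<Rightarrow> nat \<Rightarrow> nat \<Rightarrow> nat \<Rightarrow> bool" where
  "lev 0 = (\<lambda>b e j w.
     if j = 0 then b \<noteq> 0 \<and> (\<exists>l<len w. ent w l = Suc (pfst e))
     else if j = 1 then b = 0 \<and> c (pre (\<lambda>_. Suc (pfst e)) 1) (psnd e) w
     else b = 0)"
| "lev (Suc k) = (\<lambda>b e j w.
     if even j then lev k b e (j div 2) w
     else sep (lev k b e (j div 2 + (1 - b))) (lev k (1 - b) e (j div 2 + b)) w)"

text \<open>The recursive calls of \<open>lev (Suc k)\<close> change b, j and w, so recursion with a
  fixed parameter does not fit. Instead the table of all values of a level is one point of Baire
  space, and \<open>\<Psi>\<close> is the total operator that turns it into the table of the next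
  level.\<close>

lemma dec_lev:
  assumes "tot fk" "tot fb" "tot fe" "tot fj" "tot fw"
  shows "dec (\<lambda>p n. lev (fk p n) (fb p n) (fe p n) (fj p n) (fw p n))"
proof -
  let ?enc = "\<lambda>b e j w. prod_encode (b, prod_encode (e, prod_encode (j, w)))"
  let ?b = "pfst" and ?e = "\<lambda>m. pfst (psnd m)" and ?j = "\<lambda>m. pfst (psnd (psnd m))"
    and ?w = "\<lambda>m. psnd (psnd (psnd m))"
  define g where "g m = (if lev 0 (?b m) (?e m) (?j m) (?w m) then 1 else 0 :: nat)" for m
  define \<Psi> where "\<Psi> p m = (if (if even (?j m) then 0 < p (?enc (?b m) (?e m) (?j m div 2) (?w m))
     else sep (\<lambda>K. 0 < p (?enc (?b m) (?e m) (?j m div 2 + (1 - ?b m)) K))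
       (\<lambda>K. 0 < p (?enc (1 - ?b m) (?e m) (?j m div 2 + ?b m) K)) (?w m)) then 1 else 0 :: nat)"
    for p :: "nat \<Rightarrow> nat" and m
  have "tot (\<lambda>p. g)" unfolding g_def lev.simps by (intro comp_intros dec_c')
  moreover have "tot \<Psi>" unfolding \<Psi>_def by (intro comp_intros dec_sep tot_div) auto
  ultimately have *: "rec2 (\<lambda>k. rec_nat g (\<lambda>_. \<Psi>) k)" by (rule rec2_iterate)
  define It where "It k = rec_nat g (\<lambda>_. \<Psi>) k" for k
  have "It k (?enc b e j w) = (if lev k b e j w then 1 else 0)" for k b e j w
  proof (induction k arbitrary: b e j w)
    case 0
    then show ?case by (simp add: It_def g_def)
  next
    case (Suc k)
    have "It (Suc k) (?enc b e j w) = \<Psi> (It k) (?enc b e j w)" by (simp add: It_def)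
    also have "\<dots> = (if (if even j then 0 < It k (?enc b e (j div 2) w)
      else sep (\<lambda>K. 0 < It k (?enc b e (j div 2 + (1 - b)) K))
       (\<lambda>K. 0 < It k (?enc (1 - b) e (j div 2 + b) K)) w) then 1 else 0)"
      by (simp add: \<Psi>_def)
    finally show ?case unfolding Suc by simp
  qed
  then have "lev k b e j w \<longleftrightarrow> 0 < It k (?enc b e j w)" for k b e j w by simp
  moreover have "dec (\<lambda>p n. 0 < It (fk p n) (?enc (fb p n) (fe p n) (fj p n) (fw p n)))"
    unfolding It_def by (intro dec_less tot_const tot_rec2[OF *] tot_pair assms)
  ultimately show ?thesis by simp
qed

lemma stable_lev: "stable (lev k b e j)"
proof (induction k arbitrary: b j)
  case 0
  have "stable (\<lambda>w. b)" for b by (simp add: stable_def sat_def)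
  moreover have "stable (\<lambda>w. \<exists>l<len w. ent w l = Suc i)" for i
  proof -
    have "\<exists>k. p k = Suc i" if p: "enum p x" and x: "x \<in> sat (\<lambda>w. \<exists>l<len w. ent w l = Suc i)" for p x
    proof -
      from x obtain q l where "enum q x" "q l = Suc i" by (auto simp: sat_def)
      with p enum_iff show ?thesis by blast
    qed
    moreover have "\<forall>\<^sub>F k in sequentially. \<exists>l<len (pre p k). ent (pre p k) l = Suc i"
      if "p l = Suc i" for p l
      using eventually_gt_at_top[of l] by (rule eventually_mono) (use that in auto)
    ultimately show ?thesis unfolding stable_def by blast
  qed
  ultimately show ?case
    using stable_c by (cases "b = 0"; cases "j = 0"; cases "j = 1") simp_all
next
  case (Suc k)
  then show ?case using stable_sep by (cases "even j") simp_all
qed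

text \<open>The boundary data for e = (i, n): the function is positive only on \<open>B i\<close>
  and below 1 off the n-th closed shrinking of \<open>B i\<close>; the empty and full sets confine
  it to [0, 1]. The one-letter word with entry i + 1 is the index of \<open>B i\<close> as a basic
  set.\<close>

lemma sat_lev_0:
  "sat (lev 0 0 e 0) = {}" "sat (lev 0 1 e 0) = X \<inter> B (pfst e)"
  "sat (lev 0 0 e 1) = sat (c (pre (\<lambda>_. Suc (pfst e)) 1) (psnd e))"
  "sat (lev 0 0 e (Suc (Suc j))) = X" "sat (lev 0 1 e (Suc j)) = {}"
proof -
  show "sat (lev 0 0 e 0) = {}" by (simp add: sat_def)
  show "sat (lev 0 0 e 1) = sat (c (pre (\<lambda>_. Suc (pfst e)) 1) (psnd e))" by simp
  show "sat (lev 0 1 e (Suc j)) = {}" by (simp add: sat_def)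
  show "sat (lev 0 0 e (Suc (Suc j))) = X" using enum_ex' by (auto simp: sat_def enum_in)
  have "x \<in> B (pfst e)" if "enum p x" "p l = Suc (pfst e)" for p x l
    using enum_iff[OF that(1)] that(2) by blast
  moreover have "\<exists>l. p l = Suc i" if "enum p x" "x \<in> B i" for p x i
    using enum_iff[OF that(1)] that(2) by blast
  moreover have "\<exists>p. enum p x" if "x \<in> X" for x using that by (rule enum_ex')
  ultimately show "sat (lev 0 1 e 0) = X \<inter> B (pfst e)"
    using sat_subset by (auto simp: sat_def enum_def) (metis lessI)+
qed

text \<open>Write L_j and R_j for the lower and upper sets of a level. The covering by R_j and
  L_(j+1) is the hypothesis that \<open>sep\<close> needs to insert a pair at the midpoint: L_(2j+1)
  separates L_(j+1) from R_j, and R_(2j+1) does the reverse. The two new coverings come from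
  \<open>sep_cover\<close>, so both invariants propagate.\<close>

lemma lev_disjoint: "sat (lev k 0 e j) \<inter> sat (lev k 1 e j) = {}"
  and lev_cover: "sat (lev k 1 e j) \<union> sat (lev k 0 e (Suc j)) = X"
proof (induction k arbitrary: j)
  case 0
  have cyl: "cyl (pre (\<lambda>_. Suc (pfst e)) 1) = X \<inter> B (pfst e)" by (auto simp: cyl_def)
  { case 1 show ?case by (cases j) (simp_all only: sat_lev_0, simp_all) }
  { case 2
    show ?case
    proof (cases j)
      case 0
      then show ?thesis
        using c_cover[of "pre (\<lambda>_. Suc (pfst e)) 1" "psnd e"] cyl sat_lev_0(2,3)[of e]
        by (simp only: One_nat_def[symmetric]) blast
    qed (simp only: sat_lev_0, simp) }
next
  case (Suc k)
  have sep0: "sat (lev (Suc k) 0 e j) = (if even j then sat (lev k 0 e (j div 2))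
      else sat (sep (lev k 0 e (Suc (j div 2))) (lev k 1 e (j div 2))))"
    and sep1: "sat (lev (Suc k) 1 e j) = (if even j then sat (lev k 1 e (j div 2))
      else sat (sep (lev k 1 e (j div 2)) (lev k 0 e (Suc (j div 2)))))" for j
    by (simp_all cong: if_cong)
  { case 1 show ?case unfolding sep0 sep1 using Suc(1) sep_disjoint by auto }
  { case 2
    have "sat (lev k 0 e (Suc (j div 2))) \<union> sat (lev k 1 e (j div 2)) = X"
      using Suc(2) by blast
    from sep_cover[OF this] sep_cover[OF Suc(2)]
    show ?case unfolding sep0 sep1 by (cases "even j") auto }
qed

section \<open>From dyadic levels to real-valued Urysohn functions\<close>

lemma lev_scale: "lev (k + d) b e (2 ^ d * j) = lev k b e j"
  by (induction d) (simp_all add: fun_eq_iff mult.assoc)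

lemma lev_decreasing: assumes "i \<le> j" "x \<in> sat (lev k 1 e j)" shows "x \<in> sat (lev k 1 e i)"
  using assms
proof (induction rule: dec_induct)
  case (step j)
  then show ?case using lev_disjoint[of k e "Suc j"] lev_cover[of k e j] sat_subset by blast
qed

text \<open>On the common level k + l the upper sets decrease, and the one at the index of a lower
  set is disjoint from it.\<close>

lemma lev_less:
  assumes "x \<in> sat (lev k 0 e i)" "x \<in> sat (lev l 1 e j)"
  shows "real j / 2 ^ l \<le> real i / 2 ^ k"
proof -
  have *: "x \<in> sat (lev (k + l) 0 e (2 ^ l * i))" "x \<in> sat (lev (k + l) 1 e (2 ^ k * j))"
    using assms lev_scale[of k l 0 e i] lev_scale[of l k 1 e j] by (simp_all add: add.commute)
  have "2 ^ k * j \<le> 2 ^ l * i"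
  proof (rule ccontr)
    assume "\<not> 2 ^ k * j \<le> 2 ^ l * i"
    then have "2 ^ l * i \<le> 2 ^ k * j" by simp
    from lev_decreasing[OF this *(2)] *(1) lev_disjoint show False by blast
  qed
  then have "real (2 ^ k * j) \<le> real (2 ^ l * i)" by (simp only: of_nat_le_iff)
  then show ?thesis by (simp add: field_simps)
qed

text \<open>Inserting 0 gives the supremum a nonempty set at points that lie in no upper set, in
  particular outside \<open>B (pfst e)\<close>.\<close>

definition ury :: "nat \<Rightarrow> 'a \<Rightarrow> real" where
  "ury e x = Sup (insert 0 {real j / 2 ^ k |j k. x \<in> sat (lev k 1 e j)})"

lemma lev_1_bound: assumes "x \<in> sat (lev k 1 e j)" shows "real j / 2 ^ k \<le> 1"
proof (rule ccontr)
  assume "\<not> real j / 2 ^ k \<le> 1"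
  then have "real (2 ^ k) \<le> real j" by (simp add: field_simps)
  then have "2 ^ k \<le> j" by (simp only: of_nat_le_iff)
  from lev_decreasing[OF this assms] have "x \<in> sat (lev 0 1 e 1)"
    using lev_scale[of 0 k 1 e 1] by simp
  then show False using sat_lev_0(5)[of e 0] by simp
qed

lemma bdd_ury: "bdd_above (insert 0 {real j / 2 ^ k |j k. x \<in> sat (lev k 1 e j)})"
  by (intro bdd_aboveI[of _ 1]) (elim insertE CollectE exE conjE, simp_all only: lev_1_bound zero_le_one)

lemma ury_lower: "x \<in> sat (lev k 1 e j) \<Longrightarrow> real j / 2 ^ k \<le> ury e x"
  unfolding ury_def by (rule cSup_upper[OF _ bdd_ury]) blast

lemma ury_nonneg: "0 \<le> ury e x"
  unfolding ury_def by (rule cSup_upper[OF _ bdd_ury]) blast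

lemma ury_le: assumes "0 \<le> y" "\<And>k j. x \<in> sat (lev k 1 e j) \<Longrightarrow> real j / 2 ^ k \<le> y"
  shows "ury e x \<le> y"
  unfolding ury_def using assms by (intro cSup_least) auto

lemma ury_le_1: "ury e x \<le> 1"
  by (rule ury_le, simp, rule lev_1_bound)

lemma ury_upper: "x \<in> sat (lev k 0 e j) \<Longrightarrow> ury e x \<le> real j / 2 ^ k"
  by (rule ury_le, simp, rule lev_less)

lemma ury_eq_0: assumes "x \<notin> B (pfst e)" shows "ury e x = 0"
proof (rule antisym[OF ury_le ury_nonneg])
  fix k j assume "x \<in> sat (lev k 1 e j)"
  from lev_decreasing[OF le0 this] have "x \<in> sat (lev 0 1 e 0)"
    using lev_scale[of 0 k 1 e 0] by simp
  with assms sat_lev_0(2) show "real j / 2 ^ k \<le> 0" by blast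
qed simp

text \<open>The argument works at every level k with bound 1 - 2^-k. Level 3 suffices for decoding:
  with error at most 1/8, a value of at least 7/8 and the value 0 lie on different sides of
  1/2.\<close>

lemma ury_large:
  assumes "x \<in> sat (u (pre (\<lambda>_. Suc i) 1) n)" shows "7 / 8 \<le> ury (prod_encode (i, n)) x"
proof -
  let ?e = "prod_encode (i, n)"
  have "x \<notin> sat (lev 0 0 ?e 1)" using assms u_c_disjoint unfolding sat_lev_0 by auto
  then have "x \<notin> sat (lev 3 0 ?e (Suc 7))"
    using lev_scale[of 0 3 0 ?e 1] by simp
  with lev_cover[of 3 ?e 7] assms sat_subset have "x \<in> sat (lev 3 1 ?e 7)" by blast
  from ury_lower[OF this] show ?thesis by simp
qed

lemma ury_large_ex: assumes "x \<in> X" "x \<in> B i" shows "\<exists>n. 7 / 8 \<le> ury (prod_encode (i, n)) x"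
proof -
  have "x \<in> cyl (pre (\<lambda>_. Suc i) 1)" using assms by (auto simp: cyl_def)
  then show ?thesis using u_cover ury_large by blast
qed

lemma ury_tracked:
  obtains T where "rec2 T" "\<And>p x. enum p x \<Longrightarrow> \<exists>q. tracks T p q \<and> hilbert_cube_rep q = Some (\<lambda>e. ury e x)"
proof -
  \<comment> \<open>Position n = (e, t) asks for a numerator and a prefix length, both coded in m,
    that confirm the value to lie between (j - 1) / 2^(t+2) and (j + 1) / 2^(t+2). The error of j /
    2^(t+2) is then exactly what a name permits.\<close>
  let ?P = "\<lambda>p n m. (pfst m = 0 \<or> lev (psnd n + 2) 1 (pfst n) (pfst m - 1) (pre p (psnd m))) \<and>
    lev (psnd n + 2) 0 (pfst n) (pfst m + 1) (pre p (psnd m))"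
  let ?f = "\<lambda>p n m. prod_encode (prod_encode (pfst m, 0), 2 ^ (psnd n + 2) - 1)"
  have 1: "dec (\<lambda>p m. ?P p (pfst m) (psnd m))" by (intro comp_intros dec_lev)
  have 2: "tot (\<lambda>p m. ?f p (pfst m) (psnd m))" by (intro comp_intros)
  obtain T where T: "rec2 T"
    "\<And>p. (\<And>n. \<exists>k. ?P p n k) \<Longrightarrow> tracks T p (\<lambda>n. ?f p n (LEAST k. ?P p n k))"
    using search_tracked[of ?P ?f, OF 1 2] by blast
  have ex: "\<exists>m. ?P p n m" if "enum p x" for p x n
  proof -
    let ?k = "psnd n + 2" and ?e = "pfst n"
    have x: "x \<in> X" using that by (simp add: enum_def)
    have "\<exists>j. x \<in> sat (lev ?k 0 ?e (Suc j))"
    proof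
      show "x \<in> sat (lev ?k 0 ?e (Suc (2 ^ ?k * 2 - 1)))"
        using lev_scale[of 0 ?k 0 ?e 2] x sat_lev_0(4)[of ?e 0] by (simp add: numeral_2_eq_2)
    qed
    \<comment> \<open>By minimality x misses the preceding lower set, so the covering puts it into
      the upper set with index j - 1.\<close>
    define j where "j = (LEAST j. x \<in> sat (lev ?k 0 ?e (Suc j)))"
    have G: "x \<in> sat (lev ?k 0 ?e (Suc j))" unfolding j_def by (rule LeastI_ex) fact
    have H: "x \<in> sat (lev ?k 1 ?e (j - 1))" if "j \<noteq> 0"
    proof -
      have "j - 1 < j" using that by simp
      then have "x \<notin> sat (lev ?k 0 ?e (Suc (j - 1)))" unfolding j_def by (rule not_less_Least)
      with lev_cover[of ?k ?e "j - 1"] x show ?thesis by blast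
    qed
    have "\<forall>\<^sub>F s in sequentially. j = 0 \<or> lev ?k 1 ?e (j - 1) (pre p s)"
      using stableD[OF stable_lev that H] by (cases "j = 0") auto
    with stableD[OF stable_lev that G] have "\<forall>\<^sub>F s in sequentially. ?P p n (prod_encode (j, s))"
      by eventually_elim simp
    from eventually_happens'[OF sequentially_bot this] show ?thesis by blast
  qed
  have "hilbert_cube_rep (\<lambda>n. ?f p n (LEAST k. ?P p n k)) = Some (\<lambda>e. ury e x)" if p: "enum p x" for p x
  proof (rule hilbert_cube_rep_SomeI)
    show "ury e x \<in> {0..1}" for e using ury_nonneg ury_le_1 by simp
    fix e t
    let ?n = "prod_encode (e, t)"
    define m where "m = (LEAST k. ?P p ?n k)"
    have P: "?P p ?n m" unfolding m_def by (rule LeastI_ex) (rule ex[OF p])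
    have "ury e x \<le> real (pfst m + 1) / 2 ^ (t + 2)"
      using P by (intro ury_upper) (auto intro: satI[OF p])
    moreover have "(real (pfst m) - 1) / 2 ^ (t + 2) \<le> ury e x"
    proof (cases "pfst m = 0")
      case True
      then have "(real (pfst m) - 1) / 2 ^ (t + 2) \<le> 0" by simp
      with ury_nonneg show ?thesis by (rule order_trans[rotated])
    next
      case False
      with P have "real (pfst m - 1) / 2 ^ (t + 2) \<le> ury e x"
        by (intro ury_lower) (auto intro: satI[OF p])
      with False show ?thesis by (simp add: of_nat_diff)
    qed
    moreover have "real (Suc (2 ^ (t + 2) - 1)) = 2 ^ (t + 2)"
      by (metis Suc_diff_1 of_nat_numeral of_nat_power zero_less_numeral zero_less_power)
    then have "rat_enum (?f p ?n m) = real (pfst m) / 2 ^ (t + 2)"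
      by (simp add: rat_enum_eq del: of_nat_Suc)
    ultimately show "\<bar>rat_enum (?f p ?n (LEAST k. ?P p ?n k)) - ury e x\<bar> \<le> (1 / 2) ^ (t + 2)"
      unfolding m_def[symmetric] by (simp add: abs_le_iff power_one_over field_simps)
  qed
  with T ex show ?thesis by (intro that[OF T(1)]) blast
qed

text \<open>A point lies in \<open>B i\<close> iff one of its coordinates \<open>ury (prod_encode (i, n)) x\<close> is large; this
  recovers an enumeration from a name of the image.\<close>

lemma ury_inverse_tracked:
  obtains T where "rec2 T"
    "\<And>q x. x \<in> X \<Longrightarrow> hilbert_cube_rep q = Some (\<lambda>e. ury e x) \<Longrightarrow> \<exists>p. tracks T q p \<and> enum p x"
proof -
  let ?f = "\<lambda>q e. if 1 / 2 < rat_enum (q (prod_encode (e, 3))) then Suc (pfst e) else 0"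
  have "tot ?f" by (intro comp_intros dec_ratc_less rat_intros)
  from total_tracked[OF this] obtain T where T: "rec2 T" "\<And>q. tracks T q (?f q)" by blast
  have "enum (?f q) x" if x: "x \<in> X" and q: "hilbert_cube_rep q = Some (\<lambda>e. ury e x)" for q x
  proof -
    have near: "\<bar>rat_enum (q (prod_encode (e, 3))) - ury e x\<bar> \<le> 1 / 8" for e
      using hilbert_cube_rep_SomeD(2)[OF q, of e 3] by (simp add: power3_eq_cube)
    have "x \<in> B (pfst e)" if "1 / 2 < rat_enum (q (prod_encode (e, 3)))" for e
      using near[of e] that ury_eq_0[of x e] by (auto simp: abs_if split: if_splits)
    moreover have "\<exists>e. pfst e = i \<and> 1 / 2 < rat_enum (q (prod_encode (e, 3)))" if i: "x \<in> B i" for i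
    proof -
      obtain n where n: "7 / 8 \<le> ury (prod_encode (i, n)) x" using ury_large_ex[OF x i] by blast
      with near[of "prod_encode (i, n)"] show ?thesis
        by (intro exI[of _ "prod_encode (i, n)"]) (auto simp: abs_if split: if_splits)
    qed
    ultimately have "enumerated_set (?f q) = {i. x \<in> B i}"
      unfolding enumerated_set_def by (auto split: if_splits)
    with x show ?thesis by (simp add: enum_def)
  qed
  with T show ?thesis by (intro that[OF T(1)]) blast
qed

end

text \<open>Moves predicates from names in \<open>\<rho>\<close> to enumerations;
  \<open>semidecides_img\<close> goes back. Prefixes of the translated name are only known to become
  long, so \<open>mono\<close> is what makes acceptance permanent.\<close>

lemma (in subbase) stable_img:
  assumes "semidecides \<rho> S U" "ran \<rho> \<subseteq> X" and mono: "\<And>p k l. S (pre p k) \<Longrightarrow> k \<le> l \<Longrightarrow> S (pre p l)"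
    and T: "\<And>q x. enum q x \<Longrightarrow> \<exists>p. tracks T q p \<and> \<rho> p = Some x"
  shows "stable (\<lambda>w. S (img T w)) \<and> sat (\<lambda>w. S (img T w)) = U"
proof (rule sat_eqI)
  fix q x assume q: "enum q x"
  then obtain p where p: "tracks T q p" "\<rho> p = Some x" using T by blast
  have U: "x \<in> U \<longleftrightarrow> (\<exists>k. S (pre p k))" using assms(1) p(2) unfolding semidecides_def by blast
  show "x \<in> U" if "S (img T (pre q k))" for k
    using that U img_tracks[OF p(1), of k] by metis
  assume "x \<in> U"
  then obtain k where k: "S (pre p k)" using U by blast
  have "\<forall>\<^sub>F i in sequentially. k \<le> len (img T (pre q i))"
    using len_img_tracks[OF p(1)] unfolding filterlim_at_top by blast
  then show "\<forall>\<^sub>F i in sequentially. S (img T (pre q i))"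
  proof eventually_elim
    case (elim i)
    from mono[OF k this] show ?case by (simp flip: img_tracks[OF p(1)])
  qed
next
  show "U \<subseteq> X" using assms(1,2) unfolding semidecides_def by blast
qed

lemma (in subbase) semidecides_img:
  assumes "stable g" "sat g \<subseteq> ran \<rho>" and T: "\<And>p x. \<rho> p = Some x \<Longrightarrow> \<exists>q. tracks T p q \<and> enum q x"
  shows "semidecides \<rho> (\<lambda>w. g (img T w)) (sat g)"
  unfolding semidecides_def
proof (intro conjI allI impI assms(2) iffI)
  fix p x assume "\<rho> p = Some x"
  then obtain q where q: "tracks T p q" "enum q x" using T by blast
  show "\<exists>k. g (img T (pre p k))" if "x \<in> sat g"
  proof -
    from eventually_compose_filterlim[OF stableD[OF assms(1) q(2) that] len_img_tracks[OF q(1)]]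
    have "\<forall>\<^sub>F k in sequentially. g (img T (pre p k))" by (simp flip: img_tracks[OF q(1)])
    from eventually_happens'[OF sequentially_bot this] show ?thesis .
  qed
  show "x \<in> sat g" if "\<exists>k. g (img T (pre p k))"
    using that satI[OF q(2)] img_tracks[OF q(1)] by metis
qed

text \<open>Having K as a prefix would depend on the enumeration; asking that the nonzero letters of
  K occur somewhere in w does not.\<close>

definition cyl_word :: "nat \<Rightarrow> nat \<Rightarrow> bool" where
  "cyl_word K w \<longleftrightarrow> (\<forall>i < len K. ent K i = 0 \<or> (\<exists>l < len w. ent w l = ent K i))"

lemma (in subbase) cyl_word: "stable (cyl_word K) \<and> sat (cyl_word K) = cyl K"
proof (rule sat_eqI)
  fix p x assume p: "enum p x"
  have B: "x \<in> B (Suc i - 1) \<longleftrightarrow> (\<exists>l. p l = Suc i)" for i using enum_iff[OF p] by simp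
  show "x \<in> cyl K" if w: "cyl_word K (pre p k)" for k
  proof -
    have "ent K i = 0 \<or> x \<in> B (ent K i - 1)" if "i < len K" for i
      using w that B[of "ent K i - 1"] unfolding cyl_word_def by (cases "ent K i") fastforce+
    with enum_in[OF p] show ?thesis unfolding cyl_def by blast
  qed
  assume x: "x \<in> cyl K"
  have "\<forall>\<^sub>F k in sequentially. \<forall>i\<in>{..<len K}. ent K i = 0 \<or> (\<exists>l<k. p l = ent K i)"
  proof (rule eventually_ball_finite, simp, safe)
    fix i assume "i < len K"
    show "\<forall>\<^sub>F k in sequentially. ent K i = 0 \<or> (\<exists>l<k. p l = ent K i)"
    proof (cases "ent K i")
      case (Suc j)
      with x \<open>i < len K\<close> have "x \<in> B j" unfolding cyl_def by force
      then obtain l where "p l = ent K i" using enum_iff[OF p] Suc by auto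
      then show ?thesis by (intro eventually_mono[OF eventually_gt_at_top[of l]]) blast
    qed simp
  qed
  then show "\<forall>\<^sub>F k in sequentially. cyl_word K (pre p k)"
    by (rule eventually_mono) (auto simp: cyl_word_def)
qed (auto simp: cyl_def)

theorem regular_imp_computably_embeds:
  assumes "computably_second_countable \<rho>" and reg: "strongly_computably_regular \<rho>"
  shows "computably_embeds \<rho> hilbert_cube_rep"
proof -
  let ?X = "ran \<rho>"
  obtain B where sub: "\<And>i. B i \<subseteq> ?X" and inj: "inj_on (\<lambda>x. {i. x \<in> B i}) ?X"
    and eqv: "computably_equivalent \<rho> (subbase_rep ?X B)"
    using assms(1) unfolding computably_second_countable_def by blast
  interpret subbase ?X B .
  have enum: "subbase_rep ?X B p = Some x \<longleftrightarrow> enum p x" for p x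
    unfolding enum_def by (rule subbase_rep_eq_Some[OF inj])
  obtain T1 where T1: "rec2 T1" "\<And>p x. \<rho> p = Some x \<Longrightarrow> \<exists>q. tracks T1 p q \<and> enum q x"
    using eqv unfolding computably_equivalent_def computable_on_iff enum id_def by (metis ranI)
  obtain T2 where T2: "rec2 T2" "\<And>q x. enum q x \<Longrightarrow> \<exists>p. tracks T2 q p \<and> \<rho> p = Some x"
    using eqv unfolding computably_equivalent_def computable_on_iff enum id_def
    by (metis enum ranI)
  obtain TP where TP: "rec2 TP" "\<And>\<alpha> W. open_rep \<rho> \<alpha> = Some W \<Longrightarrow> \<exists>q U V. tracks TP \<alpha> q \<and>
      pair_rep (seq_rep (open_rep \<rho>)) (seq_rep (closed_rep \<rho>)) q = Some (U, V) \<and>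
      (U, V) \<in> regular_shrinkings \<rho> W"
  proof -
    have ne: "regular_shrinkings \<rho> W \<noteq> {}" if "open_rep \<rho> \<alpha> = Some W" for \<alpha> W
      using reg that unfolding strongly_computably_regular_def open_rep_eq_Some by blast
    obtain T where "rec2 T" and T: "\<And>p x. open_rep \<rho> p = Some x \<and> regular_shrinkings \<rho> x \<noteq> {} \<Longrightarrow>
      \<exists>q y. tracks T p q \<and> pair_rep (seq_rep (open_rep \<rho>)) (seq_rep (closed_rep \<rho>)) q = Some y \<and>
        y \<in> regular_shrinkings \<rho> x"
      using reg unfolding strongly_computably_regular_def computable_multi_iff by blast
    show ?thesis by (rule that[OF \<open>rec2 T\<close>]) (use T ne in \<open>metis surj_pair\<close>)
  qed
  \<comment> \<open>A name in \<open>\<rho>\<close> is first translated by \<open>T1\<close> into an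
    enumeration. The resulting names of basic open sets are computable from K without an
    oracle.\<close>
  define \<alpha> where "\<alpha> K = name_of (\<lambda>v. cyl_word K (img T1 v))" for K
  have tot_\<alpha>: "tot (\<lambda>p n. \<alpha> (k p n) (f p n))" if "tot k" "tot f" for k f
  proof -
    have k: "tot (\<lambda>p n. k p (g p n))" if "tot g" for g using tot_comp[OF \<open>tot k\<close> that] .
    show ?thesis unfolding \<alpha>_def cyl_word_def
      by (intro tot_name_of comp_intros tot_img[OF T1(1)] that(2) k)
  qed
  have "open_rep \<rho> (\<alpha> K) = Some (cyl K)" for K
    unfolding \<alpha>_def using semidecides_img[of "cyl_word K" \<rho> T1] cyl_word[of K] sat_subset[of "cyl_word K"] T1(2)
    by (intro open_rep_name_of) auto
  then have "\<forall>K. \<exists>q U V. tracks TP (\<alpha> K) q \<and>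
      pair_rep (seq_rep (open_rep \<rho>)) (seq_rep (closed_rep \<rho>)) q = Some (U, V) \<and>
      (U, V) \<in> regular_shrinkings \<rho> (cyl K)" using TP(2) by blast
  then obtain q U V where q: "\<And>K. tracks TP (\<alpha> K) (q K)"
    and qUV: "\<And>K. pair_rep (seq_rep (open_rep \<rho>)) (seq_rep (closed_rep \<rho>)) (q K) = Some (U K, V K)"
    and UV: "\<And>K. (U K, V K) \<in> regular_shrinkings \<rho> (cyl K)"
    by metis
  have U: "semidecides \<rho> (accepts (\<lambda>m. q K (2 * prod_encode (n, m)))) (U K n)" for K n
    using qUV[of K] unfolding pair_rep_eq_Some seq_rep_eq_Some by (intro semidecides_accepts) auto
  have V: "semidecides \<rho> (accepts (\<lambda>m. q K (2 * prod_encode (n, m) + 1))) (?X - V K n)" for K n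
  proof -
    have "V K n \<subseteq> ?X" using UV[of K] unfolding regular_shrinkings_def cyl_def by blast
    moreover obtain W where "open_rep \<rho> (\<lambda>m. q K (2 * prod_encode (n, m) + 1)) = Some W" "V K n = ?X - W"
      using qUV[of K] unfolding pair_rep_eq_Some seq_rep_eq_Some closed_rep_eq_Some by blast
    moreover from this have "W \<subseteq> ?X" by (simp add: open_rep_eq_Some openin_final_topology)
    ultimately show ?thesis using semidecides_accepts[of \<rho> _ W] by (metis double_diff subset_refl)
  qed
  \<comment> \<open>The sequences \<open>q K\<close> were chosen, but \<open>TP\<close> determines
    them: each value is found by running \<open>TP\<close> on growing prefixes of
    \<open>\<alpha> K\<close> until it answers.\<close>
  have "tot (\<lambda>p m. q (pfst m) (psnd m))"
  proof -
    have ex: "\<exists>l. TP (pre (\<alpha> K) l) i \<noteq> 0" for K i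
      using eventually_happens'[OF sequentially_bot tracksD(2)[OF q[of K], of i]]
      by (metis nat.distinct(1))
    have "q K i = TP (pre (\<alpha> K) (LEAST l. TP (pre (\<alpha> K) l) i \<noteq> 0)) i - 1" for K i
      using LeastI_ex[OF ex[of K i]] tracksD(1)[OF q[of K]] by (metis diff_Suc_1 not0_implies_Suc)
    moreover have "tot (\<lambda>p m. TP (pre (\<alpha> (pfst m)) (LEAST l. TP (pre (\<alpha> (pfst m)) l) (psnd m) \<noteq> 0)) (psnd m) - 1)"
      by (intro comp_intros tot_rec2[OF TP(1)] tot_Least tot_\<alpha>) (use ex in simp)
    ultimately show ?thesis by simp
  qed
  note tot_q = tot_comp2[OF this]
  define u where "u K n w = accepts (\<lambda>m. q K (2 * prod_encode (n, m))) (img T2 w)" for K n w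
  define c where "c K n w = accepts (\<lambda>m. q K (2 * prod_encode (n, m) + 1)) (img T2 w)" for K n w
  have u: "stable (u K n) \<and> sat (u K n) = U K n" for K n
    unfolding u_def by (rule stable_img[OF U _ accepts_mono T2(2)]) auto
  have c: "stable (c K n) \<and> sat (c K n) = ?X - V K n" for K n
    unfolding c_def by (rule stable_img[OF V _ accepts_mono T2(2)]) auto
  interpret regular_subbase ?X B u c
  proof
    fix K n
    show "stable (u K n)" "stable (c K n)" using u c by auto
    have K: "U K n \<subseteq> V K n" "V K n \<subseteq> cyl K" "cyl K = (\<Union>n. U K n)" for n
      using UV[of K] unfolding regular_shrinkings_def by blast+
    show "sat (u K n) \<inter> sat (c K n) = {}" using u c K(1) by blast
    have "cyl K \<subseteq> ?X" by (auto simp: cyl_def)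
    with c K(2) show "sat (c K n) \<union> cyl K = ?X" by blast
    show "cyl K = (\<Union>n. sat (u K n))" using u K(3) by simp
    show "dec (\<lambda>p m. u (pfst m) (pfst (psnd m)) (psnd (psnd m)))"
      "dec (\<lambda>p m. c (pfst m) (pfst (psnd m)) (psnd (psnd m)))"
      unfolding u_def c_def by (intro dec_accepts comp_intros tot_q tot_img[OF T2(1)])+
  qed
  obtain F where F: "rec2 F" "\<And>p x. enum p x \<Longrightarrow> \<exists>q. tracks F p q \<and> hilbert_cube_rep q = Some (\<lambda>e. ury e x)"
    using ury_tracked by blast
  obtain G where G: "rec2 G"
    "\<And>q x. x \<in> ?X \<Longrightarrow> hilbert_cube_rep q = Some (\<lambda>e. ury e x) \<Longrightarrow> \<exists>p. tracks G q p \<and> enum p x"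
    using ury_inverse_tracked by blast
  \<comment> \<open>Points with the same image share a name of it, and the inverse realizer turns
    this name into a common enumeration.\<close>
  have "inj_on (\<lambda>x e. ury e x) ?X"
  proof (rule inj_onI)
    fix x y assume x: "x \<in> ?X" and y: "y \<in> ?X" and eq: "(\<lambda>e. ury e x) = (\<lambda>e. ury e y)"
    obtain q where "hilbert_cube_rep q = Some (\<lambda>e. ury e x)" using F(2) enum_ex'[OF x] by blast
    with G(2)[OF x this] G(2)[OF y] eq have "\<exists>p. enum p x \<and> enum p y"
      using tracks_unique by metis
    then show "x = y" unfolding enum_def using inj_onD[OF inj _ x y] by auto
  qed
  moreover have "\<exists>q. tracks (\<lambda>w. F (img T1 w)) p q \<and> hilbert_cube_rep q = Some (\<lambda>e. ury e x)"
    if "\<rho> p = Some x" for p x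
    using T1(2)[OF that] F(2) tracks_img by blast
  moreover have "\<exists>p. tracks (\<lambda>w. T2 (img G w)) q p \<and> \<rho> p = Some x"
    if "x \<in> ?X" "hilbert_cube_rep q = Some (\<lambda>e. ury e x)" for q x
    using G(2)[OF that] T2(2) tracks_img by blast
  ultimately show ?thesis
    unfolding computably_embeds_iff
    by (intro exI[of _ "\<lambda>x e. ury e x"] exI[of _ "\<lambda>w. F (img T1 w)"] exI[of _ "\<lambda>w. T2 (img G w)"])
      (use rec2_img[OF T1(1) F(1)] rec2_img[OF G(1) T2(1)] in auto)
qed

section \<open>The Hilbert cube as a computable metric space\<close>

lemma rat_enum_surj: assumes "r \<in> \<rat>" shows "\<exists>c. rat_enum c = r"
proof -
  obtain i n where r: "r = real_of_int i / real n" "n \<noteq> 0"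
    using assms unfolding Rats_eq_int_div_nat by blast
  have "rat_enum (prod_encode (prod_encode (nat i, nat (- i)), n - 1)) = r"
    using r by (cases "0 \<le> i") (simp_all add: rat_enum_eq)
  then show ?thesis by blast
qed

lemma rat_enum_dense: assumes "0 < e" shows "\<exists>c. \<bar>rat_enum c - x\<bar> < e"
proof -
  obtain r where "r \<in> \<rat>" "x < r" "r < x + e"
    using Rats_dense_in_real[of x "x + e"] assms by auto
  moreover from rat_enum_surj[OF this(1)] obtain c where "rat_enum c = r" by blast
  ultimately show ?thesis by (intro exI[of _ c]) auto
qed

definition cube :: "(nat \<Rightarrow> real) set" where "cube = {x. \<forall>i. x i \<in> {0..1}}"

text \<open>A supremum instead of a weighted sum makes the distance of two finitely supported
  rational points a maximum of finitely many rationals, so a code of its exact value can be found by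
  search.\<close>

definition cube_dist :: "(nat \<Rightarrow> real) \<Rightarrow> (nat \<Rightarrow> real) \<Rightarrow> real" where
  "cube_dist x y = (SUP i. min ((1 / 2) ^ i) \<bar>x i - y i\<bar>)"

definition cube_point :: "nat \<Rightarrow> nat \<Rightarrow> real" where
  "cube_point c i = (if i < len c then max 0 (min 1 (rat_enum (ent c i))) else 0)"

lemma cube_dist_upper: "min ((1 / 2) ^ i) \<bar>x i - y i\<bar> \<le> cube_dist x y"
proof -
  have "min ((1 / 2) ^ i) \<bar>x i - y i\<bar> \<le> 1" for i by (simp add: min_le_iff_disj power_le_one)
  then have "bdd_above (range (\<lambda>i. min ((1 / 2) ^ i) \<bar>x i - y i\<bar>))" by (intro bdd_aboveI) auto
  then show ?thesis unfolding cube_dist_def by (intro cSUP_upper) auto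
qed

lemma cube_dist_least: "(\<And>i. min ((1 / 2) ^ i) \<bar>x i - y i\<bar> \<le> b) \<Longrightarrow> cube_dist x y \<le> b"
  unfolding cube_dist_def by (intro cSUP_least) auto

lemma cube_dist_nonneg: "0 \<le> cube_dist x y"
  using order_trans[OF _ cube_dist_upper[of 0 x y], of 0] by simp

lemma Metric_space_cube: "Metric_space cube cube_dist"
proof
  fix x y z :: "nat \<Rightarrow> real"
  show "0 \<le> cube_dist x y" by (rule cube_dist_nonneg)
  show "cube_dist x y = cube_dist y x" unfolding cube_dist_def by (simp add: abs_minus_commute)
  show "cube_dist x y = 0 \<longleftrightarrow> x = y"
  proof
    assume *: "cube_dist x y = 0"
    show "x = y"
    proof
      fix i
      from cube_dist_upper[of i x y] * have "min ((1 / 2) ^ i) \<bar>x i - y i\<bar> \<le> 0" by simp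
      moreover have "(0 :: real) < (1 / 2) ^ i" by simp
      ultimately have "\<bar>x i - y i\<bar> \<le> 0" by linarith
      then show "x i = y i" by simp
    qed
  next
    assume "x = y"
    then have "cube_dist x y \<le> 0" by (intro cube_dist_least) simp
    with cube_dist_nonneg[of x y] show "cube_dist x y = 0" by simp
  qed
  show "cube_dist x z \<le> cube_dist x y + cube_dist y z"
  proof (rule cube_dist_least)
    fix i
    have "(0 :: real) < (1 / 2) ^ i" by simp
    then have "min ((1 / 2) ^ i) \<bar>x i - z i\<bar> \<le> min ((1 / 2) ^ i) \<bar>x i - y i\<bar> + min ((1 / 2) ^ i) \<bar>y i - z i\<bar>"
      by linarith
    also have "\<dots> \<le> cube_dist x y + cube_dist y z" by (intro add_mono cube_dist_upper)
    finally show "min ((1 / 2) ^ i) \<bar>x i - z i\<bar> \<le> cube_dist x y + cube_dist y z" .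
  qed
qed

lemma cube_point_in_cube: "cube_point c \<in> cube"
  by (simp add: cube_def cube_point_def)

lemma cube_point_near:
  assumes x: "x \<in> cube" and p: "\<And>i. i < n \<Longrightarrow> \<bar>rat_enum (p i) - x i\<bar> \<le> (1 / 2) ^ n"
  shows "cube_dist (cube_point (pre p n)) x \<le> (1 / 2) ^ n"
proof (rule cube_dist_least)
  fix i
  show "min ((1 / 2) ^ i) \<bar>cube_point (pre p n) i - x i\<bar> \<le> (1 / 2) ^ n"
  proof (cases "i < n")
    case True
    have "0 \<le> x i" "x i \<le> 1" using x by (auto simp: cube_def)
    \<comment> \<open>Clamping to [0, 1] cannot move a number away from a point of that
      interval.\<close>
    then have "\<bar>max 0 (min 1 (rat_enum (p i))) - x i\<bar> \<le> \<bar>rat_enum (p i) - x i\<bar>"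
      by (auto simp: max_def min_def)
    with True p[OF True] show ?thesis by (simp add: cube_point_def min_le_iff_disj)
  next
    case False
    then have "(1 / 2 :: real) ^ i \<le> (1 / 2) ^ n" by (intro power_decreasing) auto
    then show ?thesis by (simp add: min_le_iff_disj)
  qed
qed

lemma ratc_cube_point:
  assumes "tot f" "tot g" shows "ratc (\<lambda>p n. cube_point (f p n) (g p n))"
  unfolding cube_point_def by (intro comp_intros rat_intros assms)

lemma cube_dist_computable:
  "computable_on (pair_rep nat_rep nat_rep) real_rep UNIV
     (\<lambda>(i, j). cube_dist (cube_point i) (cube_point j))"
proof -
  define v where "v c c' i = min ((1 / 2) ^ i) \<bar>cube_point c i - cube_point c' i\<bar>" for c c' i
  \<comment> \<open>Beyond both lengths the coordinates of the two points are 0, so the bound loses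
    nothing. The alternative value 0 serves two empty words. As the value found is exact, every
    position n gets the same code.\<close>
  let ?P = "\<lambda>(p :: nat \<Rightarrow> nat) (n :: nat) e. (\<forall>i < len (p 0) + len (p 1). v (p 0) (p 1) i \<le> rat_enum e) \<and>
    (rat_enum e = 0 \<or> (\<exists>i < len (p 0) + len (p 1). v (p 0) (p 1) i = rat_enum e))"
  have v: "ratc (\<lambda>p n. v (f p n) (g p n) (h p n))" if "tot f" "tot g" "tot h" for f g h
    unfolding v_def by (intro rat_intros ratc_cube_point that)
  have 1: "dec (\<lambda>p m. ?P p (pfst m) (psnd m))"
    by (intro comp_intros v rat_intros)
  have 2: "tot (\<lambda>p m. psnd m)" by (intro comp_intros)
  obtain T where T: "rec2 T" "\<And>p. (\<And>n. \<exists>e. ?P p n e) \<Longrightarrow> tracks T p (\<lambda>n. LEAST e. ?P p n e)"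
    using search_tracked[of ?P "\<lambda>p n e. e", OF 1 2] by blast
  have ex: "\<exists>e. ?P p n e" for p and n :: nat
  proof -
    let ?S = "insert 0 (v (p 0) (p 1) ` {..< len (p 0) + len (p 1)})"
    define m where "m = Max ?S"
    have m: "m = 0 \<or> (\<exists>i < len (p 0) + len (p 1). v (p 0) (p 1) i = m)"
      using Max_in[of ?S] unfolding m_def[symmetric] by auto
    have le: "v (p 0) (p 1) i \<le> m" if "i < len (p 0) + len (p 1)" for i
      unfolding m_def using that by (intro Max_ge) auto
    obtain c where c: "\<And>q i. rat_enum (c q i) = v (p 0) (p 1) i"
      using v[of "\<lambda>_ _. p 0" "\<lambda>_ _. p 1" "\<lambda>_ i. i", OF tot_const tot_const tot_id] unfolding ratc_def by blast
    have "rat_enum 0 = 0" by (simp add: rat_enum_eq)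
    with m c have "\<exists>e. rat_enum e = m" by blast
    then obtain e where e: "rat_enum e = m" ..
    have "?P p n e" unfolding e using m le by blast
    then show ?thesis by blast
  qed
  have "real_rep (\<lambda>n. LEAST e. ?P p n e) = Some (cube_dist (cube_point (p 0)) (cube_point (p 1)))" for p
  proof -
    define e where "e = (LEAST e. ?P p 0 e)"
    have e: "?P p 0 e" unfolding e_def by (rule LeastI_ex) (rule ex)
    have v_nonneg: "0 \<le> v c c' i" for c c' i by (simp add: v_def)
    then have e_nonneg: "0 \<le> rat_enum e" using e by (metis order_refl)
    have "cube_dist (cube_point (p 0)) (cube_point (p 1)) \<le> rat_enum e"
    proof (rule cube_dist_least)
      fix i
      show "min ((1 / 2) ^ i) \<bar>cube_point (p 0) i - cube_point (p 1) i\<bar> \<le> rat_enum e"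
      proof (cases "i < len (p 0) + len (p 1)")
        case True
        with e show ?thesis unfolding v_def by blast
      next
        case False
        with e_nonneg show ?thesis by (simp add: cube_point_def)
      qed
    qed
    moreover have "rat_enum e \<le> cube_dist (cube_point (p 0)) (cube_point (p 1))"
      using e cube_dist_nonneg cube_dist_upper unfolding v_def by metis
    ultimately show ?thesis unfolding e_def[symmetric] by (intro real_rep_SomeI) simp
  qed
  then show ?thesis
    unfolding computable_on_iff using T ex
    by (intro exI[of _ T]) (auto simp: pair_rep_def nat_rep_def)
qed

lemma computable_metric_space_cube: "computable_metric_space cube cube_dist cube_point"
proof -
  interpret Metric_space cube cube_dist by (rule Metric_space_cube)
  have "\<exists>c. cube_dist x (cube_point c) < r" if x: "x \<in> cube" and "0 < r" for x r
  proof -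
    obtain n where n: "(1 / 2) ^ n < r" using \<open>0 < r\<close> real_arch_pow_inv[of r "1 / 2"] by auto
    have "\<forall>i. \<exists>c. \<bar>rat_enum c - x i\<bar> < (1 / 2) ^ n" by (intro allI rat_enum_dense) simp
    then obtain p where "\<And>i. \<bar>rat_enum (p i) - x i\<bar> < (1 / 2) ^ n" by metis
    from cube_point_near[OF x less_imp_le[OF this]] n show ?thesis
      by (intro exI[of _ "pre p n"]) (simp add: commute)
  qed
  then have "mtopology closure_of range cube_point = cube"
    using cube_point_in_cube unfolding metric_closure_of by (auto simp: mball_def)
  then show ?thesis
    unfolding computable_metric_space_def
    using Metric_space_cube cube_point_in_cube cube_dist_computable by blast
qed

lemma hilbert_cube_embeds_cube:
  "computably_embeds hilbert_cube_rep (cauchy_rep cube cube_dist cube_point)"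
proof -
  have range: "range cube_point \<subseteq> cube" using cube_point_in_cube by blast
  \<comment> \<open>Taking n + 2 coordinates, each with precision n + 2, bounds both the truncated
    and the approximated part by 2^-(n+2).\<close>
  let ?f = "\<lambda>q n. pre (\<lambda>i. q (prod_encode (i, n + 2))) (n + 2)"
  have "tot ?f" by (intro comp_intros)
  from total_tracked[OF this] obtain S where S: "rec2 S" "\<And>q. tracks S q (?f q)" by blast
  have fwd: "cauchy_rep cube cube_dist cube_point (?f q) = Some x" if q: "hilbert_cube_rep q = Some x" for q x
  proof -
    have x: "x \<in> cube" using hilbert_cube_rep_SomeD(1)[OF q] by (simp add: cube_def)
    show ?thesis
      by (intro cauchy_rep_SomeI[OF Metric_space_cube range x] cube_point_near[OF x]
        hilbert_cube_rep_SomeD(2)[OF q])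
  qed
  \<comment> \<open>Coordinate i is controlled only when the distance is below the cap 2^-i;
    precision i + n + 3 is strictly below it and also fine enough for position n.\<close>
  have "ratc (\<lambda>p n. cube_point (p (pfst n + psnd n + 3)) (pfst n))"
    by (intro ratc_cube_point comp_intros)
  then obtain c where c: "tot c" "\<And>p n. rat_enum (c p n) = cube_point (p (pfst n + psnd n + 3)) (pfst n)"
    unfolding ratc_def by blast
  from total_tracked[OF c(1)] obtain T where T: "rec2 T" "\<And>p. tracks T p (c p)" by blast
  have bwd: "hilbert_cube_rep (c p) = Some x" if p: "cauchy_rep cube cube_dist cube_point p = Some x" for p x
  proof (rule hilbert_cube_rep_SomeI)
    show "x i \<in> {0..1}" for i
      using cauchy_rep_SomeD(1)[OF Metric_space_cube range p] by (simp add: cube_def)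
    fix i n
    have "min ((1 / 2) ^ i) \<bar>cube_point (p (i + n + 3)) i - x i\<bar> \<le> (1 / 2) ^ (i + n + 3)"
      using cube_dist_upper cauchy_rep_SomeD(2)[OF Metric_space_cube range p] by (rule order_trans)
    moreover have "(1 / 2 :: real) ^ (i + n + 3) < (1 / 2) ^ i" by (intro power_strict_decreasing) auto
    moreover have "(1 / 2 :: real) ^ (i + n + 3) \<le> (1 / 2) ^ (n + 2)" by (intro power_decreasing) auto
    ultimately show "\<bar>rat_enum (c p (prod_encode (i, n))) - x i\<bar> \<le> (1 / 2) ^ (n + 2)"
      unfolding c(2) pfst_prod_encode psnd_prod_encode by linarith
  qed
  have "inj_on (\<lambda>x. x) (ran hilbert_cube_rep)" by simp
  moreover have "\<exists>r. tracks S q r \<and> cauchy_rep cube cube_dist cube_point r = Some x"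
    if "hilbert_cube_rep q = Some x" for q x
    using S(2)[of q] fwd[OF that] by blast
  moreover have "\<exists>r. tracks T p r \<and> hilbert_cube_rep r = Some x"
    if "cauchy_rep cube cube_dist cube_point p = Some x" for p x
    using T(2)[of p] bwd[OF that] by blast
  ultimately show ?thesis
    unfolding computably_embeds_iff using S(1) T(1) by blast
qed

section \<open>Subspaces of computable metric spaces\<close>

lemma computable_metric_space_approx:
  assumes "computable_metric_space M d a"
  obtains D where "\<And>f g h. tot f \<Longrightarrow> tot g \<Longrightarrow> tot h \<Longrightarrow> tot (\<lambda>p n. D (f p n) (g p n) (h p n))"
    "\<And>i j n. \<bar>rat_enum (D i j n) - d (a i) (a j)\<bar> \<le> (1 / 2) ^ n"
proof -
  obtain T where T: "rec2 T" "\<And>p i j. pair_rep nat_rep nat_rep p = Some (i, j) \<Longrightarrow>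
      \<exists>q. tracks T p q \<and> real_rep q = Some (d (a i) (a j))"
    using assms unfolding computable_metric_space_def computable_on_iff by fastforce
  \<comment> \<open>A name of the pair (i, j) carries information only at positions 0 and 1, so its
    prefixes are computable from i and j.\<close>
  define w where "w i j k = pre (\<lambda>m. if m = 0 then i else j) k" for i j k :: nat
  have "\<exists>q. tracks T (\<lambda>m. if m = 0 then i else j) q \<and> real_rep q = Some (d (a i) (a j))" for i j
    by (rule T(2)) (simp add: pair_rep_def nat_rep_def)
  then obtain D where D: "\<And>i j. tracks T (\<lambda>m. if m = 0 then i else j) (D i j)"
    "\<And>i j. real_rep (D i j) = Some (d (a i) (a j))" by metis
  have ex: "\<exists>l. T (w i j l) n \<noteq> 0" for i j n
    using eventually_happens'[OF sequentially_bot tracksD(2)[OF D(1)[of i j], of n]]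
    unfolding w_def by (metis nat.distinct(1))
  have eq: "D i j n = T (w i j (LEAST l. T (w i j l) n \<noteq> 0)) n - 1" for i j n
    using LeastI_ex[OF ex[of i j n]] tracksD(1)[OF D(1)[of i j]] unfolding w_def
    by (metis diff_Suc_1 not0_implies_Suc)
  have w: "tot (\<lambda>p m. w (f p m) (g p m) (h p m))" if "tot f" "tot g" "tot h" for f g h
    unfolding w_def
    by (intro comp_intros that tot_comp[OF that(1) tot_pfst] tot_comp[OF that(2) tot_pfst])
  have "tot (\<lambda>p m. D (pfst m) (pfst (psnd m)) (psnd (psnd m)))"
    unfolding eq by (intro comp_intros w tot_rec2[OF T(1)] tot_Least) (use ex in simp)
  then have "tot (\<lambda>p n. D (f p n) (g p n) (h p n))" if "tot f" "tot g" "tot h" for f g h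
    using tot_comp[of "\<lambda>p m. D (pfst m) (pfst (psnd m)) (psnd (psnd m))", OF _
      tot_pair[OF that(1) tot_pair[OF that(2,3)]]] by simp
  moreover have "\<bar>rat_enum (D i j n) - d (a i) (a j)\<bar> \<le> (1 / 2) ^ n" for i j n
    by (rule real_rep_SomeD) (rule D(2))
  ultimately show ?thesis by (rule that)
qed

locale metric_embedding = Metric_space M d for M :: "'b set" and d +
  fixes a :: "nat \<Rightarrow> 'b" and \<rho> :: "'a representation" and f :: "'a \<Rightarrow> 'b"
    and S T :: "nat \<Rightarrow> nat \<Rightarrow> nat" and D :: "nat \<Rightarrow> nat \<Rightarrow> nat \<Rightarrow> nat"
  assumes a: "a i \<in> M" and dense: "y \<in> M \<Longrightarrow> 0 < e \<Longrightarrow> \<exists>i. d (a i) y < e"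
    and tot_D: "tot g1 \<Longrightarrow> tot g2 \<Longrightarrow> tot g3 \<Longrightarrow> tot (\<lambda>p n. D (g1 p n) (g2 p n) (g3 p n))"
    and D: "\<bar>rat_enum (D i j n) - d (a i) (a j)\<bar> \<le> (1 / 2) ^ n"
    and inj: "inj_on f (ran \<rho>)" and S: "rec2 S" and T: "rec2 T"
    and S_name: "\<rho> p = Some x \<Longrightarrow> \<exists>q. tracks S p q \<and> cauchy_rep M d a q = Some (f x)"
    and T_name: "x \<in> ran \<rho> \<Longrightarrow> cauchy_rep M d a q = Some (f x) \<Longrightarrow> \<exists>p. tracks T q p \<and> \<rho> p = Some x"
begin

section \<open>Comparing distances to dense points on names\<close>

lemma range_a: "range a \<subseteq> M"
  using a by blast

lemma f_in: assumes "x \<in> ran \<rho>" shows "f x \<in> M"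
proof -
  from assms obtain p where "\<rho> p = Some x" by (auto simp: ran_def)
  with S_name obtain q where "cauchy_rep M d a q = Some (f x)" by blast
  then show ?thesis by (rule cauchy_rep_SomeD(1)[OF Metric_space_axioms range_a])
qed

text \<open>The margin 2 * 2^-s has two sources: 2^-s for replacing the image point by the s-th
  entry of its Cauchy name and 2^-s for the approximate distance \<open>D\<close>.\<close>

definition below :: "nat \<Rightarrow> real \<Rightarrow> nat \<Rightarrow> bool" where
  "below i r v \<longleftrightarrow> (\<exists>s < len (img S v). rat_enum (D i (ent (img S v) s) s) + 2 * (1 / 2) ^ s < r)"

definition above :: "nat \<Rightarrow> real \<Rightarrow> nat \<Rightarrow> bool" where
  "above i r v \<longleftrightarrow> (\<exists>s < len (img S v). r < rat_enum (D i (ent (img S v) s) s) - 2 * (1 / 2) ^ s)"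

lemma dec_below_above:
  assumes "tot i" "ratc r" "tot v"
  shows "dec (\<lambda>p n. below (i p n) (r p n) (v p n))" "dec (\<lambda>p n. above (i p n) (r p n) (v p n))"
proof -
  have i: "tot (\<lambda>p n. i p (g p n))" and v: "tot (\<lambda>p n. v p (g p n))" and r: "ratc (\<lambda>p n. r p (g p n))"
    if "tot g" for g
  proof -
    show "tot (\<lambda>p n. i p (g p n))" "tot (\<lambda>p n. v p (g p n))" using assms tot_comp[OF _ that] by auto
    obtain c where "tot c" "r = (\<lambda>p n. rat_enum (c p n))" using assms(2) by (rule ratcE)
    then show "ratc (\<lambda>p n. r p (g p n))" using ratc_rat_enum[OF tot_comp[OF _ that]] by simp
  qed
  show "dec (\<lambda>p n. below (i p n) (r p n) (v p n))" "dec (\<lambda>p n. above (i p n) (r p n) (v p n))"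
    unfolding below_def above_def by (intro comp_intros rat_intros tot_img[OF S] tot_D assms i v r)+
qed

lemma approx_dist:
  assumes "cauchy_rep M d a q = Some y" "y \<in> M"
  shows "\<bar>rat_enum (D i (q s) s) - d (a i) y\<bar> \<le> 2 * (1 / 2) ^ s"
proof -
  have "d (a (q s)) y \<le> (1 / 2) ^ s" by (rule cauchy_rep_SomeD(2)[OF Metric_space_axioms range_a assms(1)])
  moreover have "d (a i) y \<le> d (a i) (a (q s)) + d (a (q s)) y" "d (a i) (a (q s)) \<le> d (a i) y + d (a (q s)) y"
    using triangle[OF a a assms(2)] triangle[OF a assms(2) a] by (auto simp: commute)
  ultimately show ?thesis using D[of i "q s" s] by linarith
qed

lemma below_above_sound:
  assumes "\<rho> p = Some x"
  shows "below i r (pre p k) \<Longrightarrow> d (a i) (f x) < r" "above i r (pre p k) \<Longrightarrow> r < d (a i) (f x)"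
proof -
  obtain q where q: "tracks S p q" "cauchy_rep M d a q = Some (f x)" using S_name[OF assms] by blast
  have x: "f x \<in> M" using f_in assms by (auto simp: ran_def)
  define l where "l = len (img S (pre p k))"
  have l: "img S (pre p k) = pre q l" unfolding l_def by (rule img_tracks[OF q(1)])
  show "d (a i) (f x) < r" if "below i r (pre p k)"
  proof -
    from that obtain s where "rat_enum (D i (q s) s) + 2 * (1 / 2) ^ s < r"
      unfolding below_def l by auto
    with approx_dist[OF q(2) x, of i s] show ?thesis by linarith
  qed
  show "r < d (a i) (f x)" if "above i r (pre p k)"
  proof -
    from that obtain s where "r < rat_enum (D i (q s) s) - 2 * (1 / 2) ^ s"
      unfolding above_def l by auto
    with approx_dist[OF q(2) x, of i s] show ?thesis by linarith
  qed
qed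

lemma below_above_complete:
  assumes "\<rho> p = Some x"
  shows "d (a i) (f x) < r \<Longrightarrow> \<forall>\<^sub>F k in sequentially. below i r (pre p k)"
    "r < d (a i) (f x) \<Longrightarrow> \<forall>\<^sub>F k in sequentially. above i r (pre p k)"
proof -
  obtain q where q: "tracks S p q" "cauchy_rep M d a q = Some (f x)" using S_name[OF assms] by blast
  have x: "f x \<in> M" using f_in assms by (auto simp: ran_def)
  have len: "\<forall>\<^sub>F k in sequentially. s < len (img S (pre p k))" for s
    using len_img_tracks[OF q(1)] unfolding filterlim_at_top Suc_le_eq[symmetric] by blast
  have ent: "ent (img S (pre p k)) s = q s" if "s < len (img S (pre p k))" for k s
    using that by (subst img_tracks[OF q(1)]) simp
  \<comment> \<open>The factor 4 adds the margin in the tests to the error in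
    \<open>approx_dist\<close>, each being 2 * 2^-s.\<close>
  have small: "\<exists>s. 4 * (1 / 2) ^ s < e" if "0 < e" for e :: real
    using real_arch_pow_inv[of "e / 4" "1 / 2"] that by (auto simp: mult.commute)
  show "\<forall>\<^sub>F k in sequentially. below i r (pre p k)" if r: "d (a i) (f x) < r"
  proof -
    obtain s where s: "4 * (1 / 2) ^ s < r - d (a i) (f x)" using small[of "r - d (a i) (f x)"] r by auto
    show ?thesis using len[of s]
    proof eventually_elim
      case (elim k)
      have "rat_enum (D i (q s) s) + 2 * (1 / 2) ^ s < r"
        using approx_dist[OF q(2) x, of i s] s by linarith
      with elim show ?case unfolding below_def by (intro exI[of _ s]) (simp add: ent)
    qed
  qed
  show "\<forall>\<^sub>F k in sequentially. above i r (pre p k)" if r: "r < d (a i) (f x)"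
  proof -
    obtain s where s: "4 * (1 / 2) ^ s < d (a i) (f x) - r" using small[of "d (a i) (f x) - r"] r by auto
    show ?thesis using len[of s]
    proof eventually_elim
      case (elim k)
      have "r < rat_enum (D i (q s) s) - 2 * (1 / 2) ^ s"
        using approx_dist[OF q(2) x, of i s] s by linarith
      with elim show ?case unfolding above_def by (intro exI[of _ s]) (simp add: ent)
    qed
  qed
qed

lemma below_iff: "\<rho> p = Some x \<Longrightarrow> (\<exists>k. below i r (pre p k)) \<longleftrightarrow> d (a i) (f x) < r"
  using below_above_sound(1) eventually_happens'[OF sequentially_bot below_above_complete(1)] by blast

lemma above_iff: "\<rho> p = Some x \<Longrightarrow> (\<exists>k. above i r (pre p k)) \<longleftrightarrow> r < d (a i) (f x)"
  using below_above_sound(2) eventually_happens'[OF sequentially_bot below_above_complete(2)] by blast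

text \<open>All points of \<open>cell w\<close> have an image with a Cauchy name beginning with \<open>w\<close>; the radii leave
  enough room that each point lies in \<open>cell\<close> of all prefixes of a suitable Cauchy name.\<close>

definition cell :: "nat \<Rightarrow> 'a set" where
  "cell w = {x \<in> ran \<rho>. \<forall>t < len w. d (a (ent w t)) (f x) < (1 / 2) ^ (t + 2)}"

lemma tight_name: assumes "x \<in> ran \<rho>" shows "\<exists>p. \<forall>t. d (a (p t)) (f x) < (1 / 2) ^ (t + 2)"
proof -
  have "\<forall>t. \<exists>i. d (a i) (f x) < (1 / 2) ^ (t + 2)" by (intro allI dense f_in assms) simp
  then show ?thesis by metis
qed

lemma cauchy_tight:
  assumes "x \<in> ran \<rho>" "\<And>t. d (a (p t)) (f x) < (1 / 2) ^ (t + 2)"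
  shows "cauchy_rep M d a p = Some (f x)"
  using assms(2) by (intro cauchy_rep_SomeI[OF Metric_space_axioms range_a f_in[OF assms(1)]] less_imp_le)

text \<open>The word w, continued by a tight name, is a genuine Cauchy name of the image of each
  point in its cell. Acceptance was decided from w alone, so it applies to all these points at
  once.\<close>

lemma cell_subset:
  assumes "open_rep \<rho> \<alpha> = Some W" "accepts \<alpha> (img T w)" shows "cell w \<subseteq> W"
proof
  fix x assume "x \<in> cell w"
  then have x: "x \<in> ran \<rho>" and w: "\<And>t. t < len w \<Longrightarrow> d (a (ent w t)) (f x) < (1 / 2) ^ (t + 2)"
    by (auto simp: cell_def)
  obtain p where p: "\<And>t. d (a (p t)) (f x) < (1 / 2) ^ (t + 2)" using tight_name[OF x] by blast
  let ?p = "\<lambda>t. if t < len w then ent w t else p t"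
  have "cauchy_rep M d a ?p = Some (f x)" using p w by (intro cauchy_tight[OF x]) auto
  then obtain q where q: "tracks T ?p q" "\<rho> q = Some x" using T_name[OF x] by blast
  have "pre ?p (len w) = w" using pre_cong[of "len w" ?p "ent w"] by simp
  then have "accepts \<alpha> (pre q (len (img T w)))"
    using assms(2) img_tracks[OF q(1), of "len w"] by simp
  with semidecides_accepts[OF assms(1)] q(2) show "x \<in> W" unfolding semidecides_def by blast
qed

lemma cell_cover:
  assumes "open_rep \<rho> \<alpha> = Some W" "x \<in> W" shows "\<exists>w. accepts \<alpha> (img T w) \<and> x \<in> cell w"
proof -
  have x: "x \<in> ran \<rho>" using assms by (auto simp: open_rep_eq_Some openin_final_topology)
  obtain p where p: "\<And>t. d (a (p t)) (f x) < (1 / 2) ^ (t + 2)" using tight_name[OF x] by blast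
  obtain q where q: "tracks T p q" "\<rho> q = Some x" using T_name[OF x cauchy_tight[OF x p]] by blast
  obtain k where k: "accepts \<alpha> (pre q k)"
    using semidecides_accepts[OF assms(1)] assms(2) q(2) unfolding semidecides_def by blast
  have "\<forall>\<^sub>F l in sequentially. k \<le> len (img T (pre p l))"
    using len_img_tracks[OF q(1)] unfolding filterlim_at_top by blast
  from eventually_happens'[OF sequentially_bot this] obtain l where "k \<le> len (img T (pre p l))" by blast
  with accepts_mono[OF k] have "accepts \<alpha> (img T (pre p l))" by (metis img_tracks[OF q(1)])
  moreover have "x \<in> cell (pre p l)" using x p by (simp add: cell_def)
  ultimately show ?thesis by blast
qed

section \<open>Second countability of the embedded space\<close>

definition B :: "nat \<Rightarrow> 'a set" where
  "B e = {x \<in> ran \<rho>. d (a (pfst e)) (f x) < (1 / 2) ^ psnd e}"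

lemma openin_B: "openin (final_topology \<rho>) (B e)"
proof (rule semidecides_openin)
  show "semidecides \<rho> (below (pfst e) ((1 / 2) ^ psnd e)) (B e)"
    unfolding semidecides_def B_def by (auto simp: below_iff ranI)
qed

lemma B_cover: "(\<Union>e. B e) = ran \<rho>"
proof -
  have "\<exists>e. x \<in> B e" if "x \<in> ran \<rho>" for x
  proof -
    obtain p where "\<And>t. d (a (p t)) (f x) < (1 / 2) ^ (t + 2)" using tight_name[OF \<open>x \<in> ran \<rho>\<close>] by blast
    with \<open>x \<in> ran \<rho>\<close> have "x \<in> B (prod_encode (p 0, 0 + 2))"
      unfolding B_def pfst_prod_encode psnd_prod_encode by blast
    then show ?thesis ..
  qed
  then show ?thesis by (auto simp: B_def)
qed

lemma topology_B: "topology_generated_by (range B) = final_topology \<rho>"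
proof (rule topology_eq[THEN iffD2], intro allI iffI)
  fix W assume "openin (topology_generated_by (range B)) W"
  then have "generate_topology_on (range B) W" by (simp add: openin_topology_generated_by_iff)
  then show "openin (final_topology \<rho>) W"
    by induction (auto intro: openin_B)
next
  fix W assume "openin (final_topology \<rho>) W"
  then obtain S where "semidecides \<rho> S W" by (rule openin_semidecides)
  then have name: "open_rep \<rho> (name_of S) = Some W" by (rule open_rep_name_of)
  have top: "topspace (topology_generated_by (range B)) = ran \<rho>"
    using B_cover by (simp add: topology_generated_by_topspace)
  have "openin (topology_generated_by (range B)) (cell w)" for w
  proof -
    let ?B = "\<lambda>t. B (prod_encode (ent w t, t + 2))"
    \<comment> \<open>For the empty word the intersection runs over no ball, so the whole space has
      to appear as a factor.\<close>
    have "cell w = (\<Inter>t\<in>{..<len w}. ?B t) \<inter> topspace (topology_generated_by (range B))"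
      unfolding top by (auto simp: cell_def B_def)
    moreover have "openin (topology_generated_by (range B)) (?B t)" for t
      by (intro topology_generated_by_Basis) auto
    ultimately show ?thesis using openin_INT[of "{..<len w}" "topology_generated_by (range B)" ?B] by simp
  qed
  moreover have "W = \<Union> (cell ` {w. accepts (name_of S) (img T w)})"
    using cell_subset[OF name] cell_cover[OF name] by blast
  ultimately show "openin (topology_generated_by (range B)) W"
    by (metis (mono_tags, lifting) image_iff openin_Union)
qed

lemma inj_on_B: "inj_on (\<lambda>x. {e. x \<in> B e}) (ran \<rho>)"
proof (rule inj_onI)
  fix x y assume x: "x \<in> ran \<rho>" and y: "y \<in> ran \<rho>" and eq: "{e. x \<in> B e} = {e. y \<in> B e}"
  have M: "f x \<in> M" "f y \<in> M" using x y f_in by auto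
  have "d (f x) (f y) \<le> e" if e: "0 < e" for e
  proof -
    obtain n where n: "(1 / 2) ^ n < e / 2" using real_arch_pow_inv[of "e / 2" "1 / 2"] e by auto
    obtain i where "d (a i) (f x) < (1 / 2) ^ n" using dense[OF M(1), of "(1 / 2) ^ n"] by auto
    then have *: "x \<in> B (prod_encode (i, n))" using x by (simp add: B_def)
    then have "y \<in> B (prod_encode (i, n))" using eq by blast
    with * n triangle[OF M(1) a M(2), of i] show ?thesis by (simp add: B_def commute)
  qed
  then have "d (f x) (f y) \<le> 0" by (rule field_le_epsilon[of _ 0, simplified])
  then have "f x = f y" using M nonneg[of "f x" "f y"] by simp
  with inj x y show "x = y" by (auto dest: inj_onD)
qed

lemma computably_second_countable: "computably_second_countable \<rho>"
proof -
  let ?\<sigma> = "subbase_rep (ran \<rho>) B"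
  note enum = subbase_rep_eq_Some[OF inj_on_B]
  have "x \<in> ran ?\<sigma>" if "x \<in> ran \<rho>" for x
    using that enumerated_set_surj[of "{i. x \<in> B i}"] enum by (auto simp: ran_def)
  moreover have "x \<in> ran \<rho>" if "x \<in> ran ?\<sigma>" for x
    using that enum by (auto simp: ran_def)
  ultimately have ran: "ran \<rho> = ran ?\<sigma>" by blast
  have fwd: "computable_on \<rho> ?\<sigma> (ran \<rho>) id"
  proof -
    \<comment> \<open>Position n codes a ball and a prefix length; an index enters the enumeration
      when its test succeeds on that prefix.\<close>
    let ?f = "\<lambda>p n. if below (pfst (pfst n)) ((1 / 2) ^ psnd (pfst n)) (pre p (psnd n)) then Suc (pfst n) else 0"
    have "tot ?f" by (intro comp_intros dec_below_above rat_intros)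
    from total_tracked[OF this] obtain R where R: "rec2 R" "\<And>p. tracks R p (?f p)" by blast
    have "?\<sigma> (?f p) = Some x" if p: "\<rho> p = Some x" for p x
    proof -
      have x: "x \<in> ran \<rho>" using p by (auto simp: ran_def)
      have "e \<in> enumerated_set (?f p) \<longleftrightarrow> (\<exists>k. below (pfst e) ((1 / 2) ^ psnd e) (pre p k))" for e
      proof
        show "\<exists>k. below (pfst e) ((1 / 2) ^ psnd e) (pre p k)" if "e \<in> enumerated_set (?f p)"
          using that by (auto simp: enumerated_set_def split: if_splits)
        assume "\<exists>k. below (pfst e) ((1 / 2) ^ psnd e) (pre p k)"
        then obtain k where "below (pfst e) ((1 / 2) ^ psnd e) (pre p k)" ..
        then have "?f p (prod_encode (e, k)) = Suc e" by simp
        then show "e \<in> enumerated_set (?f p)" unfolding enumerated_set_def by blast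
      qed
      then have "enumerated_set (?f p) = {e. x \<in> B e}"
        using below_iff[OF p] x by (auto simp: B_def)
      with x show ?thesis unfolding enum by blast
    qed
    with R show ?thesis unfolding computable_on_iff by (intro exI[of _ R]) auto
  qed
  have bwd: "computable_on ?\<sigma> \<rho> (ran ?\<sigma>) id"
  proof -
    \<comment> \<open>Entry n of the Cauchy name is the centre of the first listed ball of radius
      2^-(n+2), which makes the name tight.\<close>
    let ?P = "\<lambda>(q :: nat \<Rightarrow> nat) n m. q m \<noteq> 0 \<and> psnd (q m - 1) = n + 2"
    let ?f = "\<lambda>(q :: nat \<Rightarrow> nat) (n :: nat) m. pfst (q m - 1)"
    have 1: "dec (\<lambda>p m. ?P p (pfst m) (psnd m))" by (intro comp_intros)
    have 2: "tot (\<lambda>p m. ?f p (pfst m) (psnd m))" by (intro comp_intros)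
    obtain R where R: "rec2 R"
      "\<And>p. (\<And>n. \<exists>k. ?P p n k) \<Longrightarrow> tracks R p (\<lambda>n. ?f p n (LEAST k. ?P p n k))"
      using search_tracked[of ?P ?f, OF 1 2] by blast
    have "\<exists>p. tracks (\<lambda>w. T (img R w)) q p \<and> \<rho> p = Some x" if "?\<sigma> q = Some x" for q x
    proof -
      have x: "x \<in> ran \<rho>" and q: "enumerated_set q = {e. x \<in> B e}" using that enum by auto
      have ex: "\<exists>k. ?P q n k" for n
      proof -
        obtain i where "d (a i) (f x) < (1 / 2) ^ (n + 2)" using dense[OF f_in[OF x], of "(1 / 2) ^ (n + 2)"] by auto
        then have "x \<in> B (prod_encode (i, n + 2))" using x by (simp add: B_def)
        then obtain k where "q k = Suc (prod_encode (i, n + 2))" using q unfolding enumerated_set_def by blast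
        then show ?thesis by (intro exI[of _ k]) simp
      qed
      let ?r = "\<lambda>n. ?f q n (LEAST k. ?P q n k)"
      have "d (a (?r n)) (f x) < (1 / 2) ^ (n + 2)" for n
      proof -
        define k where "k = (LEAST k. ?P q n k)"
        have P: "?P q n k" unfolding k_def by (rule LeastI_ex) (rule ex)
        then have "q k - 1 \<in> enumerated_set q" unfolding enumerated_set_def by (auto intro!: exI[of _ k])
        then have "x \<in> B (q k - 1)" using q by blast
        with P show ?thesis unfolding k_def[symmetric] B_def by simp
      qed
      from cauchy_tight[OF x this] have "cauchy_rep M d a ?r = Some (f x)" .
      with T_name[OF x] obtain p where "tracks T ?r p" "\<rho> p = Some x" by blast
      with tracks_img[OF R(2)[OF ex]] show ?thesis by blast
    qed
    with rec2_img[OF R(1) T] show ?thesis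
      unfolding computable_on_iff by (intro exI[of _ "\<lambda>w. T (img R w)"]) auto
  qed
  show ?thesis
    unfolding computably_second_countable_def computably_equivalent_def
    using topology_B inj_on_B B_cover ran fwd bwd by (intro exI[of _ B]) (auto simp: B_def[abs_def])
qed

section \<open>Strong regularity of the embedded space\<close>

definition inner :: "(nat \<Rightarrow> nat) \<Rightarrow> nat \<Rightarrow> nat \<Rightarrow> bool" where
  "inner \<alpha> n v \<longleftrightarrow> accepts \<alpha> (img T (pfst n)) \<and>
     (\<forall>t < len (pfst n). below (ent (pfst n) t) ((1 / 2) ^ (t + 2) - (1 / 2) ^ psnd n) v)"

text \<open>The index n codes a word and a shrinking exponent. If the word is not accepted, the
  complement is everything and the closed set empty, so n can range over all numbers.\<close>

definition outer :: "(nat \<Rightarrow> nat) \<Rightarrow> nat \<Rightarrow> nat \<Rightarrow> bool" where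
  "outer \<alpha> n v \<longleftrightarrow> \<not> accepts \<alpha> (img T (pfst n)) \<or>
     (\<exists>t < len (pfst n). above (ent (pfst n) t) ((1 / 2) ^ (t + 2) - (1 / 2) ^ psnd n) v)"

definition inner_set :: "(nat \<Rightarrow> nat) \<Rightarrow> nat \<Rightarrow> 'a set" where
  "inner_set \<alpha> n = {x \<in> ran \<rho>. accepts \<alpha> (img T (pfst n)) \<and>
     (\<forall>t < len (pfst n). d (a (ent (pfst n) t)) (f x) < (1 / 2) ^ (t + 2) - (1 / 2) ^ psnd n)}"

definition outer_set :: "(nat \<Rightarrow> nat) \<Rightarrow> nat \<Rightarrow> 'a set" where
  "outer_set \<alpha> n = {x \<in> ran \<rho>. accepts \<alpha> (img T (pfst n)) \<and>
     (\<forall>t < len (pfst n). d (a (ent (pfst n) t)) (f x) \<le> (1 / 2) ^ (t + 2) - (1 / 2) ^ psnd n)}"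

lemma semidecides_inner: "semidecides \<rho> (inner \<alpha> n) (inner_set \<alpha> n)"
  unfolding semidecides_def
proof (intro conjI allI impI)
  show "inner_set \<alpha> n \<subseteq> ran \<rho>" by (auto simp: inner_set_def)
  fix p x assume p: "\<rho> p = Some x"
  then have x: "x \<in> ran \<rho>" by (auto simp: ran_def)
  show "x \<in> inner_set \<alpha> n \<longleftrightarrow> (\<exists>k. inner \<alpha> n (pre p k))"
  proof
    show "x \<in> inner_set \<alpha> n" if "\<exists>k. inner \<alpha> n (pre p k)"
      using that x below_above_sound(1)[OF p] unfolding inner_def inner_set_def by blast
    assume *: "x \<in> inner_set \<alpha> n"
    have "\<forall>\<^sub>F k in sequentially. \<forall>t\<in>{..<len (pfst n)}.
        below (ent (pfst n) t) ((1 / 2) ^ (t + 2) - (1 / 2) ^ psnd n) (pre p k)"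
      using * by (intro eventually_ball_finite ballI below_above_complete(1)[OF p]) (auto simp: inner_set_def)
    from eventually_happens'[OF sequentially_bot this] * show "\<exists>k. inner \<alpha> n (pre p k)"
      unfolding inner_def inner_set_def by blast
  qed
qed

lemma semidecides_outer: "semidecides \<rho> (outer \<alpha> n) (ran \<rho> - outer_set \<alpha> n)"
  unfolding semidecides_def
proof (intro conjI allI impI)
  fix p x assume p: "\<rho> p = Some x"
  then have x: "x \<in> ran \<rho>" by (auto simp: ran_def)
  have "(\<exists>k. outer \<alpha> n (pre p k)) \<longleftrightarrow> \<not> accepts \<alpha> (img T (pfst n)) \<or>
     (\<exists>t < len (pfst n). \<exists>k. above (ent (pfst n) t) ((1 / 2) ^ (t + 2) - (1 / 2) ^ psnd n) (pre p k))"
    unfolding outer_def by blast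
  then show "x \<in> ran \<rho> - outer_set \<alpha> n \<longleftrightarrow> (\<exists>k. outer \<alpha> n (pre p k))"
    unfolding above_iff[OF p] using x by (auto simp: outer_set_def not_le)
qed blast

lemma inner_outer_shrinkings:
  assumes "open_rep \<rho> \<alpha> = Some W"
  shows "(inner_set \<alpha>, outer_set \<alpha>) \<in> regular_shrinkings \<rho> W"
proof -
  have op: "openin (final_topology \<rho>) (inner_set \<alpha> n)" for n
    by (rule semidecides_openin[OF semidecides_inner])
  have cl: "closedin (final_topology \<rho>) (outer_set \<alpha> n)" for n
    unfolding closedin_def topspace_final_topology
    using semidecides_openin[OF semidecides_outer] by (auto simp: outer_set_def)
  have io: "inner_set \<alpha> n \<subseteq> outer_set \<alpha> n" for n
    unfolding inner_set_def outer_set_def by (auto intro: less_imp_le)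
  have ow: "outer_set \<alpha> n \<subseteq> W" for n
  proof -
    have "x \<in> cell (pfst n)" if x: "x \<in> outer_set \<alpha> n" for x
    proof -
      have "d (a (ent (pfst n) t)) (f x) < (1 / 2) ^ (t + 2)" if "t < len (pfst n)" for t
      proof -
        have "d (a (ent (pfst n) t)) (f x) \<le> (1 / 2) ^ (t + 2) - (1 / 2) ^ psnd n"
          using x that unfolding outer_set_def by blast
        moreover have "(0 :: real) < (1 / 2) ^ psnd n" by simp
        ultimately show ?thesis by linarith
      qed
      with x show ?thesis unfolding cell_def outer_set_def by blast
    qed
    moreover have "cell (pfst n) \<subseteq> W" if "outer_set \<alpha> n \<noteq> {}"
      using that cell_subset[OF assms] unfolding outer_set_def by blast
    ultimately show ?thesis by blast
  qed
  have "\<exists>n. x \<in> inner_set \<alpha> n" if x: "x \<in> W" for x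
  proof -
    obtain w where w: "accepts \<alpha> (img T w)" "x \<in> cell w" using cell_cover[OF assms x] by blast
    have "\<forall>\<^sub>F m in sequentially. d (a (ent w t)) (f x) < (1 / 2) ^ (t + 2) - (1 / 2) ^ m"
      if "t < len w" for t
    proof (rule order_tendstoD(1))
      have "(\<lambda>m. (1 / 2) ^ (t + 2) - (1 / 2) ^ m) \<longlonglongrightarrow> (1 / 2 :: real) ^ (t + 2) - 0"
        by (intro tendsto_intros LIMSEQ_power_zero) simp
      then show "(\<lambda>m. (1 / 2) ^ (t + 2) - (1 / 2) ^ m) \<longlonglongrightarrow> (1 / 2 :: real) ^ (t + 2)" by simp
      show "d (a (ent w t)) (f x) < (1 / 2) ^ (t + 2)" using w(2) that by (simp add: cell_def)
    qed
    then have "\<forall>\<^sub>F m in sequentially. \<forall>t\<in>{..<len w}. d (a (ent w t)) (f x) < (1 / 2) ^ (t + 2) - (1 / 2) ^ m"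
      by (intro eventually_ball_finite) auto
    from eventually_happens'[OF sequentially_bot this] obtain m where
      "\<forall>t<len w. d (a (ent w t)) (f x) < (1 / 2) ^ (t + 2) - (1 / 2) ^ m" by blast
    with w show ?thesis unfolding inner_set_def cell_def by (intro exI[of _ "prod_encode (w, m)"]) simp
  qed
  then have "W \<subseteq> (\<Union>n. inner_set \<alpha> n)" by blast
  moreover have "inner_set \<alpha> n \<subseteq> W" for n using io ow by (rule order_trans)
  ultimately have "W = (\<Union>n. inner_set \<alpha> n)" by blast
  then show ?thesis
    unfolding regular_shrinkings_def mem_Collect_eq prod.case using op cl io ow by (intro conjI allI)
qed

lemma strongly_computably_regular: "strongly_computably_regular \<rho>"
proof -
  \<comment> \<open>Even and odd positions interleave the open sets with the complements of the
    closed ones. All these sets depend on the name \<open>\<alpha>\<close> and not only on the open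
    set named, which a multifunction permits.\<close>
  define out where "out \<alpha> k = (if even k then name_of (inner \<alpha> (pfst (k div 2))) (psnd (k div 2))
    else name_of (outer \<alpha> (pfst (k div 2))) (psnd (k div 2)))" for \<alpha> k
  have "tot out" unfolding out_def inner_def outer_def
    by (intro comp_intros tot_name_of tot_div dec_accepts tot_img[OF T] dec_below_above rat_intros) simp_all
  from total_tracked[OF this] obtain R where R: "rec2 R" "\<And>\<alpha>. tracks R \<alpha> (out \<alpha>)" by blast
  have "pair_rep (seq_rep (open_rep \<rho>)) (seq_rep (closed_rep \<rho>)) (out \<alpha>) = Some (inner_set \<alpha>, outer_set \<alpha>)" for \<alpha>
  proof -
    have "open_rep \<rho> (\<lambda>m. out \<alpha> (2 * prod_encode (n, m))) = Some (inner_set \<alpha> n)" for n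
      using open_rep_name_of[OF semidecides_inner[of \<alpha> n]] by (simp add: out_def)
    moreover have "open_rep \<rho> (\<lambda>m. out \<alpha> (2 * prod_encode (n, m) + 1)) = Some (ran \<rho> - outer_set \<alpha> n)" for n
      using open_rep_name_of[OF semidecides_outer[of \<alpha> n]] by (simp add: out_def)
    moreover have "outer_set \<alpha> n = ran \<rho> - (ran \<rho> - outer_set \<alpha> n)" for n
      by (auto simp: outer_set_def)
    ultimately show ?thesis
      unfolding pair_rep_eq_Some seq_rep_eq_Some closed_rep_eq_Some by blast
  qed
  then have "computable_multi (open_rep \<rho>) (pair_rep (seq_rep (open_rep \<rho>)) (seq_rep (closed_rep \<rho>)))
      (regular_shrinkings \<rho>)"
    unfolding computable_multi_iff using R inner_outer_shrinkings by blast
  moreover have "regular_shrinkings \<rho> W \<noteq> {}" if "openin (final_topology \<rho>) W" for W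
  proof -
    from that obtain S where "semidecides \<rho> S W" by (rule openin_semidecides)
    from inner_outer_shrinkings[OF open_rep_name_of[OF this]] show ?thesis by blast
  qed
  ultimately show ?thesis unfolding strongly_computably_regular_def by blast
qed

end

theorem metric_embedding_imp_regular:
  assumes M: "computable_metric_space M d a" and "computably_embeds \<rho> (cauchy_rep M d a)"
  shows "computably_second_countable \<rho> \<and> strongly_computably_regular \<rho>"
proof -
  obtain D where D: "\<And>f g h. tot f \<Longrightarrow> tot g \<Longrightarrow> tot h \<Longrightarrow> tot (\<lambda>p n. D (f p n) (g p n) (h p n))"
    "\<And>i j n. \<bar>rat_enum (D i j n) - d (a i) (a j)\<bar> \<le> (1 / 2) ^ n"
    using computable_metric_space_approx[OF M] by blast
  obtain f S T where f: "inj_on f (ran \<rho>)" "rec2 S" "rec2 T"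
    and S: "\<And>p x. \<rho> p = Some x \<Longrightarrow> \<exists>q. tracks S p q \<and> cauchy_rep M d a q = Some (f x)"
    and T: "\<And>q x. x \<in> ran \<rho> \<and> cauchy_rep M d a q = Some (f x) \<Longrightarrow> \<exists>p. tracks T q p \<and> \<rho> p = Some x"
    using assms(2) unfolding computably_embeds_iff by blast
  interpret Metric_space M d using M by (simp add: computable_metric_space_def)
  have range: "range a \<subseteq> M" and dense: "mtopology closure_of range a = M"
    using M by (simp_all add: computable_metric_space_def)
  interpret metric_embedding M d a \<rho> f S T D
  proof
    show "a i \<in> M" for i using range by blast
    show "\<exists>i. d (a i) y < e" if "y \<in> M" "0 < e" for y e
      using that dense unfolding metric_closure_of by (auto simp: mball_def commute)
    show "tot (\<lambda>p n. D (g1 p n) (g2 p n) (g3 p n))" if "tot g1" "tot g2" "tot g3" for g1 g2 g3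
      using that by (rule D(1))
    show "\<bar>rat_enum (D i j n) - d (a i) (a j)\<bar> \<le> (1 / 2) ^ n" for i j n by (rule D(2))
    show "inj_on f (ran \<rho>)" "rec2 S" "rec2 T" by (rule f)+
    show "\<exists>q. tracks S p q \<and> cauchy_rep M d a q = Some (f x)" if "\<rho> p = Some x" for p x
      using that by (rule S)
    show "\<exists>p. tracks T q p \<and> \<rho> p = Some x"
      if "x \<in> ran \<rho>" "cauchy_rep M d a q = Some (f x)" for q x
      using T that by blast
  qed
  show ?thesis using computably_second_countable strongly_computably_regular by blast
qed

theorem theorem8p4:
  fixes \<rho> :: "'a representation"
  shows
    "(computably_embeds \<rho> hilbert_cube_rep \<longleftrightarrow>
        (\<exists>(M :: (nat \<Rightarrow> real) set) d a.
           computable_metric_space M d a \<and> computably_embeds \<rho> (cauchy_rep M d a))) \<and>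
     (computably_embeds \<rho> hilbert_cube_rep \<longleftrightarrow>
        computably_second_countable \<rho> \<and> strongly_computably_regular \<rho>) \<and>
     ((\<exists>(M :: 'b set) d a.
         computable_metric_space M d a \<and> computably_embeds \<rho> (cauchy_rep M d a)) \<longrightarrow>
        computably_embeds \<rho> hilbert_cube_rep)"
proof -
  have embeds_imp_metric: "\<exists>(M :: (nat \<Rightarrow> real) set) d a. computable_metric_space M d a \<and>
      computably_embeds \<rho> (cauchy_rep M d a)" if "computably_embeds \<rho> hilbert_cube_rep"
    using computable_metric_space_cube computably_embeds_trans[OF that hilbert_cube_embeds_cube] by blast
  have regular_imp_embeds: "computably_embeds \<rho> hilbert_cube_rep"
    if "computably_second_countable \<rho> \<and> strongly_computably_regular \<rho>"
    using that regular_imp_computably_embeds by blast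
  have metric_imp_regular: "computably_second_countable \<rho> \<and> strongly_computably_regular \<rho>"
    if "\<exists>(M :: (nat \<Rightarrow> real) set) d a. computable_metric_space M d a \<and> computably_embeds \<rho> (cauchy_rep M d a)"
    using that metric_embedding_imp_regular by blast
  \<comment> \<open>The same argument over an arbitrary carrier type shows that fixing the carrier
    type of the cube in the second statement loses no metric spaces.\<close>
  have metric_imp_regular_any: "computably_second_countable \<rho> \<and> strongly_computably_regular \<rho>"
    if "\<exists>(M :: 'b set) d a. computable_metric_space M d a \<and> computably_embeds \<rho> (cauchy_rep M d a)"
    using that metric_embedding_imp_regular by blast
  show ?thesis
    using embeds_imp_metric regular_imp_embeds metric_imp_regular metric_imp_regular_any by blast
qed

end
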